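(* Let $\mathcal B$ be a separable complex Banach space, $p\in\mathbb N$, $\Phi_1,\dots,\Phi_p\in\mathcal L(\mathcal B)$, $\Phi(z)=I-\sum_{j=1}^p\Phi_jz^j$, and suppose that Assumption A (see context) holds. Let $\widetilde\Phi(z)=I_p-z\widetilde\Phi_1$ be the companion pencil of $\Phi$ on $\mathcal B^p$, let $\widetilde\Phi(z)^{-1}=-\sum_j\widetilde{\mathrm N}_j(z-1)^j$ be its Laurent series near $z=1$, $\widetilde{\mathrm P}=\widetilde{\mathrm N}_{-1}\widetilde\Phi_1$, and $\mathcal K=\operatorname{ran}\widetilde\Phi(1)\cap\ker\widetilde\Phi(1)$. Then $\widetilde\Phi(z)^{-1}$ has a pole of order 2 at $z=1$ if and only if the following I(2) condition holds: $\mathcal K\ne\{0\}$ and $$\mathcal B^p=(\operatorname{ran}\widetilde\Phi(1)+\ker\widetilde\Phi(1))\oplus\widetilde\Phi(1)^g\mathcal K$$ for some choice of $[\operatorname{ran}\widetilde\Phi(1)]_\complement$ and $[\ker\widetilde\Phi(1)]_\complement$. Under the I(2) condition, for some $\eta>0$, $$(1-z)^2\widetilde\Phi(z)^{-1}=-\widetilde{\mathrm N}_{-2}+(1-z)(\widetilde{\mathrm N}_{-2}+\widetilde{\mathrm P})+(1-z)^2H(z),\qquad z\in D_{1+\eta}$$ (the left side being extended holomorphically to $z=1$), where $\operatorname{ran}\widetilde{\mathrm N}_{-2}=\mathcal K$, $H(z)$ is the holomorphic part of the Laurent series of $\widetilde\Phi(z)^{-1}$ around $z=1$, and the Maclaurin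 series of $(1-z)^2\widetilde\Phi(z)^{-1}$ and of $H(z)$ each converge on $D_{1+\eta}$.
   Context: $\mathcal L(\mathcal B)$: bounded linear operators on $\mathcal B$; $\Phi^{(1)}$: derivative of $\Phi$; $\sigma(A)=\{z\in\mathbb C: A(z)\text{ not invertible}\}$; $D_R$: open disk of radius $R$ centered at $0$. Direct sums $\oplus$ are between closed subspaces; a complementary subspace of $V$ is a (closed) $V_\complement$ with $V\oplus V_\complement$ equal to the whole space, and $\mathrm P_{V_\complement}$ is the bounded projection with range $V_\complement$ and kernel $V$. $\mathcal B^p$ carries the norm $\|(x_1,\dots,x_p)\|=\sum_j\|x_j\|$, $I_p$ is its identity, $\widetilde\Phi_1(x_1,\dots,x_p)=(\sum_{j=1}^p\Phi_jx_j,\,x_1,\dots,x_{p-1})$. One has $\sigma(\widetilde\Phi)=\sigma(\Phi)$. The holomorphic part is $H(z)=-\sum_{j\ge0}\widetilde{\mathrm N}_j(z-1)^j$ (continued holomorphically). Assumption A. (a) $\sigma(\Phi)\cap D_{1+\eta}=\{1\}$ for some $\eta>0$ and $\Phi(1)\ne0$; there are (fixed) complementary subspaces with $\mathcal B=\operatorname{ran}\Phi(1)\oplus[\operatorname{ran}\Phi(1)]_\complement=\ker\Phi(1)\oplus[\ker\Phi(1)]_\complement$ (taken to be orthogonal complements if $\mathcal B$ is a Hilbert space); and the I(1) condition fails, i.e. $\mathcal B^p\ne\operatorname{ran}\widetilde\Phi(1)\oplus\ker\widetilde\Phi(1)$ (equivalently, $\mathrm P_{[\operatorname{ran}\Phi(1)]_\complement}\Phi^{(1)}(1):\ker\Phi(1)\to[\operatorname{ran}\Phi(1)]_\complement$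 is not invertible). (b) With $\mathsf R=\mathrm P_{[\operatorname{ran}\Phi(1)]_\complement}\Phi^{(1)}(1)\ker\Phi(1)$ and $\mathsf K=\{x\in\ker\Phi(1):\Phi^{(1)}(1)x\in\operatorname{ran}\Phi(1)\}$, there are subspaces $\mathsf R_\complement,\mathsf K_\complement$ with $[\operatorname{ran}\Phi(1)]_\complement=\mathsf R\oplus\mathsf R_\complement$ and $\ker\Phi(1)=\mathsf K\oplus\mathsf K_\complement$. Under Assumption A, $\operatorname{ran}\widetilde\Phi(1)$ and $\ker\widetilde\Phi(1)$ have complementary subspaces $[\operatorname{ran}\widetilde\Phi(1)]_\complement$, $[\ker\widetilde\Phi(1)]_\complement$ in $\mathcal B^p$. For given choices, the generalized inverse $\widetilde\Phi(1)^g\in\mathcal L(\mathcal B^p)$ is $\widetilde\Phi(1)^g=\big(\widetilde\Phi(1)|_{[\ker\widetilde\Phi(1)]_\complement}:[\ker\widetilde\Phi(1)]_\complement\to\operatorname{ran}\widetilde\Phi(1)\big)^{-1}(I_p-\mathrm P_{[\operatorname{ran}\widetilde\Phi(1)]_\complement})$; it satisfies $\widetilde\Phi(1)\widetilde\Phi(1)^g=I_p-\mathrm P_{[\operatorname{ran}\widetilde\Phi(1)]_\complement}$ and $\widetilde\Phi(1)^g\widetilde\Phi(1)=\mathrm P_{[\ker\widetilde\Phi(1)]_\complement}$. *)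

theory Defs
  imports "HOL-Analysis.Analysis"
begin

section \<open>Complex normed and Banach spaces\<close>

class complex_normed_vector = real_normed_vector +
  fixes scaleC :: "complex \<Rightarrow> 'a \<Rightarrow> 'a"  (infixr "*\<^sub>C" 75)
  assumes scaleC_add_right: "c *\<^sub>C (x + y) = c *\<^sub>C x + c *\<^sub>C y"
    and scaleC_add_left: "(c + d) *\<^sub>C x = c *\<^sub>C x + d *\<^sub>C x"
    and scaleC_scaleC: "c *\<^sub>C (d *\<^sub>C x) = (c * d) *\<^sub>C x"
    and scaleR_scaleC: "scaleR r x = complex_of_real r *\<^sub>C x"
    and norm_scaleC: "norm (c *\<^sub>C x) = cmod c * norm x"

class cbanach = complex_normed_vector + complete_space
begin
subclass banach ..
end

global_interpretation complex_vector:
  vector_space "scaleC :: complex \<Rightarrow> 'a \<Rightarrow> 'a::complex_normed_vector"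
  by unfold_locales
    (simp_all add: scaleC_add_right scaleC_add_left scaleC_scaleC, metis of_real_1 scaleR_one scaleR_scaleC)

lemma scaleR_scaleC_commute: "r *\<^sub>R c *\<^sub>C x = c *\<^sub>C r *\<^sub>R (x :: 'a::complex_normed_vector)"
  by (simp only: scaleR_scaleC scaleC_scaleC mult.commute)

abbreviation csubspace :: "'a::complex_normed_vector set \<Rightarrow> bool" where
  "csubspace \<equiv> module.subspace scaleC"

text \<open>Inner products (linear in the first argument) inducing the given norm; a Banach space is a
  Hilbert space iff it has one.\<close>

definition norm_inner_product :: "('a::complex_normed_vector \<Rightarrow> 'a \<Rightarrow> complex) \<Rightarrow> bool" where
  "norm_inner_product ip \<longleftrightarrow>
     (\<forall>x y z. ip (x + y) z = ip x z + ip y z) \<and>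
     (\<forall>c x y. ip (c *\<^sub>C x) y = c * ip x y) \<and>
     (\<forall>x y. ip y x = cnj (ip x y)) \<and>
     (\<forall>x. ip x x = complex_of_real ((norm x)\<^sup>2))"

definition orthogonal_complement_wrt :: "('a \<Rightarrow> 'a \<Rightarrow> complex) \<Rightarrow> 'a set \<Rightarrow> 'a set" where
  "orthogonal_complement_wrt ip V = {x. \<forall>y\<in>V. ip x y = 0}"

section \<open>Bounded complex-linear operators with the operator norm\<close>

typedef (overloaded) ('a, 'b) cblinfun =
  "{f :: 'a::complex_normed_vector \<Rightarrow> 'b::complex_normed_vector.
      bounded_linear f \<and> (\<forall>c x. f (c *\<^sub>C x) = c *\<^sub>C f x)}"
  morphisms cblinfun_apply CBlinfun
  by (rule exI[of _ "\<lambda>_. 0"]) simp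

declare [[coercion cblinfun_apply]]

setup_lifting type_definition_cblinfun

instantiation cblinfun :: (complex_normed_vector, complex_normed_vector) complex_normed_vector
begin

lift_definition zero_cblinfun :: "('a, 'b) cblinfun" is "\<lambda>_. 0" by simp
lift_definition plus_cblinfun :: "('a, 'b) cblinfun \<Rightarrow> ('a, 'b) cblinfun \<Rightarrow> ('a, 'b) cblinfun"
  is "\<lambda>f g x. f x + g x" by (auto simp: bounded_linear_add scaleC_add_right)
lift_definition minus_cblinfun :: "('a, 'b) cblinfun \<Rightarrow> ('a, 'b) cblinfun \<Rightarrow> ('a, 'b) cblinfun"
  is "\<lambda>f g x. f x - g x"
  by (auto simp: bounded_linear_sub complex_vector.scale_right_diff_distrib)
lift_definition uminus_cblinfun :: "('a, 'b) cblinfun \<Rightarrow> ('a, 'b) cblinfun"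
  is "\<lambda>f x. - f x" by (auto simp: bounded_linear_minus)
lift_definition scaleC_cblinfun :: "complex \<Rightarrow> ('a, 'b) cblinfun \<Rightarrow> ('a, 'b) cblinfun"
  is "\<lambda>c f x. c *\<^sub>C f x"
proof -
  fix c and f :: "'a \<Rightarrow> 'b"
  assume f: "bounded_linear f \<and> (\<forall>c x. f (c *\<^sub>C x) = c *\<^sub>C f x)"
  have "bounded_linear (\<lambda>y::'b. c *\<^sub>C y)"
    by (rule bounded_linear_intro[where K = "cmod c"])
      (simp_all add: scaleC_add_right scaleR_scaleC scaleC_scaleC norm_scaleC mult.commute)
  then show "bounded_linear (\<lambda>x. c *\<^sub>C f x) \<and> (\<forall>d x. c *\<^sub>C f (d *\<^sub>C x) = d *\<^sub>C c *\<^sub>C f x)"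
    using f by (auto simp: bounded_linear_compose scaleC_scaleC mult.commute)
qed
lift_definition scaleR_cblinfun :: "real \<Rightarrow> ('a, 'b) cblinfun \<Rightarrow> ('a, 'b) cblinfun"
  is "\<lambda>r f x. r *\<^sub>R f x"
  by (auto simp: scaleR_scaleC_commute bounded_linear_const_scaleR)
lift_definition norm_cblinfun :: "('a, 'b) cblinfun \<Rightarrow> real" is onorm .
definition dist_cblinfun :: "('a, 'b) cblinfun \<Rightarrow> ('a, 'b) cblinfun \<Rightarrow> real" where
  "dist_cblinfun a b = norm (a - b)"
definition
  "(uniformity :: (('a, 'b) cblinfun \<times> ('a, 'b) cblinfun) filter) =
     (INF e\<in>{0 <..}. principal {(x, y). dist x y < e})"
definition open_cblinfun :: "('a, 'b) cblinfun set \<Rightarrow> bool" where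
  "open_cblinfun S = (\<forall>x\<in>S. \<forall>\<^sub>F (x', y) in uniformity. x' = x \<longrightarrow> y \<in> S)"
definition sgn_cblinfun :: "('a, 'b) cblinfun \<Rightarrow> ('a, 'b) cblinfun" where
  "sgn_cblinfun x = scaleR (inverse (norm x)) x"

instance
proof
  fix A B :: "('a, 'b) cblinfun" and r :: real and c :: complex
  show "dist A B = norm (A - B)" by (simp add: dist_cblinfun_def)
  show "sgn A = inverse (norm A) *\<^sub>R A" by (simp add: sgn_cblinfun_def)
  show "(norm A = 0) = (A = 0)"
    by transfer (auto simp: onorm_eq_0 fun_eq_iff)
  show "norm (A + B) \<le> norm A + norm B"
    by transfer (auto simp: onorm_triangle)
  show "norm (r *\<^sub>R A) = \<bar>r\<bar> * norm A"
    by transfer (auto simp: onorm_scaleR)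
  show "r *\<^sub>R A = complex_of_real r *\<^sub>C A"
    by transfer (simp add: scaleR_scaleC)
  have cn: "norm (c *\<^sub>C A) \<le> cmod c * norm A" for c and A :: "('a, 'b) cblinfun"
  proof transfer
    fix c and f :: "'a \<Rightarrow> 'b"
    assume f: "bounded_linear f \<and> (\<forall>c x. f (c *\<^sub>C x) = c *\<^sub>C f x)"
    show "onorm (\<lambda>x. c *\<^sub>C f x) \<le> cmod c * onorm f"
    proof (rule onorm_bound)
      show "0 \<le> cmod c * onorm f" using f by (simp add: onorm_pos_le)
      fix x show "norm (c *\<^sub>C f x) \<le> cmod c * onorm f * norm x"
        using f by (simp add: norm_scaleC mult.assoc mult_left_mono onorm)
    qed
  qed
  show "norm (c *\<^sub>C A) = cmod c * norm A"
  proof (cases "c = 0")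
    case True
    have "(0::complex) *\<^sub>C A = 0" by transfer simp
    then have "norm (0 *\<^sub>C A) \<le> 0" using cn[of 0 A] by simp
    moreover have "norm (0 *\<^sub>C A) \<ge> 0" by transfer (simp add: onorm_zero)
    ultimately show ?thesis using True by simp
  next
    case False
    have "A = inverse c *\<^sub>C (c *\<^sub>C A)"
      using False by transfer (simp add: scaleC_scaleC)
    then have "norm A \<le> cmod (inverse c) * norm (c *\<^sub>C A)" using cn by metis
    then have "cmod c * norm A \<le> norm (c *\<^sub>C A)"
      using False by (simp add: norm_divide divide_simps mult.commute)
    then show ?thesis using cn[of c A] by simp
  qed
  fix u v w :: "('a, 'b) cblinfun" and q s :: real and d e :: complex
  show "u + v + w = u + (v + w)" "u + v = v + u" "0 + u = u" "- u + u = 0" "u - v = u + - v"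
    by (transfer; simp add: fun_eq_iff algebra_simps)+
  show "q *\<^sub>R (u + v) = q *\<^sub>R u + q *\<^sub>R v" "(q + s) *\<^sub>R u = q *\<^sub>R u + s *\<^sub>R u"
    "q *\<^sub>R s *\<^sub>R u = (q * s) *\<^sub>R u" "1 *\<^sub>R u = u"
    by (transfer; simp add: fun_eq_iff scaleR_add_left scaleR_add_right)+
  show "d *\<^sub>C (u + v) = d *\<^sub>C u + d *\<^sub>C v" "(d + e) *\<^sub>C u = d *\<^sub>C u + e *\<^sub>C u"
    "d *\<^sub>C e *\<^sub>C u = (d * e) *\<^sub>C u"
    by (transfer; simp add: fun_eq_iff scaleC_add_right scaleC_add_left scaleC_scaleC)+
qed (simp_all add: uniformity_cblinfun_def open_cblinfun_def)

end

lift_definition id_cblinfun :: "('a::complex_normed_vector, 'a) cblinfun" is "\<lambda>x. x"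
  by simp

lift_definition cblinfun_compose ::
    "('b::complex_normed_vector, 'c::complex_normed_vector) cblinfun \<Rightarrow>
     ('a::complex_normed_vector, 'b) cblinfun \<Rightarrow> ('a, 'c) cblinfun"  (infixl "o\<^sub>C" 55)
  is "\<lambda>f g x. f (g x)"
  by (auto simp: bounded_linear_compose)

definition ran :: "('a::complex_normed_vector, 'b::complex_normed_vector) cblinfun \<Rightarrow> 'b set" where
  "ran A = range (cblinfun_apply A)"

definition ker :: "('a::complex_normed_vector, 'b::complex_normed_vector) cblinfun \<Rightarrow> 'a set" where
  "ker A = {x. A x = 0}"

definition is_inverse :: "('a::complex_normed_vector, 'a) cblinfun \<Rightarrow> ('a, 'a) cblinfun \<Rightarrow> bool" where
  "is_inverse A B \<longleftrightarrow> A o\<^sub>C B = id_cblinfun \<and> B o\<^sub>C A = id_cblinfun"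

definition op_invertible :: "('a::complex_normed_vector, 'a) cblinfun \<Rightarrow> bool" where
  "op_invertible A \<longleftrightarrow> (\<exists>B. is_inverse A B)"

definition op_inverse :: "('a::complex_normed_vector, 'a) cblinfun \<Rightarrow> ('a, 'a) cblinfun" where
  "op_inverse A = (THE B. is_inverse A B)"

definition pencil_spectrum :: "(complex \<Rightarrow> ('a::complex_normed_vector, 'a) cblinfun) \<Rightarrow> complex set" where
  "pencil_spectrum A = {z. \<not> op_invertible (A z)}"

section \<open>Direct sums, projections, generalized inverses\<close>

definition sum_set :: "'a::complex_normed_vector set \<Rightarrow> 'a set \<Rightarrow> 'a set" where
  "sum_set V W = {v + w |v w. v \<in> V \<and> w \<in> W}"

definition is_direct_sum :: "'a::complex_normed_vector set \<Rightarrow> 'a set \<Rightarrow> 'a set \<Rightarrow> bool" where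
  "is_direct_sum U V W \<longleftrightarrow>
     csubspace V \<and> closed V \<and> csubspace W \<and> closed W \<and> V \<inter> W = {0} \<and> U = sum_set V W"

abbreviation is_complement :: "'a::complex_normed_vector set \<Rightarrow> 'a set \<Rightarrow> bool" where
  "is_complement V Vc \<equiv> is_direct_sum UNIV V Vc"

text \<open>\<open>proj_onto Vc V\<close> is the projection \<open>P\<close> onto \<open>Vc\<close> along \<open>V\<close>; it is
  only meaningful if \<open>is_complement V Vc\<close>.\<close>

definition proj_onto :: "'a::complex_normed_vector set \<Rightarrow> 'a set \<Rightarrow> ('a, 'a) cblinfun" where
  "proj_onto Vc V = (THE P. P o\<^sub>C P = P \<and> ran P = Vc \<and> ker P = V)"

text \<open>Here \<open>Rc\<close> and \<open>Kc\<close> are complements of \<open>ran A\<close> and \<open>ker A\<close>, so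
  that \<open>A\<close> maps \<open>Kc\<close> bijectively onto \<open>ran A\<close>, which contains the argument of
  \<open>inv_into\<close>.\<close>

definition gen_inverse ::
    "('a::complex_normed_vector, 'a) cblinfun \<Rightarrow> 'a set \<Rightarrow> 'a set \<Rightarrow> 'a \<Rightarrow> 'a" where
  "gen_inverse A Rc Kc y = inv_into Kc (cblinfun_apply A) ((id_cblinfun - proj_onto Rc (ran A)) y)"

section \<open>Vector-valued holomorphic functions and Laurent series\<close>

definition has_cderiv :: "(complex \<Rightarrow> 'a::complex_normed_vector) \<Rightarrow> 'a \<Rightarrow> complex \<Rightarrow> bool" where
  "has_cderiv F D z \<longleftrightarrow> (F has_derivative (\<lambda>h. h *\<^sub>C D)) (at z)"

definition cderiv :: "(complex \<Rightarrow> 'a::complex_normed_vector) \<Rightarrow> complex \<Rightarrow> 'a" where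
  "cderiv F z = (THE D. has_cderiv F D z)"

text \<open>To be used for open \<open>S\<close> only.\<close>

definition vholomorphic_on :: "(complex \<Rightarrow> 'a::complex_normed_vector) \<Rightarrow> complex set \<Rightarrow> bool" where
  "vholomorphic_on F S \<longleftrightarrow> (\<forall>z\<in>S. \<exists>D. has_cderiv F D z)"

definition maclaurin_series_converges_on ::
    "(complex \<Rightarrow> 'a::complex_normed_vector) \<Rightarrow> complex set \<Rightarrow> bool" where
  "maclaurin_series_converges_on F S \<longleftrightarrow>
     (\<forall>z\<in>S. (\<lambda>n. (z ^ n / fact n) *\<^sub>C (cderiv ^^ n) F 0) sums F z)"

text \<open>Laurent series converge absolutely on their annulus, so the unordered two-sided sum is no
  restriction.\<close>

definition has_laurent_series ::
    "(complex \<Rightarrow> 'a::complex_normed_vector) \<Rightarrow> complex \<Rightarrow> (int \<Rightarrow> 'a) \<Rightarrow> bool" where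
  "has_laurent_series F a C \<longleftrightarrow>
     (\<exists>r>0. \<forall>z\<in>ball a r - {a}. ((\<lambda>j. ((z - a) powi j) *\<^sub>C C j) has_sum F z) UNIV)"

definition laurent_coeff :: "(complex \<Rightarrow> 'a::complex_normed_vector) \<Rightarrow> complex \<Rightarrow> int \<Rightarrow> 'a" where
  "laurent_coeff F a = (THE C. has_laurent_series F a C)"

definition has_pole_of_order ::
    "(complex \<Rightarrow> 'a::complex_normed_vector) \<Rightarrow> complex \<Rightarrow> nat \<Rightarrow> bool" where
  "has_pole_of_order F a m \<longleftrightarrow>
     m > 0 \<and> (\<exists>C. has_laurent_series F a C \<and> C (- int m) \<noteq> 0 \<and> (\<forall>j < - int m. C j = 0))"

section \<open>The product space\<close>

text \<open>\<open>('a, 'p) pow\<close> is the space of \<open>p\<close>-tuples over \<open>'a\<close> with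
  \<open>p = CARD('p)\<close>. The components are indexed by the numbers \<open>1, \<dots>, p\<close> (only the
  cardinality of \<open>'p\<close> matters) and the norm is the sum of the norms of the components.\<close>

typedef (overloaded) ('a, 'p) pow =
  "{x :: nat \<Rightarrow> 'a::complex_normed_vector. \<forall>i. i \<notin> {1..CARD('p::finite)} \<longrightarrow> x i = 0}"
  morphisms component Pow_vec
  by (rule exI[of _ "\<lambda>_. 0"]) simp

setup_lifting type_definition_pow

instantiation pow :: (complex_normed_vector, finite) complex_normed_vector
begin

lift_definition zero_pow :: "('a, 'b) pow" is "\<lambda>_. 0" by simp
lift_definition plus_pow :: "('a, 'b) pow \<Rightarrow> ('a, 'b) pow \<Rightarrow> ('a, 'b) pow"
  is "\<lambda>x y i. x i + y i" by simp
lift_definition minus_pow :: "('a, 'b) pow \<Rightarrow> ('a, 'b) pow \<Rightarrow> ('a, 'b) pow"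
  is "\<lambda>x y i. x i - y i" by simp
lift_definition uminus_pow :: "('a, 'b) pow \<Rightarrow> ('a, 'b) pow"
  is "\<lambda>x i. - x i" by simp
lift_definition scaleC_pow :: "complex \<Rightarrow> ('a, 'b) pow \<Rightarrow> ('a, 'b) pow"
  is "\<lambda>c x i. c *\<^sub>C x i" by simp
lift_definition scaleR_pow :: "real \<Rightarrow> ('a, 'b) pow \<Rightarrow> ('a, 'b) pow"
  is "\<lambda>r x i. r *\<^sub>R x i" by simp
lift_definition norm_pow :: "('a, 'b) pow \<Rightarrow> real"
  is "\<lambda>x. \<Sum>i = 1..CARD('b). norm (x i)" .
definition dist_pow :: "('a, 'b) pow \<Rightarrow> ('a, 'b) pow \<Rightarrow> real" where
  "dist_pow a b = norm (a - b)"
definition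
  "(uniformity :: (('a, 'b) pow \<times> ('a, 'b) pow) filter) =
     (INF e\<in>{0 <..}. principal {(x, y). dist x y < e})"
definition open_pow :: "('a, 'b) pow set \<Rightarrow> bool" where
  "open_pow S = (\<forall>x\<in>S. \<forall>\<^sub>F (x', y) in uniformity. x' = x \<longrightarrow> y \<in> S)"
definition sgn_pow :: "('a, 'b) pow \<Rightarrow> ('a, 'b) pow" where
  "sgn_pow x = scaleR (inverse (norm x)) x"

instance
proof
  fix x y :: "('a, 'b) pow" and r :: real and c :: complex
  show "dist x y = norm (x - y)" by (simp add: dist_pow_def)
  show "sgn x = inverse (norm x) *\<^sub>R x" by (simp add: sgn_pow_def)
  show "(norm x = 0) = (x = 0)"
    by transfer (auto simp: fun_eq_iff sum_nonneg_eq_0_iff)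
  show "norm (x + y) \<le> norm x + norm y"
    by transfer (simp add: sum_mono norm_triangle_ineq flip: sum.distrib)
  show "norm (r *\<^sub>R x) = \<bar>r\<bar> * norm x"
    by transfer (simp add: sum_distrib_left)
  show "norm (c *\<^sub>C x) = cmod c * norm x"
    by transfer (simp add: norm_scaleC sum_distrib_left)
  show "r *\<^sub>R x = complex_of_real r *\<^sub>C x"
    by transfer (simp add: scaleR_scaleC)
  fix u v w :: "('a, 'b) pow" and q s :: real and d e :: complex
  show "u + v + w = u + (v + w)" "u + v = v + u" "0 + u = u" "- u + u = 0" "u - v = u + - v"
    by (transfer; simp add: fun_eq_iff algebra_simps)+
  show "q *\<^sub>R (u + v) = q *\<^sub>R u + q *\<^sub>R v" "(q + s) *\<^sub>R u = q *\<^sub>R u + s *\<^sub>R u"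
    "q *\<^sub>R s *\<^sub>R u = (q * s) *\<^sub>R u" "1 *\<^sub>R u = u"
    by (transfer; simp add: fun_eq_iff scaleR_add_left scaleR_add_right)+
  show "d *\<^sub>C (u + v) = d *\<^sub>C u + d *\<^sub>C v" "(d + e) *\<^sub>C u = d *\<^sub>C u + e *\<^sub>C u"
    "d *\<^sub>C e *\<^sub>C u = (d * e) *\<^sub>C u"
    by (transfer; simp add: fun_eq_iff scaleC_add_right scaleC_add_left scaleC_scaleC)+
qed (simp_all add: uniformity_pow_def open_pow_def)

end

section \<open>The pencil and its companion pencil\<close>

definition pencil ::
    "nat \<Rightarrow> (nat \<Rightarrow> ('a::complex_normed_vector, 'a) cblinfun) \<Rightarrow> complex \<Rightarrow> ('a, 'a) cblinfun" where
  "pencil p \<Phi> z = id_cblinfun - (\<Sum>j = 1..p. z ^ j *\<^sub>C \<Phi> j)"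

lift_definition companion_fun ::
    "(nat \<Rightarrow> 'a \<Rightarrow> 'a) \<Rightarrow> ('a::complex_normed_vector, 'p::finite) pow \<Rightarrow> ('a, 'p) pow"
  is "\<lambda>\<Phi> x i. if i = 1 then (\<Sum>j = 1..CARD('p). \<Phi> j (x j))
                else if i \<in> {2..CARD('p)} then x (i - 1) else 0"
  by (auto simp: Suc_le_eq)

lift_definition companion ::
    "(nat \<Rightarrow> ('a::complex_normed_vector, 'a) cblinfun) \<Rightarrow> (('a, 'p::finite) pow, ('a, 'p) pow) cblinfun"
  is "companion_fun"
proof -
  fix \<Phi> :: "nat \<Rightarrow> 'a \<Rightarrow> 'a"
  assume \<Phi>: "\<And>j. bounded_linear (\<Phi> j) \<and> (\<forall>c x. \<Phi> j (c *\<^sub>C x) = c *\<^sub>C \<Phi> j x)"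
  define M where "M = (\<Sum>j = 1..CARD('p). onorm (\<Phi> j))"
  have lin: "\<Phi> j (x + y) = \<Phi> j x + \<Phi> j y" "\<Phi> j (r *\<^sub>R x) = r *\<^sub>R \<Phi> j x" for j x y r
    using \<Phi>[of j] by (auto simp: linear_simps)
  have "bounded_linear (companion_fun \<Phi> :: ('a, 'p) pow \<Rightarrow> ('a, 'p) pow)"
  proof (rule bounded_linear_intro[where K = "M + 1"])
    fix x y :: "('a, 'p) pow" and r :: real
    show "companion_fun \<Phi> (x + y) = companion_fun \<Phi> x + companion_fun \<Phi> y"
      by (auto simp: fun_eq_iff lin sum.distrib companion_fun.rep_eq plus_pow.rep_eq simp flip: component_inject)
    show "companion_fun \<Phi> (r *\<^sub>R x) = r *\<^sub>R companion_fun \<Phi> x"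
      by (auto simp: fun_eq_iff lin scaleR_sum_right companion_fun.rep_eq scaleR_pow.rep_eq simp flip: component_inject)
    show "norm (companion_fun \<Phi> x) \<le> norm x * (M + 1)"
    proof -
      let ?x = "component x"
      let ?p = "CARD('p)" and ?s = "\<Sum>i = 1..CARD('p). norm (?x i)"
      let ?y = "\<lambda>i. if i = 1 then \<Sum>j = 1..?p. \<Phi> j (?x j) else if i \<in> {2..?p} then ?x (i - 1) else 0"
      have p: "?p \<ge> 1" by (simp add: Suc_le_eq)
      have "norm (\<Phi> j (?x j)) \<le> onorm (\<Phi> j) * ?s" if "j \<in> {1..?p}" for j
      proof -
        have "norm (?x j) \<le> ?s"
          using that by (intro member_le_sum) auto
        then have "onorm (\<Phi> j) * norm (?x j) \<le> onorm (\<Phi> j) * ?s"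
          using \<Phi> by (simp add: mult_left_mono onorm_pos_le)
        then show ?thesis using \<Phi> onorm[of "\<Phi> j" "?x j"] by simp
      qed
      then have 1: "norm (\<Sum>j = 1..?p. \<Phi> j (?x j)) \<le> (\<Sum>j = 1..?p. onorm (\<Phi> j)) * ?s"
        unfolding sum_distrib_right by (rule sum_norm_le)
      have "(\<Sum>i = 2..?p. norm (?x (i - 1))) = (\<Sum>i \<in> (\<lambda>i. i - 1) ` {2..?p}. norm (?x i))"
        by (subst sum.reindex) (auto simp: inj_on_def)
      also have "\<dots> \<le> ?s"
        by (intro sum_mono2) auto
      finally have 2: "(\<Sum>i = 2..?p. norm (?x (i - 1))) \<le> ?s" .
      have "{1..?p} = insert 1 {2..?p}" using p by auto
      then have "(\<Sum>i = 1..?p. norm (?y i)) =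
          norm (\<Sum>j = 1..?p. \<Phi> j (?x j)) + (\<Sum>i = 2..?p. norm (?y i))"
        by simp
      also have "(\<Sum>i = 2..?p. norm (?y i)) = (\<Sum>i = 2..?p. norm (?x (i - 1)))"
        by (intro sum.cong) auto
      finally have "(\<Sum>i = 1..?p. norm (?y i)) \<le> ?s * ((\<Sum>j = 1..?p. onorm (\<Phi> j)) + 1)"
        using 1 2 by (simp add: algebra_simps)
      then show ?thesis by (simp add: norm_pow.rep_eq companion_fun.rep_eq M_def)
    qed
  qed
  moreover have "companion_fun \<Phi> (c *\<^sub>C x) = c *\<^sub>C companion_fun \<Phi> x"
    for c and x :: "('a, 'p) pow"
    using \<Phi> by (auto simp: fun_eq_iff complex_vector.scale_sum_right companion_fun.rep_eq scaleC_pow.rep_eq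
        simp flip: component_inject)
  ultimately show "bounded_linear (companion_fun \<Phi> :: ('a, 'p) pow \<Rightarrow> ('a, 'p) pow) \<and>
      (\<forall>c x. companion_fun \<Phi> (c *\<^sub>C x) = c *\<^sub>C (companion_fun \<Phi> x :: ('a, 'p) pow))"
    by blast
qed

definition companion_pencil ::
    "(nat \<Rightarrow> ('a::complex_normed_vector, 'a) cblinfun) \<Rightarrow> complex \<Rightarrow>
       (('a, 'p::finite) pow, ('a, 'p) pow) cblinfun" where
  "companion_pencil \<Phi> z = id_cblinfun - z *\<^sub>C companion \<Phi>"

section \<open>The I(2) condition\<close>

definition I2_condition :: "('a::complex_normed_vector, 'a) cblinfun \<Rightarrow> bool" where
  "I2_condition A \<longleftrightarrow>
     ran A \<inter> ker A \<noteq> {0} \<and>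
     (\<exists>Rc Kc. is_complement (ran A) Rc \<and> is_complement (ker A) Kc \<and>
        is_direct_sum UNIV (sum_set (ran A) (ker A)) (gen_inverse A Rc Kc ` (ran A \<inter> ker A)))"

end

theory Submission
  imports Defs
begin

text \<open>
  Write \<open>T\<close> for the companion operator and \<open>A = I - T\<close>, so that \<open>A(z) = I - z T\<close> and
  \<open>\<Phi>t 1 = A\<close>. If the resolvent has the form
  \<open>A(z)\<^sup>-\<^sup>1 = C\<^sub>-\<^sub>2 (z - 1)\<^sup>-\<^sup>2 + C\<^sub>-\<^sub>1 (z - 1)\<^sup>-\<^sup>1 + C\<^sub>0 + \<dots>\<close>, comparison of coefficients gives
  \<open>ran C\<^sub>-\<^sub>2 = ran A \<inter> ker A\<close>, \<open>ran A + ker A = ker C\<^sub>-\<^sub>2\<close> and \<open>A x = - C\<^sub>-\<^sub>2 x\<close> for \<open>x \<in> ker A\<^sup>2\<close>,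
  from which the I(2) decomposition can be read off. Conversely, I(2) says that \<open>ker A\<^sup>3 = ker A\<^sup>2\<close> and
  \<open>ran A\<^sup>2 = ran A\<^sup>3\<close>. The open mapping principle then yields a bounded projection \<open>E\<close> onto \<open>ran A\<^sup>2\<close>
  along \<open>ker A\<^sup>2\<close>. It commutes with \<open>T\<close>, the pencil \<open>I - z T E\<close> is invertible on the whole disk,
  including \<open>z = 1\<close>, and
  \<open>A(z)\<^sup>-\<^sup>1 = (I - z T E)\<^sup>-\<^sup>1 E + (1 - z)\<^sup>-\<^sup>1 (I + A) (I - E) - (1 - z)\<^sup>-\<^sup>2 A (I - E)\<close>.
  So \<open>H(z) = (I - z T E)\<^sup>-\<^sup>1 E\<close>, and its Maclaurin series is the Neumann series, which converges on the
  disk by the spectral radius formula. The complements of \<open>ran A\<close> and \<open>ker A\<close> come from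
  those of \<open>ran \<Phi>(1)\<close> and \<open>ker \<Phi>(1)\<close> by solving \<open>A x = y\<close> row by row.
\<close>

section \<open>Bounded complex-linear operators\<close>

text \<open>Finite averages over roots of unity take the place of contour integrals. They give
  uniqueness of Laurent coefficients, on which comparing coefficients rests, and the spectral radius
  bound, which turns invertibility of \<open>I - z T E\<close> on the disk into convergence of its
  Neumann series there, however large the norm of \<open>T E\<close> is. The open mapping principle
  is proved for closed linear relations, so that one argument covers bounded inverses, projections
  along complements and the bounded choice of preimages behind \<open>E\<close>. I(2) becomes
  algebraic because the generalized inverse maps \<open>ran A \<inter> ker A\<close> onto
  \<open>Kc \<inter> ker A^2\<close>. The singular terms of the resolvent come from
  \<open>ker A^2\<close>: there \<open>I - z T = (1 - z) I + z A\<close> with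
  \<open>A^2 = 0\<close>, whose inverse is \<open>(1 - z)^-1 I - z (1 - z)^-2 A\<close>. Writing
  \<open>z = 1 - (1 - z)\<close> produces the factor \<open>I + A\<close>.\<close>

lemmas cblinfun_apply_simps =
  zero_cblinfun.rep_eq plus_cblinfun.rep_eq minus_cblinfun.rep_eq uminus_cblinfun.rep_eq
  scaleC_cblinfun.rep_eq id_cblinfun.rep_eq cblinfun_compose.rep_eq

lemma bounded_linear_cblinfun [simp]: "bounded_linear (cblinfun_apply f)"
  using cblinfun_apply[of f] by simp

lemma cblinfun_scaleC [simp]: "f (c *\<^sub>C x) = c *\<^sub>C f x"
  for f :: "('a::complex_normed_vector, 'b::complex_normed_vector) cblinfun"
  using cblinfun_apply[of f] by simp

lemma cblinfun_linear_simps [simp]: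
  fixes f :: "('a::complex_normed_vector, 'b::complex_normed_vector) cblinfun"
  shows "f (x + y) = f x + f y" "f (x - y) = f x - f y" "f (- x) = - f x" "f 0 = 0"
  using linear_simps[OF bounded_linear_cblinfun[of f]] by auto

lemma cblinfun_eqI: "(\<And>x. cblinfun_apply f x = cblinfun_apply g x) \<Longrightarrow> f = g"
  by (simp add: cblinfun_apply_inject[symmetric] fun_eq_iff)

lemma norm_cblinfun_apply: "norm (cblinfun_apply f x) \<le> norm f * norm x"
  by (simp add: norm_cblinfun.rep_eq onorm)

lemma norm_cblinfun_bound:
  "0 \<le> b \<Longrightarrow> (\<And>x. norm (cblinfun_apply f x) \<le> b * norm x) \<Longrightarrow> norm f \<le> b"
  by (simp add: norm_cblinfun.rep_eq onorm_bound)

lemma norm_cblinfun_compose: "norm (f o\<^sub>C g) \<le> norm f * norm g"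
proof (rule norm_cblinfun_bound)
  fix x
  have "norm (f (g x)) \<le> norm f * norm (g x)" by (rule norm_cblinfun_apply)
  also have "\<dots> \<le> norm f * (norm g * norm x)"
    by (intro mult_left_mono norm_cblinfun_apply) simp
  finally show "norm ((f o\<^sub>C g) x) \<le> norm f * norm g * norm x"
    by (simp add: cblinfun_compose.rep_eq mult.assoc)
qed simp

lemma norm_id_cblinfun: "norm id_cblinfun \<le> 1"
  by (rule norm_cblinfun_bound) (simp_all add: id_cblinfun.rep_eq)

lemma bounded_linear_scaleC_right: "bounded_linear (\<lambda>x :: 'a::complex_normed_vector. c *\<^sub>C x)"
  by (rule bounded_linear_intro[where K = "cmod c"])
    (simp_all add: scaleC_add_right scaleR_scaleC scaleC_scaleC norm_scaleC mult.commute)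

lemma bounded_linear_scaleC_left: "bounded_linear (\<lambda>c. c *\<^sub>C (x :: 'a::complex_normed_vector))"
  by (rule bounded_linear_intro[where K = "norm x"])
    (simp_all add: scaleC_add_left scaleR_scaleC scaleC_scaleC norm_scaleC scaleR_conv_of_real)

lemma bounded_bilinear_cblinfun_compose:
  "bounded_bilinear (cblinfun_compose ::
     ('b::complex_normed_vector, 'c::complex_normed_vector) cblinfun \<Rightarrow>
     ('a::complex_normed_vector, 'b) cblinfun \<Rightarrow> _)"
proof
  fix f f' :: "('b::complex_normed_vector, 'c::complex_normed_vector) cblinfun"
    and g g' :: "('a::complex_normed_vector, 'b) cblinfun" and r :: real
  show "(f + f') o\<^sub>C g = (f o\<^sub>C g) + (f' o\<^sub>C g)" "f o\<^sub>C (g + g') = (f o\<^sub>C g) + (f o\<^sub>C g')"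
    "(r *\<^sub>R f) o\<^sub>C g = r *\<^sub>R (f o\<^sub>C g)" "f o\<^sub>C (r *\<^sub>R g) = r *\<^sub>R (f o\<^sub>C g)"
    by (auto intro!: cblinfun_eqI simp: cblinfun_apply_simps scaleR_scaleC)
  show "\<exists>K. \<forall>(a :: ('b, 'c) cblinfun) (b :: ('a, 'b) cblinfun). norm (a o\<^sub>C b) \<le> norm a * norm b * K"
    using norm_cblinfun_compose by (intro exI[of _ 1]) auto
qed

lemmas bounded_linear_compose_left = bounded_bilinear.bounded_linear_left[OF bounded_bilinear_cblinfun_compose]
lemmas bounded_linear_compose_right = bounded_bilinear.bounded_linear_right[OF bounded_bilinear_cblinfun_compose]

lemma cblinfun_compose_assoc: "(f o\<^sub>C g) o\<^sub>C h = f o\<^sub>C (g o\<^sub>C h)"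
  by (rule cblinfun_eqI) (simp add: cblinfun_apply_simps)

lemma cblinfun_compose_scaleC [simp]:
  "(c *\<^sub>C f) o\<^sub>C g = c *\<^sub>C (f o\<^sub>C g)" "f o\<^sub>C (c *\<^sub>C g) = c *\<^sub>C (f o\<^sub>C g)"
  by (auto intro!: cblinfun_eqI simp: cblinfun_apply_simps)

lemma cblinfun_compose_id [simp]: "id_cblinfun o\<^sub>C f = f" "f o\<^sub>C id_cblinfun = f"
  by (auto intro!: cblinfun_eqI simp: cblinfun_apply_simps)

lemmas cblinfun_compose_distribs =
  bounded_bilinear.add_left[OF bounded_bilinear_cblinfun_compose]
  bounded_bilinear.add_right[OF bounded_bilinear_cblinfun_compose]
  bounded_bilinear.diff_left[OF bounded_bilinear_cblinfun_compose]
  bounded_bilinear.diff_right[OF bounded_bilinear_cblinfun_compose]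
  bounded_bilinear.minus_left[OF bounded_bilinear_cblinfun_compose]
  bounded_bilinear.minus_right[OF bounded_bilinear_cblinfun_compose]

lemmas cblinfun_compose_zero [simp] =
  bounded_bilinear.zero_left[OF bounded_bilinear_cblinfun_compose]
  bounded_bilinear.zero_right[OF bounded_bilinear_cblinfun_compose]

lemma op_inverse_unique: "is_inverse A B \<Longrightarrow> is_inverse A B' \<Longrightarrow> B = B'"
  by (metis is_inverse_def cblinfun_compose_assoc cblinfun_compose_id)

lemma op_inverse_eq: "is_inverse A B \<Longrightarrow> op_inverse A = B"
  unfolding op_inverse_def by (rule the_equality) (auto dest: op_inverse_unique)

lemma op_invertible_inverse: "op_invertible A \<Longrightarrow> is_inverse A (op_inverse A)"
  using op_inverse_eq by (auto simp: op_invertible_def)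

text \<open>Read as real operators the sequence stays Cauchy, since both norms are
  \<open>onorm\<close>, and converges there; complex homogeneity survives pointwise limits.\<close>

instance cblinfun :: (complex_normed_vector, cbanach) cbanach
proof
  fix X :: "nat \<Rightarrow> ('a, 'b) cblinfun"
  assume X: "Cauchy X"
  define Y where "Y n = Blinfun (X n)" for n
  have Y: "blinfun_apply (Y n) = X n" for n
    by (simp add: Y_def bounded_linear_Blinfun_apply)
  have dY: "norm (Y n - Y m) = norm (X n - X m)" for n m
    unfolding norm_blinfun.rep_eq norm_cblinfun.rep_eq
    by (simp add: minus_blinfun.rep_eq minus_cblinfun.rep_eq Y)
  have "Cauchy Y" using X by (simp add: Cauchy_def dist_norm dY)
  then obtain L where L: "Y \<longlonglongrightarrow> L" using Cauchy_convergent convergent_def by blast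
  have Lx: "(\<lambda>n. X n x) \<longlonglongrightarrow> L x" for x
    using blinfun.tendsto[OF L tendsto_const, of x] by (simp add: Y)
  have "L (c *\<^sub>C x) = c *\<^sub>C L x" for c x
  proof (rule LIMSEQ_unique)
    show "(\<lambda>n. X n (c *\<^sub>C x)) \<longlonglongrightarrow> L (c *\<^sub>C x)" by (rule Lx)
    show "(\<lambda>n. X n (c *\<^sub>C x)) \<longlonglongrightarrow> c *\<^sub>C L x"
      using bounded_linear.tendsto[OF bounded_linear_scaleC_right Lx] by simp
  qed
  then have L': "cblinfun_apply (CBlinfun (blinfun_apply L)) = L"
    by (intro CBlinfun_inverse) (simp add: blinfun.bounded_linear_right)
  have "norm (X n - CBlinfun L) = norm (Y n - L)" for n
    unfolding norm_blinfun.rep_eq norm_cblinfun.rep_eq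
    by (simp add: minus_blinfun.rep_eq minus_cblinfun.rep_eq Y L')
  then have "X \<longlonglongrightarrow> CBlinfun L"
    using L by (simp add: tendsto_iff dist_norm)
  then show "convergent X" by (auto simp: convergent_def)
qed

lemma norm_component_le: "norm (component x i) \<le> norm x"
  for x :: "('a::complex_normed_vector, 'p::finite) pow"
proof (cases "i \<in> {1..CARD('p)}")
  case True
  then show ?thesis unfolding norm_pow.rep_eq by (intro member_le_sum) auto
next
  case False
  then show ?thesis using component[of x] by simp
qed

instance pow :: (cbanach, finite) cbanach
proof
  fix X :: "nat \<Rightarrow> ('a, 'b) pow"
  assume X: "Cauchy X"
  have "Cauchy (\<lambda>n. component (X n) i)" for i
  proof (rule metric_CauchyI)
    fix e :: real assume "e > 0"
    then obtain M where M: "\<And>m n. m \<ge> M \<Longrightarrow> n \<ge> M \<Longrightarrow> norm (X m - X n) < e"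
      using X unfolding Cauchy_def dist_norm by blast
    have "dist (component (X m) i) (component (X n) i) < e" if "m \<ge> M" "n \<ge> M" for m n
      using M[OF that] norm_component_le[of "X m - X n" i] by (simp add: dist_norm minus_pow.rep_eq)
    then show "\<exists>M. \<forall>m\<ge>M. \<forall>n\<ge>M. dist (component (X m) i) (component (X n) i) < e" by blast
  qed
  then have "\<exists>l. (\<lambda>n. component (X n) i) \<longlonglongrightarrow> l" for i
    using Cauchy_convergent convergent_def by blast
  then obtain l where l: "\<And>i. (\<lambda>n. component (X n) i) \<longlonglongrightarrow> l i" by metis
  \<comment> \<open>Coordinates outside \<open>1..p\<close> are zero along the sequence, so the
    limit family is a legitimate \<open>pow\<close>.\<close>
  have "l i = 0" if "i \<notin> {1..CARD('b)}" for i
    using l[of i] component[of "X _"] that by (simp add: LIMSEQ_const_iff)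
  then have pl: "component (Pow_vec l :: ('a, 'b) pow) = l" by (intro Pow_vec_inverse) simp
  have "(\<lambda>n. \<Sum>i = 1..CARD('b). norm (component (X n) i - l i)) \<longlonglongrightarrow> (\<Sum>i = 1..CARD('b). norm (l i - l i))"
    by (intro tendsto_intros l)
  then have "(\<lambda>n. norm (X n - Pow_vec l)) \<longlonglongrightarrow> 0"
    by (simp add: norm_pow.rep_eq minus_pow.rep_eq pl)
  then have "X \<longlonglongrightarrow> Pow_vec l"
    by (simp add: Lim_null[symmetric] tendsto_norm_zero_iff LIM_zero_iff)
  then show "convergent X" by (auto simp: convergent_def)
qed

section \<open>The open mapping principle for closed linear relations\<close>

text \<open>Since each vector is the image of some vector of norm at most \<open>n\<close>, for some \<open>n\<close>, Baire
  yields an \<open>n\<close> for which such images approximate every vector of the unit ball up to a scalar.\<close>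

lemma closed_relation_approx:
  fixes G :: "('x::real_normed_vector \<times> 'y::banach) set"
  assumes sub: "subspace G" and onto: "\<And>y. \<exists>x. (x, y) \<in> G"
  obtains c where "c > 0" "\<And>y e. e > 0 \<Longrightarrow> \<exists>x y'. (x, y') \<in> G \<and> norm x \<le> c * norm y \<and> norm (y - y') < e"
proof -
  define S where "S n = {y. \<exists>x. (x, y) \<in> G \<and> norm x \<le> real n}" for n
  have "\<exists>n. interior (closure (S n)) \<noteq> {}"
  proof (rule ccontr)
    assume "\<not> ?thesis"
    then have "euclidean interior_of \<Union>(range (\<lambda>n. closure (S n))) = {}"
      by (intro Baire_category_alt) (auto simp: completely_metrizable_space_euclidean)
    moreover have "\<Union>(range (\<lambda>n. closure (S n))) = UNIV"
    proof safe
      fix y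
      obtain x where x: "(x, y) \<in> G" using onto by blast
      obtain n where "norm x \<le> real n" using real_arch_simple by blast
      then have "y \<in> S n" using x by (auto simp: S_def)
      then show "y \<in> \<Union>(range (\<lambda>n. closure (S n)))" using closure_subset by blast
    qed simp_all
    ultimately show False by simp
  qed
  then obtain n b e where e: "e > 0" "ball b e \<subseteq> closure (S n)"
    by (metis equals0I mem_interior)
  \<comment> \<open>Both \<open>b + y\<close> and \<open>b\<close> are limits of points of
    \<open>S n\<close>; subtracting the approximants removes the centre \<open>b\<close> and doubles
    the norm bound.\<close>
  have S: "\<exists>x y'. (x, y') \<in> G \<and> norm x \<le> 2 * real n \<and> norm (y - y') < d" if y: "norm y < e" and d: "d > 0" for y d
  proof -
    have "b + y \<in> closure (S n)" "b \<in> closure (S n)" using e y by (auto simp: dist_norm)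
    then obtain u v where u: "u \<in> S n" "norm (u - (b + y)) < d/2" and v: "v \<in> S n" "norm (v - b) < d/2"
      using d unfolding closure_approachable dist_norm by (metis half_gt_zero)
    then obtain p q where pq: "(p, u) \<in> G" "(q, v) \<in> G" "norm p \<le> real n" "norm q \<le> real n"
      by (auto simp: S_def)
    have "(p - q, u - v) \<in> G" using subspace_diff[OF sub pq(1,2)] by simp
    moreover have "norm (p - q) \<le> 2 * real n" using pq norm_triangle_ineq4[of p q] by linarith
    moreover have "norm (y - (u - v)) < d"
    proof -
      have "y - (u - v) = (v - b) - (u - (b + y))" by simp
      also have "norm \<dots> \<le> norm (v - b) + norm (u - (b + y))" by (rule norm_triangle_ineq4)
      finally show ?thesis using u v by linarith
    qed
    ultimately show ?thesis by blast
  qed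
  \<comment> \<open>Rescaling \<open>y\<close> to norm \<open>e / 2\<close> and back multiplies the
    bound \<open>2 n\<close> by \<open>2 norm y / e\<close>; the summand 1 keeps \<open>c\<close>
    positive when \<open>n = 0\<close>.\<close>
  define c where "c = 4 * real n / e + 1"
  show thesis
  proof
    show "c > 0" using e by (simp add: c_def add_nonneg_pos)
    fix y :: 'y and d :: real assume d: "d > 0"
    show "\<exists>x y'. (x, y') \<in> G \<and> norm x \<le> c * norm y \<and> norm (y - y') < d"
    proof (cases "y = 0")
      case True
      then show ?thesis using d subspace_0[OF sub] by (intro exI[of _ 0]) (simp add: zero_prod_def)
    next
      case False
      define t where "t = e / (2 * norm y)"
      have t: "t > 0" using e False by (simp add: t_def)
      have "norm (t *\<^sub>R y) < e" using e False by (simp add: t_def)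
      then obtain x y' where x: "(x, y') \<in> G" "norm x \<le> 2 * real n" "norm (t *\<^sub>R y - y') < t * d"
        using S[of "t *\<^sub>R y" "t * d"] t d by auto
      have "((1/t) *\<^sub>R x, (1/t) *\<^sub>R y') \<in> G" using subspace_scale[OF sub x(1), of "1/t"] by simp
      moreover have "norm ((1/t) *\<^sub>R x) \<le> c * norm y"
      proof -
        have "norm ((1/t) *\<^sub>R x) \<le> (1/t) * (2 * real n)"
          using x t by (simp add: divide_right_mono)
        also have "\<dots> = (4 * real n / e) * norm y" using e False by (simp add: t_def field_simps)
        also have "\<dots> \<le> c * norm y" by (intro mult_right_mono) (simp_all add: c_def)
        finally show ?thesis .
      qed
      moreover have "norm (y - (1/t) *\<^sub>R y') < d"
      proof -
        have "y - (1/t) *\<^sub>R y' = (1/t) *\<^sub>R (t *\<^sub>R y - y')" using t by (simp add: scaleR_diff_right)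
        then have "norm (y - (1/t) *\<^sub>R y') = (1/t) * norm (t *\<^sub>R y - y')" using t by simp
        also have "\<dots> < (1/t) * (t * d)" using x t by (intro mult_strict_left_mono) auto
        finally show ?thesis using t by simp
      qed
      ultimately show ?thesis by blast
    qed
  qed
qed

text \<open>Approximate solving is iterated on the residual, which halves each time. The corrections
  are dominated by a geometric series with sum \<open>2 c norm y\<close>, and closedness of
  \<open>G\<close> captures the limit of the partial sums.\<close>

lemma closed_relation_bound:
  fixes G :: "('x::banach \<times> 'y::banach) set"
  assumes sub: "subspace G" and cl: "closed G" and onto: "\<And>y. \<exists>x. (x, y) \<in> G"
  obtains c where "c > 0" "\<And>y. \<exists>x. (x, y) \<in> G \<and> norm x \<le> c * norm y"
proof -
  obtain c where c: "c > 0"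
    "\<And>y e. e > 0 \<Longrightarrow> \<exists>x y'. (x, y') \<in> G \<and> norm x \<le> c * norm y \<and> norm (y - y') < e"
    using closed_relation_approx[OF sub onto] by blast
  \<comment> \<open>\<open>fst p\<close> is the correction and \<open>snd p\<close> the remaining
    error. For \<open>y = 0\<close> the accuracy \<open>norm y / 2\<close> would not be positive, so
    a pair of zeros is taken.\<close>
  have "\<exists>p. (fst p, y - snd p) \<in> G \<and> norm (fst p) \<le> c * norm y \<and>
      (y \<noteq> 0 \<longrightarrow> norm (snd p) \<le> norm y / 2) \<and> (y = 0 \<longrightarrow> snd p = 0)" for y
  proof (cases "y = 0")
    case True
    then show ?thesis using subspace_0[OF sub] by (intro exI[of _ "(0, 0)"]) (simp add: zero_prod_def)
  next
    case False
    then obtain x y' where "(x, y') \<in> G" "norm x \<le> c * norm y" "norm (y - y') < norm y / 2"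
      using c(2)[of "norm y / 2" y] by auto
    then show ?thesis using False by (intro exI[of _ "(x, y - y')"]) auto
  qed
  then obtain f where f: "\<And>y. (fst (f y), y - snd (f y)) \<in> G" "\<And>y. norm (fst (f y)) \<le> c * norm y"
    "\<And>y. y \<noteq> 0 \<longrightarrow> norm (snd (f y)) \<le> norm y / 2" "\<And>y. y = 0 \<longrightarrow> snd (f y) = 0"
    by metis
  have f3: "norm (snd (f y)) \<le> norm y / 2" for y using f(3,4)[of y] by (cases "y = 0") auto
  show thesis
  proof
    show "2 * c > 0" using c by simp
    fix y
    \<comment> \<open>\<open>r n\<close> is the error left after \<open>n\<close> corrections and
      \<open>s n\<close> the next correction, so the partial sum of the \<open>s i\<close> is
      related to \<open>y - r n\<close>.\<close>
    define r where "r n = ((\<lambda>y. snd (f y)) ^^ n) y" for n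
    define s where "s n = fst (f (r n))" for n
    have rS: "r (Suc n) = snd (f (r n))" for n by (simp add: r_def)
    have r: "norm (r n) \<le> norm y * (1/2) ^ n" for n
    proof (induction n)
      case (Suc n)
      then show ?case using f3[of "r n"] by (simp add: rS)
    qed (simp add: r_def)
    have s: "norm (s n) \<le> c * norm y * (1/2) ^ n" for n
    proof -
      have "norm (s n) \<le> c * norm (r n)" by (simp add: s_def f)
      also have "\<dots> \<le> c * (norm y * (1/2) ^ n)" using r c by (intro mult_left_mono) auto
      finally show ?thesis by (simp add: mult.assoc)
    qed
    have geo: "(\<lambda>n. c * norm y * (1/2) ^ n) sums (c * norm y * 2)"
      using sums_mult[OF geometric_sums[of "1/2 :: real"], of "c * norm y"] by simp
    have ns: "summable (\<lambda>n. norm (s n))"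
      using s by (intro summable_comparison_test'[OF sums_summable[OF geo]]) simp
    then have "summable s" by (rule summable_norm_cancel)
    then have lim: "(\<lambda>n. \<Sum>i<n. s i) \<longlonglongrightarrow> suminf s" by (rule summable_LIMSEQ)
    have G: "((\<Sum>i<n. s i), y - r n) \<in> G" for n
    proof (induction n)
      case 0
      then show ?case using subspace_0[OF sub] by (simp add: r_def zero_prod_def)
    next
      case (Suc n)
      have "(s n, r n - r (Suc n)) \<in> G" using f(1)[of "r n"] by (simp add: s_def rS)
      from subspace_add[OF sub Suc this] show ?case by simp
    qed
    have "(\<lambda>n. norm y * (1/2) ^ n) \<longlonglongrightarrow> 0"
      by (intro tendsto_mult_right_zero LIMSEQ_realpow_zero) auto
    then have "r \<longlonglongrightarrow> 0" by (rule Lim_null_comparison[rotated]) (simp add: r)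
    then have "(\<lambda>n. ((\<Sum>i<n. s i), y - r n)) \<longlonglongrightarrow> (suminf s, y - 0)"
      by (intro tendsto_Pair lim tendsto_intros)
    then have "(suminf s, y) \<in> G" using closed_sequentially[OF cl G] by simp
    moreover have "norm (suminf s) \<le> c * norm y * 2"
    proof -
      have "norm (suminf s) \<le> (\<Sum>n. norm (s n))" by (rule summable_norm[OF ns])
      also have "\<dots> \<le> (\<Sum>n. c * norm y * (1/2) ^ n)"
        by (rule suminf_le[OF s ns sums_summable[OF geo]])
      finally show ?thesis using sums_unique[OF geo] by simp
    qed
    ultimately show "\<exists>x. (x, y) \<in> G \<and> norm x \<le> 2 * c * norm y" by (auto simp: mult_ac)
  qed
qed

section \<open>Vector-valued power series\<close>

text \<open>Absolute summability is included to have majorants at hand, for instance in termwise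
  differentiation.\<close>

definition power_series_on ::
    "(complex \<Rightarrow> 'a::complex_normed_vector) \<Rightarrow> real \<Rightarrow> (nat \<Rightarrow> 'a) \<Rightarrow> bool" where
  "power_series_on F R c \<longleftrightarrow>
     (\<forall>z\<in>ball 0 R. summable (\<lambda>n. norm (c n) * cmod z ^ n) \<and> (\<lambda>n. z ^ n *\<^sub>C c n) sums F z)"

lemma power_series_on_const: "power_series_on (\<lambda>_. a) R (\<lambda>n. if n = 0 then a else 0)"
  unfolding power_series_on_def
proof (intro ballI conjI)
  fix z :: complex
  have "(\<lambda>n. norm (if n = 0 then a else 0) * cmod z ^ n) sums (\<Sum>n\<in>{0}. norm (if n = 0 then a else 0) * cmod z ^ n)"
    by (rule sums_finite) auto
  then show "summable (\<lambda>n. norm (if n = 0 then a else 0) * cmod z ^ n)" by (rule sums_summable)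
  have "(\<lambda>n. z ^ n *\<^sub>C (if n = 0 then a else 0)) sums (\<Sum>n\<in>{0}. z ^ n *\<^sub>C (if n = 0 then a else 0))"
    by (rule sums_finite) auto
  then show "(\<lambda>n. z ^ n *\<^sub>C (if n = 0 then a else 0)) sums a" by simp
qed

lemma power_series_on_add:
  assumes "power_series_on F R c" "power_series_on G R d"
  shows "power_series_on (\<lambda>z. F z + G z) R (\<lambda>n. c n + d n)"
  unfolding power_series_on_def
proof (intro ballI conjI)
  fix z :: complex assume z: "z \<in> ball 0 R"
  note F = bspec[OF assms(1)[unfolded power_series_on_def] z]
    and G = bspec[OF assms(2)[unfolded power_series_on_def] z]
  have "norm (c n + d n) * cmod z ^ n \<le> norm (c n) * cmod z ^ n + norm (d n) * cmod z ^ n" for n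
    using mult_right_mono[OF norm_triangle_ineq[of "c n" "d n"], of "cmod z ^ n"]
    by (simp add: distrib_right)
  then show "summable (\<lambda>n. norm (c n + d n) * cmod z ^ n)"
    by (intro summable_comparison_test'[OF summable_add[OF conjunct1[OF F] conjunct1[OF G]]]) simp
  show "(\<lambda>n. z ^ n *\<^sub>C (c n + d n)) sums (F z + G z)"
    using F G by (simp add: scaleC_add_right sums_add)
qed

lemma power_series_on_uminus:
  assumes "power_series_on F R c"
  shows "power_series_on (\<lambda>z. - F z) R (\<lambda>n. - c n)"
  using assms by (auto simp: power_series_on_def intro: sums_minus)

lemma power_series_on_shift:
  assumes "power_series_on F R c"
  shows "power_series_on (\<lambda>z. z *\<^sub>C F z) R (\<lambda>n. case n of 0 \<Rightarrow> 0 | Suc m \<Rightarrow> c m)"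
  unfolding power_series_on_def
proof (intro ballI conjI)
  fix z :: complex assume z: "z \<in> ball 0 R"
  note F = bspec[OF assms(1)[unfolded power_series_on_def] z]
  have "summable (\<lambda>n. cmod z * (norm (c n) * cmod z ^ n))" using F by (intro summable_mult) auto
  then show "summable (\<lambda>n. norm (case n of 0 \<Rightarrow> 0 | Suc m \<Rightarrow> c m) * cmod z ^ n)"
    by (subst summable_Suc_iff[symmetric]) (simp add: mult_ac)
  have "(\<lambda>n. z *\<^sub>C z ^ n *\<^sub>C c n) sums (z *\<^sub>C F z)"
    using F bounded_linear.sums[OF bounded_linear_scaleC_right] by blast
  then show "(\<lambda>n. z ^ n *\<^sub>C (case n of 0 \<Rightarrow> 0 | Suc m \<Rightarrow> c m)) sums (z *\<^sub>C F z)"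
    using sums_Suc[of "\<lambda>n. z ^ n *\<^sub>C (case n of 0 \<Rightarrow> 0 | Suc m \<Rightarrow> c m)"]
    by (simp add: scaleC_scaleC)
qed

lemma power_series_on_cong:
  "power_series_on F R c \<Longrightarrow> (\<And>z. z \<in> ball 0 R \<Longrightarrow> F z = G z) \<Longrightarrow> power_series_on G R c"
  by (auto simp: power_series_on_def)

text \<open>The only product of power series that occurs: applied to a constant and, twice, to
  \<open>H\<close>, it yields the Maclaurin series of \<open>(1 - z)^2\<close> times the
  resolvent.\<close>

lemma power_series_on_mult_one_minus:
  assumes "power_series_on F R c"
  obtains d where "power_series_on (\<lambda>z. (1 - z) *\<^sub>C F z) R d"
proof (rule that, rule power_series_on_cong)
  show "power_series_on (\<lambda>z. F z + - (z *\<^sub>C F z)) R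
      (\<lambda>n. c n + - (case n of 0 \<Rightarrow> 0 | Suc m \<Rightarrow> c m))"
    by (rule power_series_on_add[OF assms power_series_on_uminus[OF power_series_on_shift[OF assms]]])
qed (simp add: complex_vector.scale_left_diff_distrib)

lemma has_cderiv_unique: "has_cderiv F D z \<Longrightarrow> has_cderiv F D' z \<Longrightarrow> D = D'"
  unfolding has_cderiv_def by (drule (1) has_derivative_unique, drule fun_cong[of _ _ 1]) simp

lemma cderiv_eqI: "has_cderiv F D z \<Longrightarrow> cderiv F z = D"
  unfolding cderiv_def by (rule the_equality) (auto dest: has_cderiv_unique)

text \<open>On a smaller disk the differentiated series is dominated by its terms in norm at the
  boundary radius, so the Weierstrass test gives the uniform convergence that termwise
  differentiation needs.\<close>

lemma power_series_on_deriv: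
  fixes F :: "complex \<Rightarrow> 'a::cbanach"
  assumes F: "power_series_on F R c"
  shows "vholomorphic_on F (ball 0 R)"
    and "power_series_on (cderiv F) R (\<lambda>n. of_nat (Suc n) *\<^sub>C c (Suc n))"
proof -
  define d where "d n = (of_nat (Suc n) :: complex) *\<^sub>C c (Suc n)" for n
  define D where "D w = (\<Sum>i. (of_nat i * w ^ (i - 1)) *\<^sub>C c i)" for w :: complex
  have abs: "summable (\<lambda>n. norm (d n) * t ^ n)" if t: "0 \<le> t" "t < R" for t
  proof -
    \<comment> \<open>The norms \<open>norm (c n)\<close> form an ordinary real power series, whose
      formal derivative \<open>diffs\<close> converges for the same arguments.\<close>
    have "summable (\<lambda>n. norm (c n) * x ^ n)" if "norm x < R" for x :: real
    proof -
      have "complex_of_real x \<in> ball 0 R" using that by simp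
      then have "summable (\<lambda>n. norm (c n) * cmod (complex_of_real x) ^ n)"
        using F unfolding power_series_on_def by blast
      then have "summable (\<lambda>n. norm (norm (c n) * x ^ n))" by (simp add: abs_mult power_abs)
      then show ?thesis by (rule summable_norm_cancel)
    qed
    then have "summable (\<lambda>n. diffs (\<lambda>n. norm (c n)) n * t ^ n)"
      using t by (intro termdiff_converges) auto
    then show ?thesis by (simp add: diffs_def d_def norm_scaleC norm_of_nat del: of_nat_Suc)
  qed
  \<comment> \<open>Unshifted indexing, as termwise differentiation produces it; the term at
    \<open>n = 0\<close> vanishes through the factor \<open>real n\<close>.\<close>
  have abs': "summable (\<lambda>n. norm (c n) * (real n * t ^ (n - 1)))" if t: "0 \<le> t" "t < R" for t
    using abs[OF t] by (subst summable_Suc_iff[symmetric]) (simp add: d_def norm_scaleC norm_of_nat mult_ac del: of_nat_Suc)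
  have D: "(\<lambda>n. z ^ n *\<^sub>C d n) sums D z" if z: "z \<in> ball 0 R" for z
  proof -
    have "summable (\<lambda>i. (of_nat i * z ^ (i - 1)) *\<^sub>C c i)"
      using abs'[of "cmod z"] z
      by (intro summable_norm_cancel[of "\<lambda>i. (of_nat i * z ^ (i - 1)) *\<^sub>C c i"])
        (simp add: norm_scaleC norm_mult norm_power norm_of_nat mult_ac)
    then have "(\<lambda>i. (of_nat i * z ^ (i - 1)) *\<^sub>C c i) sums D z"
      unfolding D_def by (rule summable_sums)
    then have "(\<lambda>i. (of_nat (Suc i) * z ^ (Suc i - 1)) *\<^sub>C c (Suc i)) sums D z"
      by (subst sums_Suc_iff) simp
    then show ?thesis by (simp add: d_def scaleC_scaleC mult.commute del: of_nat_Suc)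
  qed
  have der: "has_cderiv F (D z) z" if z: "z \<in> ball 0 R" for z
  proof -
    \<comment> \<open>A radius strictly between \<open>cmod z\<close> and \<open>R\<close> gives a
      neighbourhood of \<open>z\<close> with a uniform majorant.\<close>
    define \<rho> where "\<rho> = (cmod z + R) / 2"
    have \<rho>: "cmod z < \<rho>" "\<rho> < R" "0 \<le> \<rho>" using z norm_ge_zero[of z] by (auto simp: \<rho>_def simp del: norm_ge_zero)
    let ?S = "ball 0 \<rho> :: complex set"
    have zS: "z \<in> ?S" using \<rho> by simp
    have "\<exists>g. \<forall>x\<in>?S. (\<lambda>n. x ^ n *\<^sub>C c n) sums g x \<and> (g has_derivative (\<lambda>h. h *\<^sub>C D x)) (at x within ?S)"
    proof (rule has_derivative_series[where f' = "\<lambda>n x h. (h * (of_nat n * x ^ (n - 1))) *\<^sub>C c n"])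
      show "convex ?S" by simp
      show "((\<lambda>x. x ^ n *\<^sub>C c n) has_derivative (\<lambda>h. (h * (of_nat n * x ^ (n - 1))) *\<^sub>C c n)) (at x within ?S)"
        for n and x :: complex
      proof (rule bounded_linear.has_derivative[OF bounded_linear_scaleC_left])
        have "((\<lambda>x. x ^ n) has_field_derivative of_nat n * x ^ (n - 1)) (at x within ?S)"
          by (auto intro!: derivative_eq_intros)
        then show "((\<lambda>x. x ^ n) has_derivative (\<lambda>h. h * (of_nat n * x ^ (n - 1)))) (at x within ?S)"
          unfolding has_field_derivative_def
          by (rule has_derivative_eq_rhs) (simp add: fun_eq_iff mult.commute)
      qed
      show "z \<in> ?S" by (rule zS)
      show "(\<lambda>n. z ^ n *\<^sub>C c n) sums F z" using F z by (auto simp: power_series_on_def)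
      fix e :: real assume e: "e > 0"
      have "uniform_limit ?S (\<lambda>n x. \<Sum>i<n. (of_nat i * x ^ (i - 1)) *\<^sub>C c i)
          (\<lambda>x. \<Sum>i. (of_nat i * x ^ (i - 1)) *\<^sub>C c i) sequentially"
      proof (rule Weierstrass_m_test)
        show "summable (\<lambda>n. norm (c n) * (real n * \<rho> ^ (n - 1)))" using \<rho> by (intro abs') auto
        fix n and x :: complex assume "x \<in> ?S"
        then have "real n * cmod x ^ (n - 1) \<le> real n * \<rho> ^ (n - 1)"
          by (intro mult_left_mono power_mono) auto
        then have "(real n * cmod x ^ (n - 1)) * norm (c n) \<le> (real n * \<rho> ^ (n - 1)) * norm (c n)"
          by (rule mult_right_mono) simp
        then show "norm ((of_nat n * x ^ (n - 1)) *\<^sub>C c n) \<le> norm (c n) * (real n * \<rho> ^ (n - 1))"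
          by (simp add: norm_scaleC norm_mult norm_power norm_of_nat mult_ac)
      qed
      then have "\<forall>\<^sub>F n in sequentially. \<forall>x\<in>?S. dist (\<Sum>i<n. (of_nat i * x ^ (i - 1)) *\<^sub>C c i) (D x) < e"
        using uniform_limitD[OF _ e] unfolding D_def by blast
      then show "\<forall>\<^sub>F n in sequentially. \<forall>x\<in>?S. \<forall>h.
          norm ((\<Sum>i<n. (h * (of_nat i * x ^ (i - 1))) *\<^sub>C c i) - h *\<^sub>C D x) \<le> e * norm h"
      proof (rule eventually_mono, intro ballI allI)
        fix n and x h :: complex
        assume *: "\<forall>x\<in>?S. dist (\<Sum>i<n. (of_nat i * x ^ (i - 1)) *\<^sub>C c i) (D x) < e" and x: "x \<in> ?S"
        have "(\<Sum>i<n. (h * (of_nat i * x ^ (i - 1))) *\<^sub>C c i) - h *\<^sub>C D x =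
            h *\<^sub>C ((\<Sum>i<n. (of_nat i * x ^ (i - 1)) *\<^sub>C c i) - D x)"
          by (simp add: complex_vector.scale_right_diff_distrib complex_vector.scale_sum_right scaleC_scaleC)
        then have "norm ((\<Sum>i<n. (h * (of_nat i * x ^ (i - 1))) *\<^sub>C c i) - h *\<^sub>C D x) =
            norm h * dist (\<Sum>i<n. (of_nat i * x ^ (i - 1)) *\<^sub>C c i) (D x)"
          by (simp add: norm_scaleC dist_norm)
        also have "\<dots> \<le> norm h * e"
          by (rule mult_left_mono[OF less_imp_le[OF bspec[OF * x]]]) simp
        finally show "norm ((\<Sum>i<n. (h * (of_nat i * x ^ (i - 1))) *\<^sub>C c i) - h *\<^sub>C D x) \<le> e * norm h"
          by (simp add: mult.commute)
      qed
    qed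
    then obtain g where g: "\<And>x. x \<in> ?S \<Longrightarrow> (\<lambda>n. x ^ n *\<^sub>C c n) sums g x"
      "\<And>x. x \<in> ?S \<Longrightarrow> (g has_derivative (\<lambda>h. h *\<^sub>C D x)) (at x within ?S)" by blast
    have gF: "g x = F x" if "x \<in> ?S" for x
    proof -
      have "x \<in> ball 0 R" using that \<rho> by simp
      then have "(\<lambda>n. x ^ n *\<^sub>C c n) sums F x" using F unfolding power_series_on_def by blast
      then show ?thesis using sums_unique2[OF g(1)[OF that]] by simp
    qed
    have "(g has_derivative (\<lambda>h. h *\<^sub>C D z)) (at z)"
      using g(2)[OF zS] by (simp add: at_within_open[OF zS])
    then show ?thesis unfolding has_cderiv_def
      by (rule has_derivative_transform_within_open[OF _ open_ball zS]) (use gF in auto)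
  qed
  show "vholomorphic_on F (ball 0 R)" unfolding vholomorphic_on_def using der by blast
  show "power_series_on (cderiv F) R (\<lambda>n. of_nat (Suc n) *\<^sub>C c (Suc n))"
    unfolding power_series_on_def d_def[symmetric]
    using abs D cderiv_eqI[OF der] by (auto simp: dist_norm)
qed

lemma power_series_on_maclaurin:
  fixes F :: "complex \<Rightarrow> 'a::cbanach"
  assumes F: "power_series_on F R c"
  shows "maclaurin_series_converges_on F (ball 0 R)"
proof (cases "R > 0")
  case True
  \<comment> \<open>The derivative is again such a series, so induction over all \<open>F\<close>
    and \<open>c\<close> works once the innermost derivative is peeled off.\<close>
  have coeff: "(cderiv ^^ n) F 0 = fact n *\<^sub>C c n" if "power_series_on F R c" for n F and c :: "nat \<Rightarrow> 'a"
    using that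
  proof (induction n arbitrary: F c)
    case 0
    have "(\<lambda>n. 0 ^ n *\<^sub>C c n) sums F 0" using 0 True by (simp add: power_series_on_def)
    moreover have "(\<lambda>n. 0 ^ n *\<^sub>C c n) sums (\<Sum>n\<in>{0}. 0 ^ n *\<^sub>C c n)"
      by (rule sums_finite) auto
    ultimately have "F 0 = (\<Sum>n\<in>{0}. 0 ^ n *\<^sub>C c n)" by (rule sums_unique2)
    then show ?case by simp
  next
    case (Suc n)
    have "(cderiv ^^ Suc n) F 0 = (cderiv ^^ n) (cderiv F) 0" by (simp add: funpow_swap1)
    also have "\<dots> = fact n *\<^sub>C of_nat (Suc n) *\<^sub>C c (Suc n)"
      by (rule Suc.IH[OF power_series_on_deriv(2)[OF Suc.prems]])
    finally show ?case by (simp add: scaleC_scaleC mult.commute)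
  qed
  show ?thesis unfolding maclaurin_series_converges_on_def
  proof
    fix z :: complex assume "z \<in> ball 0 R"
    then have "(\<lambda>n. z ^ n *\<^sub>C c n) sums F z" using F by (auto simp: power_series_on_def)
    then show "(\<lambda>n. (z ^ n / fact n) *\<^sub>C (cderiv ^^ n) F 0) sums F z"
      by (simp add: coeff[OF F] scaleC_scaleC)
  qed
next
  case False
  then have "z \<notin> ball 0 R" for z :: complex using norm_ge_zero[of z] by (simp del: norm_ge_zero)
  then show ?thesis unfolding maclaurin_series_converges_on_def by blast
qed

section \<open>Averages over roots of unity and uniqueness of Laurent series\<close>

text \<open>Multiplication by a primitive root \<open>\<zeta>\<close> permutes the roots of unity
  and multiplies the sum by \<open>\<zeta> ^ m\<close>, which is not 1.\<close>

lemma sum_roots_unity_power: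
  assumes m: "0 < m" "m < n"
  shows "(\<Sum>w | w ^ n = 1. w ^ m) = (0 :: complex)"
proof -
  define \<zeta> where "\<zeta> = cis (2 * pi / real n)"
  have n: "n > 0" using m by simp
  have \<zeta>n: "\<zeta> ^ n = 1" proof -
    have "\<zeta> ^ n = cis (real n * (2 * pi / real n))" unfolding \<zeta>_def by (rule Complex.DeMoivre)
    also have "real n * (2 * pi / real n) = 2 * pi" using n by simp
    finally show ?thesis by simp
  qed
  have "\<zeta> ^ m \<noteq> 1"
  proof
    assume "\<zeta> ^ m = 1"
    moreover have "\<zeta> ^ m = cis (real m * (2 * pi / real n))" unfolding \<zeta>_def by (rule Complex.DeMoivre)
    moreover have "real m * (2 * pi / real n) = 2 * pi * real m / real n"
      by (simp add: mult_ac)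
    ultimately have "cis (2 * pi * real m / real n) = cis (2 * pi * real 0 / real n)"
      by (simp only:) simp
    from inj_onD[OF bij_betw_imp_inj_on[OF Complex.bij_betw_roots_unity[OF n]] this]
    show False using m by simp
  qed
  have "\<zeta> \<noteq> 0" by (simp add: \<zeta>_def)
  then have "bij_betw (\<lambda>w. \<zeta> * w) {w. w ^ n = 1} {w. w ^ n = 1}"
    by (intro bij_betwI[where g = "\<lambda>w. w / \<zeta>"])
      (use \<zeta>n in \<open>auto simp: power_mult_distrib power_divide\<close>)
  then have "(\<Sum>w | w ^ n = 1. (\<zeta> * w) ^ m) = (\<Sum>w | w ^ n = 1. w ^ m)"
    by (rule sum.reindex_bij_betw)
  then have "\<zeta> ^ m * (\<Sum>w | w ^ n = 1. w ^ m) = (\<Sum>w | w ^ n = 1. w ^ m)"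
    by (simp add: power_mult_distrib sum_distrib_left)
  then show ?thesis using \<open>\<zeta> ^ m \<noteq> 1\<close> by (metis mult_cancel_right1 mult.commute)
qed

lemma sum_roots_unity_powi:
  assumes n: "n > 0"
  shows "(\<Sum>w | w ^ n = 1. w powi m) = (if int n dvd m then of_nat n else (0 :: complex))"
proof -
  \<comment> \<open>On \<open>n\<close>-th roots of unity only the residue of the exponent modulo
    \<open>n\<close> matters.\<close>
  have *: "w powi m = w ^ nat (m mod int n)" if "w ^ n = 1" for w :: complex
  proof -
    have w: "w \<noteq> 0" using that n by (auto simp: power_0_left)
    have "w powi m = w powi (int n * (m div int n) + m mod int n)" by simp
    also have "\<dots> = (w powi int n) powi (m div int n) * w powi (m mod int n)"
      by (simp only: power_int_add[OF disjI1[OF w]] power_int_mult)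
    also have "\<dots> = w ^ nat (m mod int n)" using that n by (simp add: power_int_def)
    finally show ?thesis .
  qed
  then have eq: "(\<Sum>w | w ^ n = 1. w powi m) = (\<Sum>w::complex | w ^ n = 1. w ^ nat (m mod int n))"
    by (intro sum.cong) auto
  show ?thesis
  proof (cases "int n dvd m")
    case True
    then have "m mod int n = 0" by simp
    then show ?thesis using True n card_roots_unity_eq[of n] by (simp add: eq)
  next
    case False
    then have "m mod int n \<noteq> 0" by (simp add: dvd_eq_mod_eq_0)
    then have "0 < m mod int n" "m mod int n < int n"
      using n pos_mod_sign[of "int n" m] pos_mod_bound[of "int n" m] by linarith+
    then show ?thesis using False by (simp add: eq sum_roots_unity_power)
  qed
qed

section \<open>Unordered sums and uniqueness of their coefficients\<close>

lemma has_sum_sum: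
  fixes f :: "'i \<Rightarrow> 'j \<Rightarrow> 'a::topological_comm_monoid_add"
  assumes "\<And>i. i \<in> I \<Longrightarrow> (f i has_sum s i) A"
  shows "((\<lambda>j. \<Sum>i\<in>I. f i j) has_sum (\<Sum>i\<in>I. s i)) A"
  using assms by (induction I rule: infinite_finite_induct) (auto intro!: has_sum_add)

lemma has_sum_zero_tail:
  fixes f :: "'i \<Rightarrow> 'a::real_normed_vector"
  assumes "(f has_sum 0) UNIV" "\<epsilon> > 0"
  shows "\<exists>X. finite X \<and> (\<forall>Y. finite Y \<and> X \<subseteq> Y \<longrightarrow> norm (sum f Y) < \<epsilon>)"
  using tendstoD[OF assms[unfolded has_sum_def]]
  unfolding eventually_finite_subsets_at_top dist_norm by auto

text \<open>Averaging the terms of a vanishing Laurent series over the \<open>n\<close>-th roots of unity isolates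
  the coefficients with index congruent to \<open>k\<close> modulo \<open>n\<close>; for large \<open>n\<close> all of them but
  the \<open>k\<close>-th lie in the tail of the series.\<close>

lemma laurent_series_zero:
  fixes D :: "int \<Rightarrow> 'a::complex_normed_vector"
  assumes r: "r > 0" and D: "\<And>z. z \<in> ball a r - {a} \<Longrightarrow> ((\<lambda>j. ((z - a) powi j) *\<^sub>C D j) has_sum 0) UNIV"
  shows "D k = 0"
proof -
  \<comment> \<open>Absorbing a fixed radius inside the punctured disk into the coefficients
    \<open>e j\<close> leaves a series that vanishes on the unit circle.\<close>
  define s where "s = complex_of_real (r / 2)"
  have s: "s \<noteq> 0" "cmod s < r" using r by (auto simp: s_def norm_divide)
  define e where "e j = (s powi j) *\<^sub>C D j" for j
  have hs: "((\<lambda>j. (w powi j) *\<^sub>C e j) has_sum 0) UNIV" if w: "cmod w = 1" for w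
  proof -
    have "a + w * s \<in> ball a r - {a}" using s w by (auto simp: dist_norm norm_mult)
    from D[OF this] show ?thesis by (simp add: e_def scaleC_scaleC power_int_mult_distrib)
  qed
  have "norm (e k) \<le> 3 * \<epsilon>" if \<epsilon>: "\<epsilon> > 0" for \<epsilon>
  proof -
    have "(e has_sum 0) UNIV" using hs[of 1] by simp
    then obtain J where J: "finite J" "\<forall>Y. finite Y \<and> J \<subseteq> Y \<longrightarrow> norm (sum e Y) < \<epsilon>"
      using has_sum_zero_tail[OF _ \<epsilon>] by blast
    \<comment> \<open>The sum over a set disjoint from \<open>J\<close> is the difference of sums
      over two supersets of \<open>J\<close>, each below \<open>\<epsilon>\<close> in norm.\<close>
    have small: "norm (sum e Z) < 2 * \<epsilon>" if "finite Z" "Z \<inter> J = {}" for Z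
    proof -
      have "sum e Z = sum e (J \<union> Z) - sum e J"
        using that J(1) by (subst sum.union_disjoint) auto
      then have "norm (sum e Z) \<le> norm (sum e (J \<union> Z)) + norm (sum e J)"
        by (simp add: norm_triangle_ineq4)
      also have "\<dots> < \<epsilon> + \<epsilon>" using J that by (intro add_strict_mono) auto
      finally show ?thesis by simp
    qed
    \<comment> \<open>Larger than every distance from \<open>k\<close> to an index of
      \<open>J\<close>, so that no index of \<open>J\<close> other than \<open>k\<close> is
      congruent to \<open>k\<close> modulo \<open>n\<close>.\<close>
    define n where "n = Suc (nat (\<Sum>j\<in>J. \<bar>j - k\<bar>))"
    have n: "n > 0" by (simp add: n_def)
    have nJ: "\<not> int n dvd j - k" if "j \<in> J" "j \<noteq> k" for j
    proof
      assume "int n dvd j - k"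
      then have "int n \<le> \<bar>j - k\<bar>" using that zdvd_imp_le[of "int n" "\<bar>j - k\<bar>"] by simp
      moreover have "\<bar>j - k\<bar> \<le> (\<Sum>j\<in>J. \<bar>j - k\<bar>)" using that J(1) by (intro member_le_sum) auto
      ultimately show False by (simp add: n_def)
    qed
    define c where "c j = (if int n dvd j - k then e j else 0)" for j
    \<comment> \<open>The weight \<open>w powi (- k)\<close> shifts index \<open>k\<close> to 0, so
      averaging keeps precisely the indices congruent to \<open>k\<close>.\<close>
    have "((\<lambda>j. inverse (of_nat n) *\<^sub>C (\<Sum>w | w ^ n = 1. (w powi (- k)) *\<^sub>C (w powi j) *\<^sub>C e j)) has_sum
        inverse (of_nat n) *\<^sub>C (\<Sum>w | w ^ n = 1. (w powi (- k)) *\<^sub>C (0 :: 'a))) UNIV"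
    proof (rule has_sum_bounded_linear[OF bounded_linear_scaleC_right])
      show "((\<lambda>j. \<Sum>w | w ^ n = 1. (w powi (- k)) *\<^sub>C (w powi j) *\<^sub>C e j) has_sum
        (\<Sum>w | w ^ n = 1. (w powi (- k)) *\<^sub>C (0 :: 'a))) UNIV"
      proof (rule has_sum_sum)
        fix w :: complex assume "w \<in> {w. w ^ n = 1}"
        then have "cmod w ^ n = 1 ^ n" by (simp add: norm_power[symmetric])
        then have "cmod w = 1" by (rule power_eq_imp_eq_base) (use n in auto)
        from has_sum_bounded_linear[OF bounded_linear_scaleC_right hs[OF this]]
        show "((\<lambda>j. (w powi (- k)) *\<^sub>C (w powi j) *\<^sub>C e j) has_sum (w powi (- k)) *\<^sub>C 0) UNIV" .
      qed
    qed
    moreover have "inverse (of_nat n) *\<^sub>C (\<Sum>w | w ^ n = 1. (w powi (- k)) *\<^sub>C (w powi j) *\<^sub>C e j) = c j" for j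
    proof -
      have "(\<Sum>w | w ^ n = 1. (w powi (- k)) *\<^sub>C (w powi j) *\<^sub>C e j) = (\<Sum>w | w ^ n = 1. w powi (j - k)) *\<^sub>C e j"
        unfolding complex_vector.scale_sum_left
      proof (intro sum.cong refl)
        fix w :: complex assume "w \<in> {w. w ^ n = 1}"
        then have "w \<noteq> 0" using n by (auto simp: power_0_left)
        then show "(w powi (- k)) *\<^sub>C (w powi j) *\<^sub>C e j = (w powi (j - k)) *\<^sub>C e j"
          by (simp add: scaleC_scaleC power_int_add[symmetric])
      qed
      then show ?thesis using n by (simp add: sum_roots_unity_powi c_def scaleC_scaleC)
    qed
    ultimately have "(c has_sum 0) UNIV" by simp
    from has_sum_zero_tail[OF this \<epsilon>]
    obtain X where X: "finite X" "\<forall>Y. finite Y \<and> X \<subseteq> Y \<longrightarrow> norm (sum c Y) < \<epsilon>" by blast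
    define Y where "Y = X \<union> insert k J"
    have Y: "finite Y" "insert k J \<subseteq> Y" using X(1) J(1) by (auto simp: Y_def)
    moreover have "X \<subseteq> Y" by (auto simp: Y_def)
    ultimately have Yc: "norm (sum c Y) < \<epsilon>" using X(2) by blast
    define Z where "Z = {j \<in> Y. int n dvd j - k \<and> j \<noteq> k}"
    have "sum c Y = c k + sum c (Y - {k})" using Y by (intro sum.remove) auto
    also have "sum c (Y - {k}) = sum e Z"
      using Y(1) by (intro sum.mono_neutral_cong_right) (auto simp: c_def Z_def)
    also have "c k = e k" by (simp add: c_def)
    finally have "e k = sum c Y - sum e Z" by simp
    then have "norm (e k) \<le> norm (sum c Y) + norm (sum e Z)" by (simp add: norm_triangle_ineq4)
    moreover have "norm (sum e Z) < 2 * \<epsilon>" using Y(1) nJ by (intro small) (auto simp: Z_def)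
    ultimately show ?thesis using Yc by linarith
  qed
  \<comment> \<open>With this \<open>\<epsilon>\<close> the bound reads
    \<open>norm (e k) \<le> norm (e k) / 2\<close>.\<close>
  from this[of "norm (e k) / 6"] have "e k = 0" by (cases "e k = 0") auto
  then show ?thesis using s by (simp add: e_def)
qed

text \<open>Besides making \<open>laurent_coeff\<close> meaningful, this turns identities between
  functions into identities between coefficients.\<close>

lemma has_laurent_series_unique:
  fixes C :: "int \<Rightarrow> 'a::complex_normed_vector"
  assumes "has_laurent_series F a C" "has_laurent_series F a C'"
  shows "C = C'"
proof
  fix k
  obtain r where r: "r > 0" "\<And>z. z \<in> ball a r - {a} \<Longrightarrow> ((\<lambda>j. ((z - a) powi j) *\<^sub>C C j) has_sum F z) UNIV"
    using assms(1) by (auto simp: has_laurent_series_def)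
  obtain r' where r': "r' > 0" "\<And>z. z \<in> ball a r' - {a} \<Longrightarrow> ((\<lambda>j. ((z - a) powi j) *\<^sub>C C' j) has_sum F z) UNIV"
    using assms(2) by (auto simp: has_laurent_series_def)
  have "C k - C' k = 0"
  proof (rule laurent_series_zero[of "min r r'"])
    fix z :: complex assume "z \<in> ball a (min r r') - {a}"
    then have "z \<in> ball a r - {a}" "z \<in> ball a r' - {a}" by auto
    note has_sum_add[OF r(2)[OF this(1)] has_sum_bounded_linear[OF bounded_linear_minus[OF bounded_linear_ident],OF r'(2)[OF this(2)]]]
    then show "((\<lambda>j. ((z - a) powi j) *\<^sub>C (C j - C' j)) has_sum 0) UNIV"
      by (simp add: complex_vector.scale_right_diff_distrib)
  qed (use r r' in auto)
  then show "C k = C' k" by simp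
qed

lemma laurent_coeff_eq: "has_laurent_series F a C \<Longrightarrow> laurent_coeff F a = C"
  unfolding laurent_coeff_def by (rule the_equality) (auto dest: has_laurent_series_unique)

section \<open>Resolvents\<close>

primrec cblinfun_power ::
    "('a::complex_normed_vector, 'a) cblinfun \<Rightarrow> nat \<Rightarrow> ('a, 'a) cblinfun" where
  "cblinfun_power S 0 = id_cblinfun"
| "cblinfun_power S (Suc n) = S o\<^sub>C cblinfun_power S n"

lemma cblinfun_power_commute: "cblinfun_power S n o\<^sub>C S = S o\<^sub>C cblinfun_power S n"
  by (induction n) (simp_all add: cblinfun_compose_assoc)

lemma cblinfun_power_scaleC: "cblinfun_power (c *\<^sub>C S) n = c ^ n *\<^sub>C cblinfun_power S n"
  by (induction n) (simp_all add: scaleC_scaleC mult.commute)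

lemma norm_cblinfun_power: "norm (cblinfun_power S n) \<le> norm S ^ n"
proof (induction n)
  case 0
  then show ?case using norm_id_cblinfun by simp
next
  case (Suc n)
  have "norm (S o\<^sub>C cblinfun_power S n) \<le> norm S * norm (cblinfun_power S n)"
    by (rule norm_cblinfun_compose)
  also have "\<dots> \<le> norm S * norm S ^ n" by (intro mult_left_mono Suc) simp
  finally show ?case by simp
qed

lemma geometric_sum_cblinfun:
  "(id_cblinfun - S) o\<^sub>C (\<Sum>j<n. cblinfun_power S j) = id_cblinfun - cblinfun_power S n"
  "(\<Sum>j<n. cblinfun_power S j) o\<^sub>C (id_cblinfun - S) = id_cblinfun - cblinfun_power S n"
proof -
  have "(\<Sum>j<n. cblinfun_power S j) o\<^sub>C S = S o\<^sub>C (\<Sum>j<n. cblinfun_power S j)"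
    by (simp add: bounded_bilinear.sum_left[OF bounded_bilinear_cblinfun_compose]
        bounded_bilinear.sum_right[OF bounded_bilinear_cblinfun_compose] cblinfun_power_commute)
  moreover show "(id_cblinfun - S) o\<^sub>C (\<Sum>j<n. cblinfun_power S j) = id_cblinfun - cblinfun_power S n"
    by (induction n) (simp_all add: cblinfun_compose_distribs)
  ultimately show "(\<Sum>j<n. cblinfun_power S j) o\<^sub>C (id_cblinfun - S) = id_cblinfun - cblinfun_power S n"
    by (simp add: cblinfun_compose_distribs)
qed

text \<open>Summability of the powers is assumed instead of \<open>norm S < 1\<close>, because in
  \<open>power_series_on_resolvent\<close> the norm of \<open>z S\<close> may be large. The
  telescoped geometric sums pass to the limit on both sides.\<close>

lemma neumann_series:
  fixes S :: "('a::cbanach, 'a) cblinfun"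
  assumes S: "summable (\<lambda>n. norm (cblinfun_power S n))"
  obtains Q where "cblinfun_power S sums Q" "is_inverse (id_cblinfun - S) Q"
proof
  let ?Q = "suminf (cblinfun_power S)"
  have sm: "summable (cblinfun_power S)" using S by (rule summable_norm_cancel)
  then show "cblinfun_power S sums ?Q" by (rule summable_sums)
  have lim: "(\<lambda>n. \<Sum>j<n. cblinfun_power S j) \<longlonglongrightarrow> ?Q" using sm by (rule summable_LIMSEQ)
  have "(\<lambda>n. id_cblinfun - cblinfun_power S n) \<longlonglongrightarrow> id_cblinfun - 0"
    using summable_LIMSEQ_zero[OF sm] by (intro tendsto_intros)
  then have lim': "(\<lambda>n. id_cblinfun - cblinfun_power S n) \<longlonglongrightarrow> id_cblinfun" by simp
  have "(id_cblinfun - S) o\<^sub>C ?Q = id_cblinfun"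
    using LIMSEQ_unique[OF bounded_linear.tendsto[OF bounded_linear_compose_right lim] lim'[folded geometric_sum_cblinfun(1)]] .
  moreover have "?Q o\<^sub>C (id_cblinfun - S) = id_cblinfun"
    using LIMSEQ_unique[OF bounded_linear.tendsto[OF bounded_linear_compose_left lim] lim'[folded geometric_sum_cblinfun(2)]] .
  ultimately show "is_inverse (id_cblinfun - S) ?Q" by (simp add: is_inverse_def)
qed

section \<open>Resolvent estimates and the radius of the Neumann series\<close>

lemma resolvent_identity:
  assumes "is_inverse (id_cblinfun - z *\<^sub>C S) P" "is_inverse (id_cblinfun - w *\<^sub>C S) Q"
  shows "P - Q = (z - w) *\<^sub>C (P o\<^sub>C S o\<^sub>C Q)"
proof -
  have "P - Q = (P o\<^sub>C ((id_cblinfun - w *\<^sub>C S) o\<^sub>C Q)) - ((P o\<^sub>C (id_cblinfun - z *\<^sub>C S)) o\<^sub>C Q)"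
    using assms by (simp add: is_inverse_def)
  also have "\<dots> = (z - w) *\<^sub>C (P o\<^sub>C S o\<^sub>C Q)"
    by (simp add: cblinfun_compose_assoc cblinfun_compose_distribs complex_vector.scale_left_diff_distrib)
  finally show ?thesis .
qed

lemma norm_resolvent_diff:
  assumes "is_inverse (id_cblinfun - z *\<^sub>C S) P" "is_inverse (id_cblinfun - w *\<^sub>C S) Q"
  shows "norm (P - Q) \<le> cmod (z - w) * (norm P * norm S * norm Q)"
proof -
  have "norm (P o\<^sub>C S o\<^sub>C Q) \<le> norm (P o\<^sub>C S) * norm Q" by (rule norm_cblinfun_compose)
  also have "\<dots> \<le> norm P * norm S * norm Q"
    by (intro mult_right_mono norm_cblinfun_compose) simp
  finally have "cmod (z - w) * norm (P o\<^sub>C S o\<^sub>C Q) \<le> cmod (z - w) * (norm P * norm S * norm Q)"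
    by (intro mult_left_mono) auto
  then show ?thesis by (simp add: resolvent_identity[OF assms] norm_scaleC)
qed

text \<open>Near \<open>z\<close> the resolvent identity bounds \<open>norm (f w)\<close> by
  \<open>norm (f z)\<close> plus half of itself, hence by twice \<open>norm (f z)\<close>. The same
  identity then gives continuity, and compactness gives the bound.\<close>

lemma resolvent_bounded:
  fixes S :: "('a::complex_normed_vector, 'a) cblinfun"
  assumes K: "compact K" and f: "\<And>z. z \<in> K \<Longrightarrow> is_inverse (id_cblinfun - z *\<^sub>C S) (f z)"
  obtains M where "M > 0" "\<And>z. z \<in> K \<Longrightarrow> norm (f z) \<le> M"
proof -
  have "continuous_on K f"
    unfolding continuous_on_def
  proof
    fix z assume z: "z \<in> K"
    define m k where "m = norm (f z)" and "k = norm S"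
    have "((\<lambda>w. f w - f z) \<longlongrightarrow> 0) (at z within K)"
    proof (rule Lim_null_comparison)
      show "((\<lambda>w. cmod (z - w) * (m * k * (2 * m))) \<longlongrightarrow> 0) (at z within K)"
        by (auto intro!: tendsto_eq_intros)
      have "((\<lambda>w. cmod (z - w) * (m * k)) \<longlongrightarrow> 0) (at z within K)"
        by (auto intro!: tendsto_eq_intros)
      then have "\<forall>\<^sub>F w in at z within K. cmod (z - w) * (m * k) < 1/2"
        by (rule order_tendstoD) simp
      moreover have "\<forall>\<^sub>F w in at z within K. w \<in> K" by (simp add: eventually_at_filter)
      ultimately show "\<forall>\<^sub>F w in at z within K. norm (f w - f z) \<le> cmod (z - w) * (m * k * (2 * m))"
      proof eventually_elim
        case (elim w)
        have d: "norm (f z - f w) \<le> cmod (z - w) * (m * k * norm (f w))"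
          unfolding m_def k_def using norm_resolvent_diff[OF f[OF z] f[OF elim(2)]] .
        have "norm (f w) \<le> norm (f z) + norm (f z - f w)"
          using norm_triangle_ineq4[of "f z" "f z - f w"] by simp
        also have "\<dots> \<le> m + (cmod (z - w) * (m * k)) * norm (f w)" using d by (simp add: m_def mult_ac)
        also have "\<dots> \<le> m + 1/2 * norm (f w)"
          using elim(1) by (intro add_left_mono mult_right_mono) auto
        finally have "norm (f w) \<le> 2 * m" by simp
        then have "cmod (z - w) * (m * k) * norm (f w) \<le> cmod (z - w) * (m * k) * (2 * m)"
          by (intro mult_left_mono) (auto simp: m_def k_def)
        then show ?case using d by (simp add: norm_minus_commute mult_ac)
      qed
    qed
    then show "(f \<longlongrightarrow> f z) (at z within K)" by (rule LIM_zero_cancel)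
  qed
  then have "bounded (f ` K)" using K by (intro compact_imp_bounded compact_continuous_image)
  then show thesis using that unfolding bounded_pos by auto
qed

text \<open>The argument is Rickart's: averaging the resolvent over the circle of radius \<open>a\<close> gives
  \<open>(I - a\<^sup>n S\<^sup>n)\<^sup>-\<^sup>1\<close>, which depends on \<open>a\<close> in a Lipschitz way, uniformly in \<open>n\<close>. Hence the decay
  of \<open>a\<^sup>n S\<^sup>n\<close> propagates from small \<open>a\<close> by steps of a fixed length.\<close>

lemma bounded_powers_of_resolvent:
  fixes S :: "('a::complex_normed_vector, 'a) cblinfun"
  assumes inv: "\<And>z. cmod z < R \<Longrightarrow> op_invertible (id_cblinfun - z *\<^sub>C S)" and r: "0 \<le> r" "r < R"
  obtains B where "\<And>n. r ^ n * norm (cblinfun_power S n) \<le> B"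
proof -
  \<comment> \<open>A closed disk strictly inside the region of invertibility, where the resolvent
    is bounded and Lipschitz, with room beyond \<open>r\<close> for the steps below.\<close>
  define r0 where "r0 = (r + R) / 2"
  have r0: "r < r0" "r0 < R" "0 < r0" using r by (auto simp: r0_def)
  define f where "f z = op_inverse (id_cblinfun - z *\<^sub>C S)" for z
  have f: "is_inverse (id_cblinfun - z *\<^sub>C S) (f z)" if "cmod z \<le> r0" for z
    unfolding f_def using that r0 by (intro op_invertible_inverse inv) auto
  obtain M where M: "M > 0" "\<And>z. cmod z \<le> r0 \<Longrightarrow> norm (f z) \<le> M"
    using resolvent_bounded[of "cball 0 r0" S f] f by auto
  define L where "L = M * norm S * M + 1"
  have L: "L > 0" using M by (auto simp: L_def intro!: add_nonneg_pos)
  have lip: "norm (f z - f w) \<le> L * cmod (z - w)" if "cmod z \<le> r0" "cmod w \<le> r0" for z w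
  proof -
    have "norm (f z - f w) \<le> cmod (z - w) * (norm (f z) * norm S * norm (f w))"
      by (rule norm_resolvent_diff[OF f[OF that(1)] f[OF that(2)]])
    also have "\<dots> \<le> cmod (z - w) * (M * norm S * M)"
      using M(1) by (intro mult_left_mono mult_mono M(2) that mult_nonneg_nonneg) auto
    also have "\<dots> \<le> cmod (z - w) * L" by (intro mult_left_mono) (auto simp: L_def)
    finally show ?thesis by (simp add: mult.commute)
  qed
  define P where "P n a = complex_of_real a ^ n *\<^sub>C cblinfun_power S n" for n and a :: real
  have nP: "norm (P n a) = a ^ n * norm (cblinfun_power S n)" if "a \<ge> 0" for n a
    using that by (simp add: P_def norm_scaleC norm_power)
  define V where "V n a = inverse (of_nat n) *\<^sub>C (\<Sum>w | w ^ n = 1. f (of_real a * w))" for n and a :: real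
  have unit: "cmod w = 1" if "w ^ n = 1" "n > 0" for w :: complex and n
  proof -
    have "cmod w ^ n = 1 ^ n" using that by (simp add: norm_power[symmetric])
    then show ?thesis by (rule power_eq_imp_eq_base) (use that in auto)
  qed
  have fin: "finite {w::complex. w ^ n = 1}" "card {w::complex. w ^ n = 1} = n" if "n > 0" for n
    using that finite_roots_unity[of n] card_roots_unity_eq[of n] by auto
  have inverse_P: "(id_cblinfun - P n a) o\<^sub>C V n a = id_cblinfun" if n: "n > 0" and a: "0 \<le> a" "a \<le> r0" for n a
  proof -
    \<comment> \<open>For \<open>w ^ n = 1\<close>, \<open>P n a\<close> is the \<open>n\<close>-th
      power of \<open>(a w) S\<close>, so the factor \<open>I - (a w) S\<close> of the telescoping
      sum cancels against the resolvent. In the average over \<open>w\<close> only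
      \<open>j = 0\<close> remains.\<close>
    have summand: "(id_cblinfun - P n a) o\<^sub>C f (of_real a * w) = (\<Sum>j<n. w ^ j *\<^sub>C P j a)" if w: "w ^ n = 1" for w
    proof -
      have "cmod (of_real a * w) \<le> r0" using a unit[OF w n] by (simp add: norm_mult)
      note i = f[OF this]
      let ?T = "(of_real a * w) *\<^sub>C S"
      have "P n a = cblinfun_power ?T n"
        by (simp add: P_def cblinfun_power_scaleC power_mult_distrib w)
      then have "(id_cblinfun - P n a) o\<^sub>C f (of_real a * w) =
          ((\<Sum>j<n. cblinfun_power ?T j) o\<^sub>C (id_cblinfun - ?T)) o\<^sub>C f (of_real a * w)"
        by (simp add: geometric_sum_cblinfun)
      also have "\<dots> = (\<Sum>j<n. cblinfun_power ?T j)"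
        using i by (simp add: cblinfun_compose_assoc is_inverse_def)
      also have "\<dots> = (\<Sum>j<n. w ^ j *\<^sub>C P j a)"
        by (simp add: P_def cblinfun_power_scaleC power_mult_distrib scaleC_scaleC mult.commute)
      finally show ?thesis .
    qed
    have "(id_cblinfun - P n a) o\<^sub>C V n a =
        inverse (of_nat n) *\<^sub>C (\<Sum>w | w ^ n = 1. (id_cblinfun - P n a) o\<^sub>C f (of_real a * w))"
      by (simp add: V_def bounded_bilinear.sum_right[OF bounded_bilinear_cblinfun_compose])
    also have "(\<Sum>w | w ^ n = 1. (id_cblinfun - P n a) o\<^sub>C f (of_real a * w)) =
        (\<Sum>w | w ^ n = 1. \<Sum>j<n. w ^ j *\<^sub>C P j a)"
      by (intro sum.cong refl summand) auto
    also have "\<dots> = (\<Sum>j<n. \<Sum>w | w ^ n = 1. w ^ j *\<^sub>C P j a)" by (rule sum.swap)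
    also have "\<dots> = (\<Sum>j<n. (\<Sum>w | w ^ n = 1. w ^ j) *\<^sub>C P j a)"
      by (simp add: complex_vector.scale_sum_left)
    also have "\<dots> = (\<Sum>j\<in>{0}. (\<Sum>w | w ^ n = 1. w ^ j) *\<^sub>C P j a)"
      using n by (intro sum.mono_neutral_right) (auto simp: sum_roots_unity_power)
    also have "\<dots> = of_nat n *\<^sub>C id_cblinfun" using fin[OF n] by (simp add: P_def)
    finally show ?thesis using n by (simp add: scaleC_scaleC)
  qed
  have average: "norm (inverse (of_nat n) *\<^sub>C (\<Sum>w | w ^ n = 1. g w)) \<le> C"
    if n: "n > 0" and "\<And>w. w ^ n = 1 \<Longrightarrow> norm (g w) \<le> C"
    for n and g :: "complex \<Rightarrow> ('a, 'a) cblinfun" and C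
  proof -
    have "norm (\<Sum>w | w ^ n = 1. g w) \<le> (\<Sum>w::complex | w ^ n = 1. C)"
      by (rule sum_norm_le) (use that in auto)
    then show ?thesis
      using n fin[OF n] by (simp add: norm_scaleC norm_inverse norm_of_nat
          divide_inverse_commute[symmetric] divide_le_eq mult.commute[of C])
  qed
  have V_bound: "norm (V n a) \<le> M" if "n > 0" "0 \<le> a" "a \<le> r0" for n a
    unfolding V_def by (rule average) (use that unit in \<open>auto intro!: M(2) simp: norm_mult\<close>)
  have V_lip: "norm (V n a - V n b) \<le> L * \<bar>a - b\<bar>"
    if n: "n > 0" and "0 \<le> a" "a \<le> r0" "0 \<le> b" "b \<le> r0" for n a b
  proof -
    have "V n a - V n b = inverse (of_nat n) *\<^sub>C (\<Sum>w | w ^ n = 1. f (of_real a * w) - f (of_real b * w))"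
      by (simp add: V_def sum_subtractf complex_vector.scale_right_diff_distrib)
    also have "norm \<dots> \<le> L * \<bar>a - b\<bar>"
    proof (rule average[OF n])
      fix w :: complex assume "w ^ n = 1"
      then have w: "cmod w = 1" using unit n by blast
      have "norm (f (of_real a * w) - f (of_real b * w)) \<le> L * cmod (of_real a * w - of_real b * w)"
        using that w by (intro lip) (auto simp: norm_mult)
      also have "of_real a * w - of_real b * w = of_real (a - b) * w" by (simp add: left_diff_distrib)
      finally show "norm (f (of_real a * w) - f (of_real b * w)) \<le> L * \<bar>a - b\<bar>"
        by (simp only: norm_mult norm_of_real w)
    qed
    finally show ?thesis .
  qed
  \<comment> \<open>If \<open>P n a\<close> is small, \<open>V n a\<close> is within 1/4 of the
    identity, and the Lipschitz bound keeps \<open>V n b\<close> within 3/4. At \<open>b\<close> the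
    identity \<open>P = (V - I) - P (V - I)\<close> then gives
    \<open>norm P \<le> 3/4 + 3/4 norm P\<close>, whence the 3.\<close>
  have step: "\<forall>\<^sub>F n in sequentially. norm (P n b) \<le> 3"
    if a: "(\<lambda>n. norm (P n a)) \<longlonglongrightarrow> 0" "0 \<le> a" "a \<le> b" "b \<le> r0" "L * (b - a) \<le> 1/2" for a b
  proof -
    have "(\<lambda>n. norm (P n a) * M) \<longlonglongrightarrow> 0" using tendsto_mult_left_zero[OF a(1)] .
    then have "\<forall>\<^sub>F n in sequentially. norm (P n a) * M < 1/4" by (rule order_tendstoD) simp
    then show ?thesis using eventually_gt_at_top[of 0]
    proof eventually_elim
      case (elim n)
      have b: "0 \<le> b" "a \<le> r0" using a by auto
      have PV: "V n c - id_cblinfun = P n c o\<^sub>C V n c" if "0 \<le> c" "c \<le> r0" for c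
        using inverse_P[OF elim(2) that] by (simp add: cblinfun_compose_distribs algebra_simps)
      have "norm (V n a - id_cblinfun) \<le> norm (P n a) * norm (V n a)"
        unfolding PV[OF a(2) b(2)] by (rule norm_cblinfun_compose)
      also have "\<dots> \<le> norm (P n a) * M"
        using V_bound[OF elim(2) a(2) b(2)] by (intro mult_left_mono) auto
      finally have "norm (V n a - id_cblinfun) \<le> 1/4" using elim(1) by simp
      moreover have "norm (V n b - V n a) \<le> 1/2"
        using V_lip[OF elim(2) b(1) a(4) a(2) b(2)] a by simp
      moreover have "norm (V n b - id_cblinfun) \<le> norm (V n b - V n a) + norm (V n a - id_cblinfun)"
        using norm_triangle_ineq[of "V n b - V n a" "V n a - id_cblinfun"] by simp
      ultimately have V: "norm (V n b - id_cblinfun) \<le> 3/4" by simp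
      have "P n b = (V n b - id_cblinfun) - (P n b o\<^sub>C (V n b - id_cblinfun))"
        unfolding PV[OF b(1) a(4)] by (simp add: PV[OF b(1) a(4), symmetric] cblinfun_compose_distribs)
      then have "norm (P n b) \<le> norm (V n b - id_cblinfun) + norm (P n b o\<^sub>C (V n b - id_cblinfun))"
        by (metis norm_triangle_ineq4)
      also have "norm (P n b o\<^sub>C (V n b - id_cblinfun)) \<le> norm (P n b) * norm (V n b - id_cblinfun)"
        by (rule norm_cblinfun_compose)
      also have "\<dots> \<le> norm (P n b) * (3/4)" by (intro mult_left_mono V) simp
      finally show ?case using V by simp
    qed
  qed
  \<comment> \<open>A step of length \<open>2 h\<close> costs at most 1/2 in the Lipschitz bound,
    and \<open>r + 2 h\<close> does not exceed \<open>r0\<close>.\<close>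
  define h where "h = min ((r0 - r) / 2) (1 / (4 * L))"
  have h: "h > 0" "2 * h \<le> r0 - r" using r0 L by (auto simp: h_def min_def field_simps)
  have hL: "L * (2 * h) \<le> 1/2"
  proof -
    have "h \<le> 1 / (4 * L)" by (simp add: h_def)
    then show ?thesis using L by (simp add: field_simps)
  qed
  have decay: "(\<lambda>n. norm (P n (real k * h))) \<longlonglongrightarrow> 0" if "real k * h \<le> r + h" for k
    using that
  proof (induction k)
    case 0
    \<comment> \<open>Shifted by one because \<open>P 0 0\<close> is the identity; all later terms
      vanish.\<close>
    have "(\<lambda>n. norm (P (Suc n) 0)) \<longlonglongrightarrow> 0" by (simp add: P_def)
    then have "(\<lambda>n. norm (P n 0)) \<longlonglongrightarrow> 0" by (rule LIMSEQ_imp_Suc)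
    then show ?case by simp
  next
    case (Suc k)
    \<comment> \<open>\<open>step\<close> yields only boundedness at \<open>b\<close>, which lies
      \<open>2 h\<close> ahead; at \<open>a + h\<close> this becomes geometric decay with ratio
      \<open>(a + h) / b\<close>.\<close>
    define a b where "a = real k * h" and "b = real k * h + 2 * h"
    have ab: "0 \<le> a" "a \<le> b" "b \<le> r0" "b > 0" "b - a = 2 * h" "real (Suc k) * h = a + h"
      using Suc.prems h by (auto simp: a_def b_def algebra_simps intro: add_nonneg_pos)
    have "(\<lambda>n. norm (P n a)) \<longlonglongrightarrow> 0" unfolding a_def using Suc h by (intro Suc.IH) (auto simp: algebra_simps)
    from step[OF this ab(1-3)] have ev: "\<forall>\<^sub>F n in sequentially. norm (P n b) \<le> 3"
      using hL ab(5) by simp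
    show ?case unfolding ab(6)
    proof (rule Lim_null_comparison)
      have "(a + h) / b < 1" "0 \<le> (a + h) / b" using ab h by (auto simp: a_def b_def)
      then show "(\<lambda>n. ((a + h) / b) ^ n * 3) \<longlonglongrightarrow> 0"
        by (intro tendsto_mult_left_zero LIMSEQ_realpow_zero)
      show "\<forall>\<^sub>F n in sequentially. norm (norm (P n (a + h))) \<le> ((a + h) / b) ^ n * 3"
        using ev
      proof eventually_elim
        case (elim n)
        have "norm (P n (a + h)) = ((a + h) / b) ^ n * norm (P n b)"
          using ab h by (simp add: nP power_divide)
        also have "\<dots> \<le> ((a + h) / b) ^ n * 3" using elim ab h by (intro mult_left_mono) auto
        finally show ?case by simp
      qed
    qed
  qed
  define k where "k = nat \<lceil>r / h\<rceil>"
  have k: "r \<le> real k * h" "real k * h \<le> r + h"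
  proof -
    have "r / h \<le> real k" "real k \<le> r / h + 1"
      using r h unfolding k_def by (auto simp: of_nat_ceiling intro: of_nat_ceiling)
    then show "r \<le> real k * h" "real k * h \<le> r + h"
      using h by (auto simp: field_simps)
  qed
  have "Bseq (\<lambda>n. norm (P n (real k * h)))"
    using decay[OF k(2)] convergent_imp_Bseq convergent_def by blast
  then obtain B where B: "\<forall>n. norm (norm (P n (real k * h))) \<le> B" by (rule BseqE)
  show thesis
  proof
    fix n
    have "r ^ n * norm (cblinfun_power S n) \<le> (real k * h) ^ n * norm (cblinfun_power S n)"
      using r k by (intro mult_right_mono power_mono) auto
    also have "\<dots> = norm (P n (real k * h))" using h by (simp add: nP)
    also have "\<dots> \<le> B" using B by simp
    finally show "r ^ n * norm (cblinfun_power S n) \<le> B" .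
  qed
qed

text \<open>With \<open>r\<close> strictly between \<open>cmod z\<close> and \<open>R\<close>,
  boundedness of \<open>r^n norm (S^n)\<close> dominates the Neumann series at \<open>z\<close> by a
  geometric series of ratio \<open>cmod z / r\<close>.\<close>

lemma power_series_on_resolvent:
  fixes S :: "('a::cbanach, 'a) cblinfun"
  assumes inv: "\<And>z. cmod z < R \<Longrightarrow> op_invertible (id_cblinfun - z *\<^sub>C S)"
  shows "power_series_on (\<lambda>z. op_inverse (id_cblinfun - z *\<^sub>C S)) R (cblinfun_power S)"
  unfolding power_series_on_def
proof
  fix z :: complex assume "z \<in> ball 0 R"
  then have z: "cmod z < R" by simp
  define r where "r = (cmod z + R) / 2"
  have r: "0 \<le> r" "r < R" "cmod z < r" using z norm_ge_zero[of z] by (auto simp: r_def simp del: norm_ge_zero)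
  obtain B where B: "\<And>n. r ^ n * norm (cblinfun_power S n) \<le> B"
    using bounded_powers_of_resolvent[of R S r] inv r by blast
  have "summable (\<lambda>n. (cmod z / r) ^ n * B)"
    using r le_less_trans[OF norm_ge_zero r(3)] by (intro summable_mult2 summable_geometric) auto
  then have sm: "summable (\<lambda>n. norm (cblinfun_power S n) * cmod z ^ n)"
  proof (rule summable_comparison_test')
    fix n
    have "norm (cblinfun_power S n) * cmod z ^ n = (cmod z / r) ^ n * (r ^ n * norm (cblinfun_power S n))"
      using r(3) norm_ge_zero[of z] by (simp add: power_divide del: norm_ge_zero)
    also have "\<dots> \<le> (cmod z / r) ^ n * B" using r by (intro mult_left_mono B) auto
    finally show "norm (norm (cblinfun_power S n) * cmod z ^ n) \<le> (cmod z / r) ^ n * B" by simp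
  qed
  then have "summable (\<lambda>n. norm (cblinfun_power (z *\<^sub>C S) n))"
    by (simp add: cblinfun_power_scaleC norm_scaleC norm_power mult.commute)
  then obtain Q where Q: "cblinfun_power (z *\<^sub>C S) sums Q" "is_inverse (id_cblinfun - z *\<^sub>C S) Q"
    by (rule neumann_series)
  then have "(\<lambda>n. z ^ n *\<^sub>C cblinfun_power S n) sums op_inverse (id_cblinfun - z *\<^sub>C S)"
    by (simp add: op_inverse_eq cblinfun_power_scaleC[abs_def])
  then show "summable (\<lambda>n. norm (cblinfun_power S n) * cmod z ^ n) \<and>
      (\<lambda>n. z ^ n *\<^sub>C cblinfun_power S n) sums op_inverse (id_cblinfun - z *\<^sub>C S)"
    using sm by blast
qed

section \<open>Complements, generalized inverses and bounded inverses\<close>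

text \<open>\<open>P x y\<close> is a graph with the value first. The norm bound is a separate
  hypothesis so that graphs not known to be closed can be treated, as for \<open>E\<close> in
  \<open>square_projection\<close>.\<close>

lemma bounded_functional_relation:
  fixes P :: "'x::complex_normed_vector \<Rightarrow> 'y::complex_normed_vector \<Rightarrow> bool"
  assumes add: "\<And>x y x' y'. P x y \<Longrightarrow> P x' y' \<Longrightarrow> P (x + x') (y + y')"
    and scale: "\<And>c x y. P x y \<Longrightarrow> P (c *\<^sub>C x) (c *\<^sub>C y)"
    and zero: "\<And>x. P x 0 \<Longrightarrow> x = 0"
    and bound: "\<And>y. \<exists>x. P x y \<and> norm x \<le> c * norm y"
  obtains B :: "('y, 'x) cblinfun" where "\<And>x y. P x y \<longleftrightarrow> x = B y"
proof -
  have unique: "x = x'" if "P x y" "P x' y" for x x' y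
    using zero[of "x + (- 1) *\<^sub>C x'"] add[OF that(1) scale[OF that(2), of "- 1"]] by simp
  obtain g where g: "\<And>y. P (g y) y" "\<And>y. norm (g y) \<le> c * norm y"
    using bound by metis
  have gP: "P x y \<longleftrightarrow> x = g y" for x y using g unique by blast
  have "bounded_linear g"
    by (rule bounded_linear_intro[where K = c])
      (use add[OF g(1) g(1)] scale[OF g(1)] g(2) in \<open>auto simp: gP scaleR_scaleC mult.commute\<close>)
  moreover have "g (a *\<^sub>C y) = a *\<^sub>C g y" for a y using scale[OF g(1)] by (simp add: gP)
  ultimately have "cblinfun_apply (CBlinfun g) = g" by (intro CBlinfun_inverse) simp
  then show thesis using that[of "CBlinfun g"] gP by simp
qed

text \<open>A closed graph theorem in relational form, with the bound from
  \<open>closed_relation_bound\<close>. Inverses and projections can thus be specified by the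
  equations that determine them.\<close>

lemma closed_functional_relation:
  fixes P :: "'x::cbanach \<Rightarrow> 'y::cbanach \<Rightarrow> bool"
  assumes add: "\<And>x y x' y'. P x y \<Longrightarrow> P x' y' \<Longrightarrow> P (x + x') (y + y')"
    and scale: "\<And>c x y. P x y \<Longrightarrow> P (c *\<^sub>C x) (c *\<^sub>C y)"
    and zero: "\<And>x. P x 0 \<Longrightarrow> x = 0"
    and total: "\<And>y. \<exists>x. P x y"
    and cl: "closed {p. P (fst p) (snd p)}"
  obtains B :: "('y, 'x) cblinfun" where "\<And>x y. P x y \<longleftrightarrow> x = B y"
proof -
  have sub: "subspace {p. P (fst p) (snd p)}"
  proof (rule subspaceI)
    obtain x where "P x 0" using total by blast
    with zero have "P 0 0" by blast
    then show "0 \<in> {p. P (fst p) (snd p)}" by simp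
  qed (use add scale in \<open>auto simp: scaleR_scaleC\<close>)
  obtain c where c: "\<And>y. \<exists>x. (x, y) \<in> {p. P (fst p) (snd p)} \<and> norm x \<le> c * norm y"
    by (rule closed_relation_bound[OF sub cl]) (use total in auto)
  show thesis
    by (rule bounded_functional_relation[of P c]) (use add scale zero c that in auto)
qed

lemma continuous_on_cblinfun [continuous_intros]:
  "continuous_on S f \<Longrightarrow> continuous_on S (\<lambda>x. cblinfun_apply A (f x))"
  by (rule bounded_linear.continuous_on[OF bounded_linear_cblinfun])

text \<open>The graph of the inverse is closed, so its boundedness is automatic; later invertibility
  proofs reduce to solving equations.\<close>

lemma op_invertible_iff_bij:
  fixes A :: "('a::cbanach, 'a) cblinfun"
  shows "op_invertible A \<longleftrightarrow> (\<forall>x. A x = 0 \<longrightarrow> x = 0) \<and> (\<forall>y. \<exists>x. A x = y)" (is "_ \<longleftrightarrow> ?bij")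
proof
  assume "op_invertible A"
  then obtain B where "is_inverse A B" by (auto simp: op_invertible_def)
  then have AB: "A (B x) = x" "B (A x) = x" for x
    unfolding is_inverse_def by (metis cblinfun_compose.rep_eq id_cblinfun.rep_eq)+
  then show ?bij by (metis cblinfun_linear_simps(4))
next
  assume bij: ?bij
  obtain B :: "('a, 'a) cblinfun" where B: "\<And>x y. cblinfun_apply A x = y \<longleftrightarrow> x = cblinfun_apply B y"
  proof (rule closed_functional_relation[of "\<lambda>x y. A x = y"])
    show "closed {p. A (fst p) = snd p}" by (intro closed_Collect_eq continuous_intros)
  qed (use bij in auto)
  have "is_inverse A B"
    unfolding is_inverse_def by (auto intro!: cblinfun_eqI simp: cblinfun_apply_simps B) (metis B)
  then show "op_invertible A" by (auto simp: op_invertible_def)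
qed

lemma op_inverse_apply:
  assumes "op_invertible A"
  shows "A (op_inverse A x) = x" "op_inverse A (A x) = x"
  using op_invertible_inverse[OF assms] unfolding is_inverse_def
  by (metis cblinfun_compose.rep_eq id_cblinfun.rep_eq)+

section \<open>Projections and generalized inverses along complements\<close>

lemma is_complementD:
  assumes "is_complement V W"
  shows "0 \<in> V" "0 \<in> W" "x \<in> V \<Longrightarrow> y \<in> V \<Longrightarrow> x + y \<in> V" "x \<in> W \<Longrightarrow> y \<in> W \<Longrightarrow> x + y \<in> W"
    "x \<in> V \<Longrightarrow> y \<in> V \<Longrightarrow> x - y \<in> V" "x \<in> W \<Longrightarrow> y \<in> W \<Longrightarrow> x - y \<in> W"
    "x \<in> V \<Longrightarrow> c *\<^sub>C x \<in> V" "x \<in> W \<Longrightarrow> c *\<^sub>C x \<in> W" "x \<in> V \<Longrightarrow> x \<in> W \<Longrightarrow> x = 0"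
    "\<exists>v w. v \<in> V \<and> w \<in> W \<and> x = v + w"
proof -
  have V: "csubspace V" and W: "csubspace W" and VW: "V \<inter> W = {0}" "sum_set V W = UNIV"
    using assms by (auto simp: is_direct_sum_def)
  show "0 \<in> V" "0 \<in> W" "x \<in> V \<Longrightarrow> y \<in> V \<Longrightarrow> x + y \<in> V" "x \<in> W \<Longrightarrow> y \<in> W \<Longrightarrow> x + y \<in> W"
    "x \<in> V \<Longrightarrow> y \<in> V \<Longrightarrow> x - y \<in> V" "x \<in> W \<Longrightarrow> y \<in> W \<Longrightarrow> x - y \<in> W"
    "x \<in> V \<Longrightarrow> c *\<^sub>C x \<in> V" "x \<in> W \<Longrightarrow> c *\<^sub>C x \<in> W"
    using complex_vector.subspace_0[OF V] complex_vector.subspace_0[OF W]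
      complex_vector.subspace_add[OF V] complex_vector.subspace_add[OF W]
      complex_vector.subspace_diff[OF V] complex_vector.subspace_diff[OF W]
      complex_vector.subspace_scale[OF V] complex_vector.subspace_scale[OF W] by auto
  show "x \<in> V \<Longrightarrow> x \<in> W \<Longrightarrow> x = 0" using VW(1) by blast
  have "x \<in> sum_set V W" using VW(2) by simp
  then show "\<exists>v w. v \<in> V \<and> w \<in> W \<and> x = v + w" unfolding sum_set_def by blast
qed

text \<open>The relation between \<open>x\<close> and its \<open>W\<close>-component has a closed
  graph, so the projection exists as a bounded operator, and it is the only candidate for the
  \<open>THE\<close> in \<open>proj_onto\<close>. Its kernel is what \<open>gen_inverse\<close>
  needs on \<open>ran A\<close>.\<close>

lemma ker_proj_onto:
  fixes V :: "'a::cbanach set"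
  assumes VW: "is_complement V W"
  shows "ker (proj_onto W V) = V"
proof -
  note D = is_complementD[OF VW]
  have cl: "closed V" "closed W" using VW by (auto simp: is_direct_sum_def)
  obtain Q :: "('a, 'a) cblinfun" where Q: "\<And>w x. w \<in> W \<and> x - w \<in> V \<longleftrightarrow> w = cblinfun_apply Q x"
  proof (rule closed_functional_relation[of "\<lambda>w x. w \<in> W \<and> x - w \<in> V"])
    fix x y x' y' assume "x \<in> W \<and> y - x \<in> V" "x' \<in> W \<and> y' - x' \<in> V"
    then show "x + x' \<in> W \<and> y + y' - (x + x') \<in> V"
      using D(4)[of x x'] D(3)[of "y - x" "y' - x'"] by (simp add: algebra_simps)
  next
    fix c :: complex and x y assume "x \<in> W \<and> y - x \<in> V"
    then show "c *\<^sub>C x \<in> W \<and> c *\<^sub>C y - c *\<^sub>C x \<in> V"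
      using D(7)[of "y - x" c] D(8)[of x c] by (simp add: complex_vector.scale_right_diff_distrib)
  next
    fix x assume "x \<in> W \<and> 0 - x \<in> V"
    then show "x = 0" using D(7)[of "- x" "- 1"] D(9)[of x] by simp
  next
    fix y obtain v w where "v \<in> V" "w \<in> W" "y = v + w" using D(10) by blast
    then show "\<exists>x. x \<in> W \<and> y - x \<in> V" by (intro exI[of _ w]) simp
  next
    have "closed ({p. fst p \<in> W} \<inter> {p. snd p - fst p \<in> V})"
      by (intro closed_Int closed_vimage[OF cl(2), unfolded vimage_def] closed_vimage[OF cl(1), unfolded vimage_def]
          continuous_intros)
    then show "closed {p. fst p \<in> W \<and> snd p - fst p \<in> V}" by (simp add: Collect_conj_eq)
  qed blast
  have W: "Q x \<in> W" "x - Q x \<in> V" for x using Q[of "Q x" x] by auto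
  have QW: "Q w = w" if "w \<in> W" for w using Q[of w w] that D(1) by simp
  have QV: "Q v = 0" if "v \<in> V" for v using Q[of 0 v] that D(2) by simp
  have kQ: "ker Q = V"
  proof
    show "ker Q \<subseteq> V"
    proof
      fix x assume "x \<in> ker Q"
      then show "x \<in> V" using W(2)[of x] by (simp add: ker_def)
    qed
    show "V \<subseteq> ker Q" using QV by (auto simp: ker_def)
  qed
  have "proj_onto W V = Q"
    unfolding proj_onto_def
  proof (rule the_equality)
    have "ran Q = W" unfolding ran_def using W(1) by (auto intro!: image_eqI[where f = Q, OF QW[symmetric]])
    moreover have "Q o\<^sub>C Q = Q" by (rule cblinfun_eqI) (simp add: cblinfun_compose.rep_eq QW W)
    ultimately show "Q o\<^sub>C Q = Q \<and> ran Q = W \<and> ker Q = V" using kQ by blast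
  next
    fix P assume P: "P o\<^sub>C P = P \<and> ran P = W \<and> ker P = V"
    show "P = Q"
    proof (rule cblinfun_eqI)
      fix x
      have PP: "P (P x) = P x" using P by (metis cblinfun_compose.rep_eq)
      have "P x \<in> W" using P by (auto simp: ran_def)
      moreover have "x - P x \<in> ker P" by (simp add: ker_def PP)
      ultimately show "P x = Q x" using Q[of "P x" x] P by simp
    qed
  qed
  then show ?thesis using kQ by simp
qed

text \<open>The projection term vanishes on \<open>ran A\<close>. A preimage in \<open>Kc\<close>
  arises from any preimage by dropping its component in \<open>ker A\<close>.\<close>

lemma gen_inverse:
  fixes A :: "('a::cbanach, 'a) cblinfun"
  assumes R: "is_complement (ran A) Rc" and K: "is_complement (ker A) Kc" and y: "y \<in> ran A"
  shows "gen_inverse A Rc Kc y \<in> Kc" "A (gen_inverse A Rc Kc y) = y"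
proof -
  have "proj_onto Rc (ran A) y = 0" using ker_proj_onto[OF R] y by (auto simp: ker_def)
  then have g: "gen_inverse A Rc Kc y = inv_into Kc A y"
    by (simp add: gen_inverse_def cblinfun_apply_simps)
  obtain x where x: "y = A x" using y by (auto simp: ran_def)
  obtain v w where vw: "v \<in> ker A" "w \<in> Kc" "x = v + w" using is_complementD(10)[OF K] by blast
  then have "y \<in> cblinfun_apply A ` Kc" using x by (auto simp: ker_def)
  then show "gen_inverse A Rc Kc y \<in> Kc" "A (gen_inverse A Rc Kc y) = y"
    unfolding g by (rule inv_into_into, rule f_inv_into_f)
qed

section \<open>Laurent series of resolvents\<close>

lemma has_laurent_series_bounded_linear:
  assumes "bounded_linear h" "\<And>c x. h (c *\<^sub>C x) = c *\<^sub>C h x" "has_laurent_series F a C"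
  shows "has_laurent_series (\<lambda>z. h (F z)) a (\<lambda>j. h (C j))"
proof -
  obtain r where r: "r > 0" "\<And>z. z \<in> ball a r - {a} \<Longrightarrow> ((\<lambda>j. ((z - a) powi j) *\<^sub>C C j) has_sum F z) UNIV"
    using assms(3) by (auto simp: has_laurent_series_def)
  show ?thesis unfolding has_laurent_series_def
  proof (intro exI[of _ r] conjI ballI r(1))
    fix z assume "z \<in> ball a r - {a}"
    from has_sum_bounded_linear[OF assms(1) r(2)[OF this]]
    show "((\<lambda>j. ((z - a) powi j) *\<^sub>C h (C j)) has_sum h (F z)) UNIV" by (simp add: assms(2))
  qed
qed

lemma has_laurent_series_shift:
  assumes "has_laurent_series F a C"
  shows "has_laurent_series (\<lambda>z. (z - a) *\<^sub>C F z) a (\<lambda>j. C (j - 1))"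
proof -
  obtain r where r: "r > 0" "\<And>z. z \<in> ball a r - {a} \<Longrightarrow> ((\<lambda>j. ((z - a) powi j) *\<^sub>C C j) has_sum F z) UNIV"
    using assms by (auto simp: has_laurent_series_def)
  show ?thesis unfolding has_laurent_series_def
  proof (intro exI[of _ r] conjI ballI r(1))
    fix z assume z: "z \<in> ball a r - {a}"
    have bij: "bij_betw (\<lambda>j. j - 1) UNIV (UNIV :: int set)"
      by (rule bij_betwI[where g = "\<lambda>j. j + 1"]) auto
    have "((\<lambda>j. (z - a) *\<^sub>C ((z - a) powi j) *\<^sub>C C j) has_sum (z - a) *\<^sub>C F z) UNIV"
      by (rule has_sum_bounded_linear[OF bounded_linear_scaleC_right r(2)[OF z]])
    then have "((\<lambda>j. (z - a) *\<^sub>C ((z - a) powi (j - 1)) *\<^sub>C C (j - 1)) has_sum (z - a) *\<^sub>C F z) UNIV"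
      by (subst has_sum_reindex_bij_betw[OF bij, of "\<lambda>j. (z - a) *\<^sub>C ((z - a) powi j) *\<^sub>C C j"])
    moreover have "(z - a) * (z - a) powi (j - 1) = (z - a) powi j" for j
      using z power_int_add_1'[of "z - a" "j - 1"] by simp
    ultimately show "((\<lambda>j. ((z - a) powi j) *\<^sub>C C (j - 1)) has_sum (z - a) *\<^sub>C F z) UNIV"
      by (simp add: scaleC_scaleC)
  qed
qed

lemma has_laurent_series_diff:
  assumes "has_laurent_series F a C" "has_laurent_series G a D"
  shows "has_laurent_series (\<lambda>z. F z - G z) a (\<lambda>j. C j - D j)"
proof -
  obtain r where r: "r > 0" "\<And>z. z \<in> ball a r - {a} \<Longrightarrow> ((\<lambda>j. ((z - a) powi j) *\<^sub>C C j) has_sum F z) UNIV"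
    using assms(1) by (auto simp: has_laurent_series_def)
  obtain s where s: "s > 0" "\<And>z. z \<in> ball a s - {a} \<Longrightarrow> ((\<lambda>j. ((z - a) powi j) *\<^sub>C D j) has_sum G z) UNIV"
    using assms(2) by (auto simp: has_laurent_series_def)
  show ?thesis unfolding has_laurent_series_def
  proof (intro exI[of _ "min r s"] conjI ballI)
    fix z assume "z \<in> ball a (min r s) - {a}"
    then have "z \<in> ball a r - {a}" "z \<in> ball a s - {a}" by auto
    from has_sum_add[OF r(2)[OF this(1)]
        has_sum_bounded_linear[OF bounded_linear_minus[OF bounded_linear_ident] s(2)[OF this(2)]]]
    show "((\<lambda>j. ((z - a) powi j) *\<^sub>C (C j - D j)) has_sum F z - G z) UNIV"
      by (simp add: complex_vector.scale_right_diff_distrib)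
  qed (use r s in auto)
qed

lemma has_laurent_series_cong:
  assumes "has_laurent_series F a C" "s > 0" "\<And>z. z \<in> ball a s - {a} \<Longrightarrow> F z = G z"
  shows "has_laurent_series G a C"
proof -
  obtain r where r: "r > 0" "\<And>z. z \<in> ball a r - {a} \<Longrightarrow> ((\<lambda>j. ((z - a) powi j) *\<^sub>C C j) has_sum F z) UNIV"
    using assms(1) by (auto simp: has_laurent_series_def)
  show ?thesis unfolding has_laurent_series_def
    by (rule exI[of _ "min r s"]) (use r assms(2) in \<open>auto simp flip: assms(3)\<close>)
qed

text \<open>The regular part converges absolutely, hence unordered, over the nonnegative indices;
  once the two polar indices are joined, only zero coefficients are left.\<close>

lemma has_laurent_seriesI:
  fixes D :: "nat \<Rightarrow> 'a::cbanach"
  assumes r: "r > 0"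
    and sm: "\<And>z. z \<in> ball a r - {a} \<Longrightarrow> summable (\<lambda>j. norm (D j) * cmod (z - a) ^ j)"
    and F: "\<And>z. z \<in> ball a r - {a} \<Longrightarrow>
      (\<lambda>j. (z - a) ^ j *\<^sub>C D j) sums (F z - ((z - a) powi - 1) *\<^sub>C X - ((z - a) powi - 2) *\<^sub>C Y)"
  shows "has_laurent_series F a
    (\<lambda>j. if j = - 1 then X else if j = - 2 then Y else if j < 0 then 0 else D (nat j))" (is "has_laurent_series F a ?C")
  unfolding has_laurent_series_def
proof (intro exI[of _ r] conjI ballI r)
  fix z assume z: "z \<in> ball a r - {a}"
  let ?f = "\<lambda>j. ((z - a) powi j) *\<^sub>C ?C j"
  have "summable (\<lambda>j. norm ((z - a) ^ j *\<^sub>C D j))"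
    using sm[OF z] by (simp add: norm_scaleC norm_power mult.commute)
  from norm_summable_imp_has_sum[OF this F[OF z]]
  have "((\<lambda>j. ?f (int j)) has_sum (F z - ((z - a) powi - 1) *\<^sub>C X - ((z - a) powi - 2) *\<^sub>C Y)) UNIV"
    by simp
  then have nonneg: "(?f has_sum (F z - ((z - a) powi - 1) *\<^sub>C X - ((z - a) powi - 2) *\<^sub>C Y)) (range int)"
    by (subst has_sum_reindex) (simp_all add: o_def)
  have neg: "(?f has_sum (((z - a) powi - 1) *\<^sub>C X + ((z - a) powi - 2) *\<^sub>C Y)) {- 1, - 2}"
    by (rule has_sum_finiteI) auto
  have "(?f has_sum (((z - a) powi - 1) *\<^sub>C X + ((z - a) powi - 2) *\<^sub>C Y +
      (F z - ((z - a) powi - 1) *\<^sub>C X - ((z - a) powi - 2) *\<^sub>C Y))) ({- 1, - 2} \<union> range int)"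
    by (rule has_sum_Un_disjoint[OF neg nonneg]) auto
  then have "(?f has_sum F z) ({- 1, - 2} \<union> range int)" by simp
  moreover have "j \<in> range int" if "j \<ge> 0" for j :: int
    using that by (intro image_eqI[of _ _ "nat j"]) auto
  ultimately show "(?f has_sum F z) UNIV"
    by (intro iffD2[OF has_sum_cong_neutral[where S = UNIV and T = "{- 1, - 2} \<union> range int" and f = ?f and g = ?f]])
      (auto simp: not_less)
qed

lemma has_laurent_series_const:
  "has_laurent_series (\<lambda>_. x :: 'a::cbanach) a (\<lambda>j. if j = 0 then x else 0)"
proof -
  define D where "D j = (if j = 0 then x else 0)" for j :: nat
  have D: "power_series_on (\<lambda>_. x) 1 D" using power_series_on_const[of x] by (simp add: D_def[abs_def])
  have "has_laurent_series (\<lambda>_. x) a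
    (\<lambda>j. if j = - 1 then 0 else if j = - 2 then 0 else if j < 0 then 0 else D (nat j))"
  proof (rule has_laurent_seriesI[of 1])
    fix z assume "z \<in> ball a 1 - {a}"
    then have "z - a \<in> ball 0 1" by (simp add: dist_norm norm_minus_commute)
    then show "summable (\<lambda>j. norm (D j) * cmod (z - a) ^ j)"
      "(\<lambda>j. (z - a) ^ j *\<^sub>C D j) sums (x - ((z - a) powi - 1) *\<^sub>C 0 - ((z - a) powi - 2) *\<^sub>C 0)"
      using D unfolding power_series_on_def by auto
  qed simp
  also have "(\<lambda>j. if j = - 1 then 0 else if j = - 2 then 0 else if j < 0 then 0 else D (nat j)) =
      (\<lambda>j. if j = 0 then x else 0)" by (auto simp: D_def fun_eq_iff)
  finally show ?thesis .
qed

text \<open>\<open>I - z S\<close> factors as \<open>(I - (z - a) S Q) (I - a S)\<close>, and the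
  first factor is inverted by a Neumann series in \<open>z - a\<close>.\<close>

lemma resolvent_taylor:
  fixes S :: "('a::cbanach, 'a) cblinfun"
  assumes Q: "is_inverse (id_cblinfun - a *\<^sub>C S) Q" and w: "cmod (z - a) * norm (S o\<^sub>C Q) < 1"
  shows "summable (\<lambda>j. norm (Q o\<^sub>C cblinfun_power (S o\<^sub>C Q) j) * cmod (z - a) ^ j)"
    and "(\<lambda>j. (z - a) ^ j *\<^sub>C (Q o\<^sub>C cblinfun_power (S o\<^sub>C Q) j)) sums op_inverse (id_cblinfun - z *\<^sub>C S)"
proof -
  define B where "B = S o\<^sub>C Q"
  have "summable (\<lambda>j. (cmod (z - a) * norm B) ^ j)" using w by (intro summable_geometric) (simp add: B_def)
  then have sm: "summable (\<lambda>j. norm (cblinfun_power B j) * cmod (z - a) ^ j)"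
    by (rule summable_comparison_test')
      (use norm_cblinfun_power[of B] in \<open>simp add: power_mult_distrib mult.commute mult_right_mono\<close>)
  show "summable (\<lambda>j. norm (Q o\<^sub>C cblinfun_power (S o\<^sub>C Q) j) * cmod (z - a) ^ j)"
  proof (rule summable_comparison_test'[OF summable_mult[OF sm, of "norm Q"]])
    fix j show "norm (norm (Q o\<^sub>C cblinfun_power (S o\<^sub>C Q) j) * cmod (z - a) ^ j) \<le>
        norm Q * (norm (cblinfun_power B j) * cmod (z - a) ^ j)"
      unfolding B_def using norm_cblinfun_compose[of Q "cblinfun_power (S o\<^sub>C Q) j"]
      by (simp add: mult.assoc[symmetric] mult_right_mono)
  qed
  have "summable (\<lambda>j. norm (cblinfun_power ((z - a) *\<^sub>C B) j))"
    using sm by (simp add: cblinfun_power_scaleC norm_scaleC norm_power mult.commute)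
  then obtain U where U: "cblinfun_power ((z - a) *\<^sub>C B) sums U" "is_inverse (id_cblinfun - (z - a) *\<^sub>C B) U"
    by (rule neumann_series)
  have Q': "(id_cblinfun - a *\<^sub>C S) o\<^sub>C Q = id_cblinfun" "Q o\<^sub>C (id_cblinfun - a *\<^sub>C S) = id_cblinfun"
    using Q by (auto simp: is_inverse_def)
  have BQ: "B o\<^sub>C (id_cblinfun - a *\<^sub>C S) = S" by (simp add: B_def cblinfun_compose_assoc Q')
  have "id_cblinfun - z *\<^sub>C S = (id_cblinfun - a *\<^sub>C S) - (z - a) *\<^sub>C (B o\<^sub>C (id_cblinfun - a *\<^sub>C S))"
    unfolding BQ by (simp add: complex_vector.scale_left_diff_distrib)
  also have "\<dots> = (id_cblinfun - (z - a) *\<^sub>C B) o\<^sub>C (id_cblinfun - a *\<^sub>C S)"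
    by (simp add: cblinfun_compose_distribs complex_vector.scale_right_diff_distrib scaleC_scaleC
        mult.commute algebra_simps)
  finally have fact: "id_cblinfun - z *\<^sub>C S = (id_cblinfun - (z - a) *\<^sub>C B) o\<^sub>C (id_cblinfun - a *\<^sub>C S)" .
  have "is_inverse (id_cblinfun - z *\<^sub>C S) (Q o\<^sub>C U)"
    unfolding is_inverse_def fact
  proof
    have "((id_cblinfun - (z - a) *\<^sub>C B) o\<^sub>C (id_cblinfun - a *\<^sub>C S)) o\<^sub>C (Q o\<^sub>C U) =
        (id_cblinfun - (z - a) *\<^sub>C B) o\<^sub>C (((id_cblinfun - a *\<^sub>C S) o\<^sub>C Q) o\<^sub>C U)"
      by (simp only: cblinfun_compose_assoc)
    then show "((id_cblinfun - (z - a) *\<^sub>C B) o\<^sub>C (id_cblinfun - a *\<^sub>C S)) o\<^sub>C (Q o\<^sub>C U) = id_cblinfun"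
      using U(2) Q' by (simp add: is_inverse_def)
    have "(Q o\<^sub>C U) o\<^sub>C ((id_cblinfun - (z - a) *\<^sub>C B) o\<^sub>C (id_cblinfun - a *\<^sub>C S)) =
        Q o\<^sub>C ((U o\<^sub>C (id_cblinfun - (z - a) *\<^sub>C B)) o\<^sub>C (id_cblinfun - a *\<^sub>C S))"
      by (simp only: cblinfun_compose_assoc)
    then show "(Q o\<^sub>C U) o\<^sub>C ((id_cblinfun - (z - a) *\<^sub>C B) o\<^sub>C (id_cblinfun - a *\<^sub>C S)) = id_cblinfun"
      using U(2) Q' by (simp add: is_inverse_def)
  qed
  then have "op_inverse (id_cblinfun - z *\<^sub>C S) = Q o\<^sub>C U" by (rule op_inverse_eq)
  moreover have "(\<lambda>j. Q o\<^sub>C cblinfun_power ((z - a) *\<^sub>C B) j) sums (Q o\<^sub>C U)"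
    by (rule bounded_linear.sums[OF bounded_linear_compose_right U(1)])
  ultimately show "(\<lambda>j. (z - a) ^ j *\<^sub>C (Q o\<^sub>C cblinfun_power (S o\<^sub>C Q) j)) sums op_inverse (id_cblinfun - z *\<^sub>C S)"
    by (simp add: B_def cblinfun_power_scaleC)
qed

section \<open>Poles of order two and the I(2) condition\<close>

text \<open>For \<open>x\<close> in \<open>Kc\<close>, the generalized inverse of \<open>A x\<close>
  differs from \<open>x\<close> by an element of \<open>Kc \<inter> ker A\<close>, hence equals it.
  The image is thus a complement of \<open>ker A\<close> within \<open>ker A^2\<close>.\<close>

lemma gen_inverse_image:
  fixes A :: "('a::cbanach, 'a) cblinfun"
  assumes R: "is_complement (ran A) Rc" and K: "is_complement (ker A) Kc"
  shows "gen_inverse A Rc Kc ` (ran A \<inter> ker A) = {x \<in> Kc. A (A x) = 0}"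
proof safe
  fix x assume "x \<in> ran A" "x \<in> ker A"
  then show "gen_inverse A Rc Kc x \<in> Kc" "A (A (gen_inverse A Rc Kc x)) = 0"
    using gen_inverse[OF R K] by (auto simp: ker_def)
next
  fix x assume x: "x \<in> Kc" "A (A x) = 0"
  have "A x \<in> ran A" by (simp add: ran_def)
  note g = gen_inverse[OF R K this]
  have "gen_inverse A Rc Kc (A x) - x \<in> ker A" by (simp add: ker_def g)
  moreover have "gen_inverse A Rc Kc (A x) - x \<in> Kc" by (rule is_complementD(6)[OF K g(1) x(1)])
  ultimately have "gen_inverse A Rc Kc (A x) - x = 0" using is_complementD(9)[OF K] by blast
  then have "x = gen_inverse A Rc Kc (A x)" by simp
  then show "x \<in> gen_inverse A Rc Kc ` (ran A \<inter> ker A)"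
    by (rule image_eqI) (use x in \<open>simp add: ran_def ker_def\<close>)
qed

text \<open>Comparing coefficients in \<open>A(z) A(z)\<^sup>-\<^sup>1 = I = A(z)\<^sup>-\<^sup>1 A(z)\<close>, where
  \<open>A(z) = (I - T) - (z - 1) T\<close>.\<close>

lemma laurent_coeff_recurrence:
  fixes T :: "('a::cbanach, 'a) cblinfun"
  assumes C: "has_laurent_series (\<lambda>z. op_inverse (id_cblinfun - z *\<^sub>C T)) 1 C"
    and \<delta>: "\<delta> > 0" and inv: "\<forall>z\<in>ball 1 \<delta> - {1}. op_invertible (id_cblinfun - z *\<^sub>C T)"
  shows "((id_cblinfun - T) o\<^sub>C C j) - (T o\<^sub>C C (j - 1)) = (if j = 0 then id_cblinfun else 0)"
    and "(C j o\<^sub>C (id_cblinfun - T)) - (C (j - 1) o\<^sub>C T) = (if j = 0 then id_cblinfun else 0)"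
proof -
  let ?F = "\<lambda>z. op_inverse (id_cblinfun - z *\<^sub>C T)"
  have split: "id_cblinfun - z *\<^sub>C T = (id_cblinfun - T) - (z - 1) *\<^sub>C T" for z
    by (simp add: complex_vector.scale_left_diff_distrib)
  have left: "has_laurent_series (\<lambda>z. U o\<^sub>C ?F z) 1 (\<lambda>j. U o\<^sub>C C j)"
    and right: "has_laurent_series (\<lambda>z. ?F z o\<^sub>C U) 1 (\<lambda>j. C j o\<^sub>C U)" for U
    by (rule has_laurent_series_bounded_linear[OF bounded_linear_compose_right _ C], simp,
        rule has_laurent_series_bounded_linear[OF bounded_linear_compose_left _ C], simp)
  have "has_laurent_series (\<lambda>_. id_cblinfun) 1 (\<lambda>j. ((id_cblinfun - T) o\<^sub>C C j) - (T o\<^sub>C C (j - 1)))"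
  proof (rule has_laurent_series_cong[OF has_laurent_series_diff[OF left has_laurent_series_shift[OF left]] \<delta>])
    fix z :: complex assume "z \<in> ball 1 \<delta> - {1}"
    from op_invertible_inverse[OF bspec[OF inv this]]
    have "(id_cblinfun - z *\<^sub>C T) o\<^sub>C ?F z = id_cblinfun" by (simp add: is_inverse_def)
    moreover have "(id_cblinfun - z *\<^sub>C T) o\<^sub>C ?F z = (((id_cblinfun - T) - (z - 1) *\<^sub>C T) o\<^sub>C ?F z)"
      by (subst split) (rule refl)
    ultimately show "((id_cblinfun - T) o\<^sub>C ?F z) - (z - 1) *\<^sub>C (T o\<^sub>C ?F z) = id_cblinfun"
      by (simp only: cblinfun_compose_distribs cblinfun_compose_scaleC)
  qed
  from has_laurent_series_unique[OF this has_laurent_series_const]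
  show "((id_cblinfun - T) o\<^sub>C C j) - (T o\<^sub>C C (j - 1)) = (if j = 0 then id_cblinfun else 0)"
    by (rule fun_cong)
  have "has_laurent_series (\<lambda>_. id_cblinfun) 1 (\<lambda>j. (C j o\<^sub>C (id_cblinfun - T)) - (C (j - 1) o\<^sub>C T))"
  proof (rule has_laurent_series_cong[OF has_laurent_series_diff[OF right has_laurent_series_shift[OF right]] \<delta>])
    fix z :: complex assume "z \<in> ball 1 \<delta> - {1}"
    from op_invertible_inverse[OF bspec[OF inv this]]
    have "?F z o\<^sub>C (id_cblinfun - z *\<^sub>C T) = id_cblinfun" by (simp add: is_inverse_def)
    moreover have "?F z o\<^sub>C (id_cblinfun - z *\<^sub>C T) = (?F z o\<^sub>C ((id_cblinfun - T) - (z - 1) *\<^sub>C T))"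
      by (simp only: split[of z, symmetric])
    ultimately show "(?F z o\<^sub>C (id_cblinfun - T)) - (z - 1) *\<^sub>C (?F z o\<^sub>C T) = id_cblinfun"
      by (simp only: cblinfun_compose_distribs cblinfun_compose_scaleC)
  qed
  from has_laurent_series_unique[OF this has_laurent_series_const]
  show "(C j o\<^sub>C (id_cblinfun - T)) - (C (j - 1) o\<^sub>C T) = (if j = 0 then id_cblinfun else 0)"
    by (rule fun_cong)
qed

text \<open>The recurrences at indices -2, -1 and 0 with \<open>T = I - A\<close>; the vanishing of
  \<open>C (- 3)\<close> starts the chain.\<close>

lemma double_pole_coeffs:
  fixes T :: "('a::cbanach, 'a) cblinfun"
  defines "A \<equiv> id_cblinfun - T"
  assumes C: "has_laurent_series (\<lambda>z. op_inverse (id_cblinfun - z *\<^sub>C T)) 1 C" "\<forall>j< - 2. C j = 0"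
    and \<delta>: "\<delta> > 0" and inv: "\<forall>z\<in>ball 1 \<delta> - {1}. op_invertible (id_cblinfun - z *\<^sub>C T)"
  shows "A (C (- 2) x) = 0" "C (- 2) (A x) = 0" "A (C (- 1) x) = C (- 2) x" "C (- 1) (A x) = C (- 2) x"
    "x = A (C 0 x) - C (- 1) x + C (- 2) x" "x = C 0 (A x) - C (- 1) x + C (- 2) x"
proof -
  note L = laurent_coeff_recurrence(1)[OF C(1) \<delta> inv, folded A_def]
    and R = laurent_coeff_recurrence(2)[OF C(1) \<delta> inv, folded A_def]
  have T: "T x = x - A x" for x by (simp add: A_def cblinfun_apply_simps)
  have Lx: "A (C j x) - T (C (j - 1) x) = (if j = 0 then x else 0)" for j x
    using arg_cong[OF L[of j], of "\<lambda>f. cblinfun_apply f x"] by (simp add: cblinfun_apply_simps split: if_splits)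
  have Rx: "C j (A x) - C (j - 1) (T x) = (if j = 0 then x else 0)" for j x
    using arg_cong[OF R[of j], of "\<lambda>f. cblinfun_apply f x"] by (simp add: cblinfun_apply_simps split: if_splits)
  show 1: "A (C (- 2) x) = 0" "C (- 2) (A x) = 0" for x
    using Lx[of "- 2" x] Rx[of "- 2" x] by (simp_all add: C(2) cblinfun_apply_simps)
  show 2: "A (C (- 1) x) = C (- 2) x" "C (- 1) (A x) = C (- 2) x" for x
    using Lx[of "- 1" x] Rx[of "- 1" x] by (simp_all add: T 1)
  show "x = A (C 0 x) - C (- 1) x + C (- 2) x" "x = C 0 (A x) - C (- 1) x + C (- 2) x"
    using Lx[of 0 x] Rx[of 0 x] by (simp_all add: T 2 algebra_simps)
qed

text \<open>Each \<open>C (- 2) x\<close> equals \<open>A (C (- 1) x)\<close> and is killed by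
  \<open>A\<close>. Conversely, for \<open>k = A x\<close> with \<open>A k = 0\<close> the relation
  at index 0 collapses to \<open>k = - C (- 2) x\<close>.\<close>

lemma ran_double_pole_coeff:
  fixes T :: "('a::cbanach, 'a) cblinfun"
  assumes C: "has_laurent_series (\<lambda>z. op_inverse (id_cblinfun - z *\<^sub>C T)) 1 C" "\<forall>j< - 2. C j = 0"
    and \<delta>: "\<delta> > 0" and inv: "\<forall>z\<in>ball 1 \<delta> - {1}. op_invertible (id_cblinfun - z *\<^sub>C T)"
  shows "ran (C (- 2)) = ran (id_cblinfun - T) \<inter> ker (id_cblinfun - T)"
proof -
  define A where "A = id_cblinfun - T"
  note c = double_pole_coeffs[OF C \<delta> inv, folded A_def]
  have "C (- 2) x \<in> ran A \<inter> ker A" for x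
  proof
    show "C (- 2) x \<in> ran A" unfolding ran_def by (rule range_eqI, rule c(3)[symmetric])
    show "C (- 2) x \<in> ker A" using c(1)[of x] by (simp add: ker_def)
  qed
  moreover have "k \<in> ran (C (- 2))" if k: "k \<in> ran A" "k \<in> ker A" for k
  proof -
    obtain x where x: "k = A x" using k by (auto simp: ran_def)
    have "A k = 0" using k by (simp add: ker_def)
    then have "k = - C (- 2) x" using c(6)[of k] by (simp add: x c(2,4))
    then have "k = C (- 2) (- x)" by simp
    then show ?thesis unfolding ran_def by (rule range_eqI)
  qed
  ultimately show "ran (C (- 2)) = ran (id_cblinfun - T) \<inter> ker (id_cblinfun - T)"
    unfolding A_def[symmetric] by (auto simp: ran_def)
qed

lemma I2_condition_if_double_pole:
  fixes T :: "('a::cbanach, 'a) cblinfun"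
  assumes C: "has_laurent_series (\<lambda>z. op_inverse (id_cblinfun - z *\<^sub>C T)) 1 C" "\<forall>j< - 2. C j = 0"
    and C2: "C (- 2) \<noteq> 0"
    and \<delta>: "\<delta> > 0" and inv: "\<forall>z\<in>ball 1 \<delta> - {1}. op_invertible (id_cblinfun - z *\<^sub>C T)"
    and Rc: "is_complement (ran (id_cblinfun - T)) Rc" and Kc: "is_complement (ker (id_cblinfun - T)) Kc"
  shows "I2_condition (id_cblinfun - T)"
proof -
  define A where "A = id_cblinfun - T"
  note c = double_pole_coeffs[OF C \<delta> inv, folded A_def]
  note Rc = Rc[folded A_def] and Kc = Kc[folded A_def]
  define gK where "gK = gen_inverse A Rc Kc ` (ran A \<inter> ker A)"
  have gK: "gK = {x \<in> Kc. A (A x) = 0}" unfolding gK_def by (rule gen_inverse_image[OF Rc Kc])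
  have cK: "closed Kc" using Kc by (simp add: is_direct_sum_def)
  \<comment> \<open>Describing the sum as a kernel is also what shows that it is closed.\<close>
  have sums: "sum_set (ran A) (ker A) = ker (C (- 2))"
  proof safe
    fix x assume "x \<in> sum_set (ran A) (ker A)"
    then obtain y n where "x = A y + n" "A n = 0" by (auto simp: sum_set_def ran_def ker_def)
    then show "x \<in> ker (C (- 2))" using c(4)[of n] c(2)[of y] by (simp add: ker_def)
  next
    fix x assume "x \<in> ker (C (- 2))"
    then have "C (- 2) x = 0" by (simp add: ker_def)
    then have "x = A (C 0 x) + - C (- 1) x" "A (- C (- 1) x) = 0" using c(5)[of x] c(3)[of x] by simp_all
    then show "x \<in> sum_set (ran A) (ker A)" unfolding sum_set_def ran_def ker_def by blast
  qed
  have AA: "A x = - C (- 2) x" if "A (A x) = 0" for x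
    using c(6)[of "A x"] that by (simp add: c(2,4))
  have "ran A \<inter> ker A \<noteq> {0}"
  proof
    assume "ran A \<inter> ker A = {0}"
    then have "ran (C (- 2)) = {0}" using ran_double_pole_coeff[OF C \<delta> inv] by (simp add: A_def)
    then have "C (- 2) = 0" by (intro cblinfun_eqI) (auto simp: ran_def zero_cblinfun.rep_eq)
    with C2 show False ..
  qed
  moreover have "is_direct_sum UNIV (sum_set (ran A) (ker A)) gK"
    unfolding is_direct_sum_def
  proof (intro conjI)
    show "csubspace (sum_set (ran A) (ker A))" unfolding sums
      by (rule complex_vector.subspaceI) (auto simp: ker_def)
    show "closed (sum_set (ran A) (ker A))" unfolding sums unfolding ker_def
      by (intro closed_Collect_eq continuous_intros)
    show "csubspace gK" unfolding gK
      by (rule complex_vector.subspaceI) (use is_complementD[OF Kc] in auto)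
    have "closed (Kc \<inter> {x. A (A x) = 0})" by (intro closed_Int cK closed_Collect_eq continuous_intros)
    then show "closed gK" unfolding gK by (simp add: Collect_conj_eq)
    show "sum_set (ran A) (ker A) \<inter> gK = {0}"
    proof safe
      fix x assume "x \<in> sum_set (ran A) (ker A)" "x \<in> gK"
      then have x: "C (- 2) x = 0" "x \<in> Kc" "A (A x) = 0" unfolding sums gK by (auto simp: ker_def)
      then have "x \<in> ker A" using AA[OF x(3)] by (simp add: ker_def)
      then show "x = 0" using is_complementD(9)[OF Kc _ x(2)] by blast
    next
      show "0 \<in> sum_set (ran A) (ker A)" "0 \<in> gK" unfolding sums gK using is_complementD(2)[OF Kc] by (auto simp: ker_def)
    qed
    show "UNIV = sum_set (sum_set (ran A) (ker A)) gK"
    proof safe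
      fix x
      have "C (- 2) (- x) \<in> ran A \<inter> ker A"
        using ran_double_pole_coeff[OF C \<delta> inv] unfolding A_def ran_def by blast
      then have k: "C (- 2) (- x) \<in> ran A" "C (- 2) (- x) \<in> ker A" by auto
      \<comment> \<open>The sign compensates \<open>A = - C (- 2)\<close> on \<open>ker A^2\<close>:
        it makes \<open>C (- 2) g = C (- 2) x\<close>, so that \<open>x - g\<close> lies in the
        kernel.\<close>
      define g where "g = gen_inverse A Rc Kc (C (- 2) (- x))"
      have Ag: "A g = C (- 2) (- x)" unfolding g_def by (rule gen_inverse[OF Rc Kc k(1)])
      have "g \<in> gK" unfolding gK_def g_def using k by blast
      moreover have "A (A g) = 0" using k(2) by (simp add: Ag ker_def)
      then have "C (- 2) (x - g) = 0" using AA[of g] Ag by simp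
      then have "x - g \<in> sum_set (ran A) (ker A)" unfolding sums by (simp add: ker_def)
      moreover have "x = (x - g) + g" by simp
      ultimately show "x \<in> sum_set (sum_set (ran A) (ker A)) gK" unfolding sum_set_def[of _ gK] by blast
    qed simp
  qed
  ultimately show ?thesis unfolding I2_condition_def A_def[symmetric] using Rc Kc unfolding gK_def by blast
qed

text \<open>Applying \<open>A^2\<close> to the decomposition of \<open>x\<close> leaves only
  \<open>A^3 y\<close>. If \<open>A^3 x = 0\<close>, the \<open>Kc\<close>-part of
  \<open>A x\<close> lies in both summands of the direct sum and is therefore zero.\<close>

lemma I2_condition_ker:
  fixes A :: "('a::cbanach, 'a) cblinfun"
  assumes I2: "I2_condition A"
  shows "A (A (A x)) = 0 \<Longrightarrow> A (A x) = 0" and "\<exists>y. A (A x) = A (A (A y))"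
proof -
  obtain Rc Kc where Rc: "is_complement (ran A) Rc" and Kc: "is_complement (ker A) Kc"
    and ds: "is_direct_sum UNIV (sum_set (ran A) (ker A)) (gen_inverse A Rc Kc ` (ran A \<inter> ker A))"
    using I2 by (auto simp: I2_condition_def)
  define gK where "gK = gen_inverse A Rc Kc ` (ran A \<inter> ker A)"
  have gK: "gK = {x \<in> Kc. A (A x) = 0}" unfolding gK_def by (rule gen_inverse_image[OF Rc Kc])
  note ds = ds[folded gK_def]
  have decomp: "\<exists>y n g. x = A y + n + g \<and> A n = 0 \<and> g \<in> Kc \<and> A (A g) = 0" for x
  proof -
    obtain v g where v: "v \<in> sum_set (ran A) (ker A)" and g: "g \<in> gK" "x = v + g"
      using is_complementD(10)[OF ds] by blast
    obtain y n where "v = A y + n" "A n = 0" using v by (auto simp: sum_set_def ran_def ker_def)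
    then show ?thesis using g by (auto simp: gK)
  qed
  show "\<exists>y. A (A x) = A (A (A y))" using decomp[of x] by auto
  assume 0: "A (A (A x)) = 0"
  obtain v g where vg: "v \<in> ker A" "g \<in> Kc" "A x = v + g" using is_complementD(10)[OF Kc] by blast
  have "A (A g) = 0" using 0 vg by (simp add: ker_def)
  then have "g \<in> gK" using vg by (simp add: gK)
  moreover have "g = A x + (- v)" using vg by simp
  moreover have "- v \<in> ker A" using vg by (simp add: ker_def)
  ultimately have "g \<in> sum_set (ran A) (ker A)" unfolding sum_set_def ran_def by blast
  with \<open>g \<in> gK\<close> have "g = 0" using is_complementD(9)[OF ds] by blast
  then show "A (A x) = 0" using vg by (simp add: ker_def)
qed

text \<open>That \<open>ran A\<^sup>2\<close> is closed is not known
  in advance; boundedness comes from a bounded choice of \<open>y\<close> in \<open>A\<^sup>2 x = A\<^sup>3 y\<close>, whose graph is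
  closed.\<close>

lemma square_projection:
  fixes A :: "('a::cbanach, 'a) cblinfun"
  assumes ker: "\<And>x. A (A (A x)) = 0 \<Longrightarrow> A (A x) = 0" and ran: "\<And>x. \<exists>y. A (A x) = A (A (A y))"
  obtains E :: "('a, 'a) cblinfun" where "\<And>x. \<exists>u. E x = A (A u)" "\<And>x. A (A (E x)) = A (A x)"
    "\<And>u. E (A (A u)) = A (A u)" "\<And>x. A (A x) = 0 \<Longrightarrow> E x = 0" "\<And>x. E (A x) = A (E x)"
proof -
  define G where "G = {p. A (A (snd p)) = A (A (A (fst p)))}"
  have "subspace G" by (rule subspaceI) (auto simp: G_def scaleR_scaleC)
  moreover have "closed G" unfolding G_def by (intro closed_Collect_eq continuous_intros)
  ultimately obtain c where c: "c > 0" "\<And>x. \<exists>y. (y, x) \<in> G \<and> norm y \<le> c * norm x"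
    by (rule closed_relation_bound) (use ran in \<open>auto simp: G_def\<close>)
  \<comment> \<open>\<open>e\<close> is to be the part of \<open>x\<close> in
    \<open>ran A^2\<close>, with remainder in \<open>ker A^2\<close>.\<close>
  define P where "P e x \<longleftrightarrow> (\<exists>u. e = A (A u) \<and> A (A x) = A (A e))" for e x
  obtain E :: "('a, 'a) cblinfun" where E: "\<And>e x. P e x \<longleftrightarrow> e = E x"
  proof (rule bounded_functional_relation[of P "norm A * norm A * c * c"])
    fix x y x' y' assume "P x y" "P x' y'"
    then obtain u u' where "x = A (A u)" "A (A y) = A (A x)" "x' = A (A u')" "A (A y') = A (A x')"
      by (auto simp: P_def)
    then show "P (x + x') (y + y')" unfolding P_def by (intro exI[of _ "u + u'"]) simp
  next
    fix a :: complex and x y assume "P x y"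
    then obtain u where "x = A (A u)" "A (A y) = A (A x)" by (auto simp: P_def)
    then show "P (a *\<^sub>C x) (a *\<^sub>C y)" unfolding P_def by (intro exI[of _ "a *\<^sub>C u"]) simp
  next
    \<comment> \<open>Here \<open>x = A^2 u\<close> and \<open>A^4 u = 0\<close>, so applying
      \<open>ker\<close> twice gives \<open>A^2 u = 0\<close>.\<close>
    fix x assume "P x 0"
    then show "x = 0" by (auto simp: P_def dest!: sym[of 0] ker)
  next
    fix x
    \<comment> \<open>Two bounded choices give \<open>A^2 x = A^3 y = A^4 u\<close>, so
      \<open>e = A^2 u\<close> works; the constant collects one \<open>c\<close> per choice and one
      \<open>norm A\<close> per factor of \<open>A^2\<close>.\<close>
    obtain y where y: "A (A x) = A (A (A y))" "norm y \<le> c * norm x" using c(2)[of x] by (auto simp: G_def)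
    obtain u where u: "A (A y) = A (A (A u))" "norm u \<le> c * norm y" using c(2)[of y] by (auto simp: G_def)
    have "norm (A (A u)) \<le> norm A * norm (A u)" by (rule norm_cblinfun_apply)
    also have "\<dots> \<le> norm A * (norm A * norm u)" by (intro mult_left_mono norm_cblinfun_apply) simp
    also have "\<dots> \<le> norm A * (norm A * (c * (c * norm x)))"
      using order_trans[OF u(2) mult_left_mono[OF y(2)]] c(1) by (intro mult_left_mono) auto
    finally have "norm (A (A u)) \<le> norm A * norm A * c * c * norm x" by (simp add: mult.assoc)
    moreover have "P (A (A u)) x" unfolding P_def using y(1) u(1) by auto
    ultimately show "\<exists>e. P e x \<and> norm e \<le> norm A * norm A * c * c * norm x" by blast
  qed blast
  have P: "P (E x) x" for x using E by blast
  show thesis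
  proof
    show "\<exists>u. E x = A (A u)" "A (A (E x)) = A (A x)" for x using P[of x] by (auto simp: P_def)
    have "P (A (A u)) (A (A u))" for u by (auto simp: P_def)
    then show "E (A (A u)) = A (A u)" for u using E by metis
    have "P 0 x" if "A (A x) = 0" for x using that by (auto simp: P_def intro: exI[of _ 0])
    then show "A (A x) = 0 \<Longrightarrow> E x = 0" for x using E by metis
    have "P (A (E x)) (A x)" for x
      using P[of x] by (auto simp: P_def)
    then show "E (A x) = A (E x)" for x using E by metis
  qed
qed

text \<open>With \<open>S = T E\<close>, the operator \<open>I - z S\<close> is
  \<open>I - z T\<close> on \<open>ran E\<close> and the identity on \<open>ker E\<close>. At
  \<open>z = 1\<close> the first part is \<open>A\<close> on \<open>ran A^2\<close>, bijective by
  I(2), so the singularity is confined to \<open>ker A^2\<close>. The last conclusion rests on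
  \<open>(I + A) T = I - A^2\<close> and serves to compute \<open>Pt\<close>.\<close>

lemma I2_condition_resolvent:
  fixes T :: "('a::cbanach, 'a) cblinfun"
  defines "A \<equiv> id_cblinfun - T"
  assumes I2: "I2_condition A" and inv: "\<forall>z\<in>ball 0 R - {1}. op_invertible (id_cblinfun - z *\<^sub>C T)"
  obtains E S where
    "\<And>z. z \<in> ball 0 R \<Longrightarrow> op_invertible (id_cblinfun - z *\<^sub>C S)"
    "\<And>z. z \<in> ball 0 R - {1} \<Longrightarrow> op_inverse (id_cblinfun - z *\<^sub>C T) =
       (op_inverse (id_cblinfun - z *\<^sub>C S) o\<^sub>C E) + (1 / (1 - z)) *\<^sub>C ((id_cblinfun + A) o\<^sub>C (id_cblinfun - E))
       - (1 / (1 - z)\<^sup>2) *\<^sub>C (A o\<^sub>C (id_cblinfun - E))"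
    "A o\<^sub>C (id_cblinfun - E) \<noteq> 0"
    "((id_cblinfun + A) o\<^sub>C (id_cblinfun - E)) o\<^sub>C T = id_cblinfun - E"
proof -
  note ker = I2_condition_ker(1)[OF I2]
  obtain E :: "('a, 'a) cblinfun" where E: "\<And>x. \<exists>u. E x = A (A u)" "\<And>x. A (A (E x)) = A (A x)"
    "\<And>u. E (A (A u)) = A (A u)" "\<And>x. A (A x) = 0 \<Longrightarrow> E x = 0" "\<And>x. E (A x) = A (E x)"
    using square_projection[OF ker I2_condition_ker(2)[OF I2]] by blast
  have T: "T x = x - A x" for x by (simp add: A_def cblinfun_apply_simps)
  have EE: "E (E x) = E x" for x using E(1)[of x] E(3) by metis
  have ET: "E (T x) = T (E x)" for x by (simp add: T E(5))
  define S where "S = T o\<^sub>C E"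
  have pS: "(id_cblinfun - z *\<^sub>C S) x = x - z *\<^sub>C T (E x)" for z x by (simp add: S_def cblinfun_apply_simps)
  have pT: "(id_cblinfun - z *\<^sub>C T) x = x - z *\<^sub>C T x" for z x by (simp add: cblinfun_apply_simps)
  have invS: "op_invertible (id_cblinfun - z *\<^sub>C S)" if z: "z \<in> ball 0 R" for z
  proof -
    have inj: "E x = 0" if "E x - z *\<^sub>C T (E x) = 0" for x
    proof (cases "z = 1")
      case True
      then have "A (E x) = 0" using that by (simp add: T)
      then show ?thesis using E(4)[of "E x"] by (simp add: EE)
    next
      case False
      then show ?thesis using that inv z by (auto simp: op_invertible_iff_bij pT)
    qed
    have surj: "\<exists>v. E v = v \<and> v - z *\<^sub>C T v = E y" for y
    proof (cases "z = 1")
      case True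
      obtain u where u: "E y = A (A u)" using E(1) by blast
      obtain v where v: "A (A u) = A (A (A v))" using I2_condition_ker(2)[OF I2] by blast
      then show ?thesis using True by (intro exI[of _ "A (A v)"]) (simp add: T u E(3))
    next
      case False
      then have "op_invertible (id_cblinfun - z *\<^sub>C T)" using inv z by blast
      then have bij: "\<And>x. x - z *\<^sub>C T x = 0 \<Longrightarrow> x = 0" "\<And>y. \<exists>x. x - z *\<^sub>C T x = y"
        by (auto simp: op_invertible_iff_bij pT)
      obtain v where v: "v - z *\<^sub>C T v = E y" using bij(2) by blast
      \<comment> \<open>\<open>E v\<close> solves the same equation as \<open>v\<close>, because
        \<open>E\<close> fixes the right side; injectivity then gives
        \<open>E v = v\<close>.\<close>
      have "E v - z *\<^sub>C T (E v) = E (v - z *\<^sub>C T v)" by (simp add: ET)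
      also have "\<dots> = v - z *\<^sub>C T v" by (simp only: v EE)
      finally have "(E v - v) - z *\<^sub>C T (E v - v) = 0"
        by (simp add: complex_vector.scale_right_diff_distrib algebra_simps)
      from bij(1)[OF this] have "E v = v" by simp
      then show ?thesis using v by blast
    qed
    show ?thesis unfolding op_invertible_iff_bij pS
    proof (intro conjI allI impI)
      fix x assume x: "x - z *\<^sub>C T (E x) = 0"
      then have "E (x - z *\<^sub>C T (E x)) = 0" by simp
      then have "E x = 0" by (intro inj) (simp add: ET EE)
      then show "x = 0" using x by simp
    next
      fix y
      obtain v where v: "E v = v" "v - z *\<^sub>C T v = E y" using surj by blast
      \<comment> \<open>\<open>v\<close> accounts for \<open>E y\<close>, while
        \<open>y - E y\<close> is killed by \<open>E\<close> and passes unchanged through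
        \<open>I - z S\<close>.\<close>
      have "E (v + (y - E y)) = v" by (simp add: v EE)
      then have "(v + (y - E y)) - z *\<^sub>C T (E (v + (y - E y))) = (v - z *\<^sub>C T v) + (y - E y)"
        by (simp add: algebra_simps)
      then show "\<exists>x. x - z *\<^sub>C T (E x) = y" unfolding v(2) by (intro exI[of _ "v + (y - E y)"]) simp
    qed
  qed
  have inverse: "op_inverse (id_cblinfun - z *\<^sub>C T) =
       (op_inverse (id_cblinfun - z *\<^sub>C S) o\<^sub>C E) + (1 / (1 - z)) *\<^sub>C ((id_cblinfun + A) o\<^sub>C (id_cblinfun - E))
       - (1 / (1 - z)\<^sup>2) *\<^sub>C (A o\<^sub>C (id_cblinfun - E))" (is "_ = ?B")
    if z: "z \<in> ball 0 R - {1}" for z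
  proof (rule cblinfun_eqI)
    fix y
    have iS: "op_invertible (id_cblinfun - z *\<^sub>C S)" and iT: "op_invertible (id_cblinfun - z *\<^sub>C T)"
      using invS inv z by auto
    define v where "v = op_inverse (id_cblinfun - z *\<^sub>C S) (E y)"
    have v: "v - z *\<^sub>C T (E v) = E y" using op_inverse_apply(1)[OF iS, of "E y"] by (simp only: pS v_def)
    have "E (v - z *\<^sub>C T (E v)) = E v - z *\<^sub>C T (E v)" by (simp add: ET EE)
    then have "E v = v" unfolding v EE using v by (metis diff_add_cancel)
    then have v': "v - z *\<^sub>C T v = E y" using v by simp
    define n a where "n = y - E y" and "a = 1 / (1 - z)"
    have a: "(1 - z) * a = 1" using z by (simp add: a_def)
    have An: "A (A n) = 0" by (simp add: n_def E(2))
    have By: "?B y = v + a *\<^sub>C (n + A n) - (a * a) *\<^sub>C A n"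
      by (simp add: cblinfun_apply_simps v_def n_def a_def power2_eq_square)
    have TT: "T n = n - A n" "T (A n) = A n" by (simp_all add: T An)
    have "?B y - z *\<^sub>C T (?B y) = (v - z *\<^sub>C T v) + ((1 - z) * a) *\<^sub>C n
        + ((1 - z) * a + z * a - (1 - z) * a * a) *\<^sub>C A n"
      unfolding By by (simp add: TT scaleC_add_right complex_vector.scale_right_diff_distrib
        complex_vector.scale_left_diff_distrib scaleC_add_left scaleC_scaleC algebra_simps)
    \<comment> \<open>The first two summands add up to \<open>a\<close>, and
      \<open>(1 - z) a = 1\<close> turns the last product into \<open>a\<close>.\<close>
    also have "(1 - z) * a + z * a - (1 - z) * a * a = 0" unfolding a using a by (simp add: algebra_simps)
    finally have "(id_cblinfun - z *\<^sub>C T) (?B y) = y" by (simp add: pT a v' n_def)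
    then show "op_inverse (id_cblinfun - z *\<^sub>C T) y = ?B y" using op_inverse_apply(2)[OF iT, of "?B y"] by simp
  qed
  \<comment> \<open>A vector \<open>k = A x\<close> of \<open>ker A\<close> has
    \<open>E x = 0\<close>, hence \<open>k = A (x - E x)\<close>. Vanishing of this operator would
    thus make \<open>ran A \<inter> ker A\<close> trivial, against I(2).\<close>
  have "A o\<^sub>C (id_cblinfun - E) \<noteq> 0"
  proof
    assume 0: "A o\<^sub>C (id_cblinfun - E) = 0"
    have A0: "A (x - E x) = 0" for x
      using arg_cong[OF 0, of "\<lambda>f. cblinfun_apply f x"] by (simp add: cblinfun_apply_simps)
    have "k = 0" if "k \<in> ran A" "k \<in> ker A" for k
    proof -
      obtain x where x: "k = A x" using \<open>k \<in> ran A\<close> by (auto simp: ran_def)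
      then have "E x = 0" using that by (intro E(4)) (simp add: ker_def)
      then show ?thesis using A0[of x] x by simp
    qed
    moreover have "0 \<in> ran A" "0 \<in> ker A" unfolding ran_def ker_def by (auto intro: range_eqI[of _ _ 0])
    ultimately show False using I2 unfolding I2_condition_def by blast
  qed
  moreover have "((id_cblinfun + A) o\<^sub>C (id_cblinfun - E)) o\<^sub>C T = id_cblinfun - E"
  proof (rule cblinfun_eqI)
    fix x
    have "A (A (x - E x)) = 0" by (simp add: E(2))
    then show "(((id_cblinfun + A) o\<^sub>C (id_cblinfun - E)) o\<^sub>C T) x = (id_cblinfun - E) x"
      by (simp add: cblinfun_apply_simps T E(5))
  qed
  ultimately show thesis using that invS inverse by blast
qed

text \<open>\<open>H\<close> is expanded twice: at 0, where the Neumann series reaches the whole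
  disk, and at 1, where the Taylor series supplies the Laurent coefficients of nonnegative
  index.\<close>

lemma double_pole_expansion:
  fixes T :: "('a::cbanach, 'a) cblinfun"
  assumes I2: "I2_condition (id_cblinfun - T)" and \<eta>: "\<eta> > 0"
    and inv: "\<forall>z\<in>ball 0 (1 + \<eta>) - {1}. op_invertible (id_cblinfun - z *\<^sub>C T)"
  obtains C H c where
    "has_laurent_series (\<lambda>z. op_inverse (id_cblinfun - z *\<^sub>C T)) 1 C" "C (- 2) \<noteq> 0" "\<forall>j< - 2. C j = 0"
    "power_series_on H (1 + \<eta>) c" "\<forall>\<^sub>F z in nhds 1. (\<lambda>j. (z - 1) ^ j *\<^sub>C C (int j)) sums H z"
    "\<And>z. z \<in> ball 0 (1 + \<eta>) - {1} \<Longrightarrow> (1 - z)\<^sup>2 *\<^sub>C op_inverse (id_cblinfun - z *\<^sub>C T) =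
       C (- 2) - (1 - z) *\<^sub>C (C (- 2) + (C (- 1) o\<^sub>C T)) + (1 - z)\<^sup>2 *\<^sub>C H z"
proof -
  define A where "A = id_cblinfun - T"
  obtain E S where S: "\<And>z. z \<in> ball 0 (1 + \<eta>) \<Longrightarrow> op_invertible (id_cblinfun - z *\<^sub>C S)"
    and inverse: "\<And>z. z \<in> ball 0 (1 + \<eta>) - {1} \<Longrightarrow> op_inverse (id_cblinfun - z *\<^sub>C T) =
       (op_inverse (id_cblinfun - z *\<^sub>C S) o\<^sub>C E) + (1 / (1 - z)) *\<^sub>C ((id_cblinfun + A) o\<^sub>C (id_cblinfun - E))
       - (1 / (1 - z)\<^sup>2) *\<^sub>C (A o\<^sub>C (id_cblinfun - E))"
    and nz: "A o\<^sub>C (id_cblinfun - E) \<noteq> 0"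
    and P: "((id_cblinfun + A) o\<^sub>C (id_cblinfun - E)) o\<^sub>C T = id_cblinfun - E"
    using I2_condition_resolvent[OF I2 inv, folded A_def] by metis
  define Q where "Q = op_inverse (id_cblinfun - 1 *\<^sub>C S)"
  have "op_invertible (id_cblinfun - 1 *\<^sub>C S)" using \<eta> by (intro S) simp
  then have Q: "is_inverse (id_cblinfun - 1 *\<^sub>C S) Q" unfolding Q_def by (rule op_invertible_inverse)
  \<comment> \<open>\<open>Y\<close> inherits its sign from the resolvent formula; \<open>X\<close>
    gets it from \<open>(z - 1)^-1 = - (1 - z)^-1\<close>.\<close>
  define X Y where "X = - ((id_cblinfun + A) o\<^sub>C (id_cblinfun - E))" and "Y = - (A o\<^sub>C (id_cblinfun - E))"
  define D where "D j = (Q o\<^sub>C cblinfun_power (S o\<^sub>C Q) j) o\<^sub>C E" for j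
  define H where "H z = op_inverse (id_cblinfun - z *\<^sub>C S) o\<^sub>C E" for z
  \<comment> \<open>Small enough for the ball around 1 to lie in the disk and for
    \<open>(z - 1) S Q\<close> to have norm below 1; the added 1 avoids division by zero.\<close>
  define r where "r = min \<eta> (1 / (norm (S o\<^sub>C Q) + 1))"
  have r: "r > 0" "r \<le> \<eta>" using \<eta> by (auto simp: r_def add_nonneg_pos)
  have ball: "z \<in> ball 0 (1 + \<eta>)" if "z \<in> ball 1 r" for z :: complex
    using that r norm_triangle_ineq[of 1 "z - 1"] by (simp add: dist_norm norm_minus_commute)
  have small: "cmod (z - 1) * norm (S o\<^sub>C Q) < 1" if "z \<in> ball 1 r" for z
  proof -
    have "cmod (z - 1) < 1 / (norm (S o\<^sub>C Q) + 1)"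
      using that by (simp add: r_def dist_norm norm_minus_commute)
    then have "cmod (z - 1) * (norm (S o\<^sub>C Q) + 1) < 1"
      by (simp add: pos_less_divide_eq add_nonneg_pos)
    moreover have "cmod (z - 1) * norm (S o\<^sub>C Q) \<le> cmod (z - 1) * (norm (S o\<^sub>C Q) + 1)"
      by (intro mult_left_mono) auto
    ultimately show ?thesis by linarith
  qed
  have D: "summable (\<lambda>j. norm (D j) * cmod (z - 1) ^ j)" "(\<lambda>j. (z - 1) ^ j *\<^sub>C D j) sums H z"
    if z: "z \<in> ball 1 r" for z
  proof -
    note t = resolvent_taylor[OF Q small[OF z]]
    show "summable (\<lambda>j. norm (D j) * cmod (z - 1) ^ j)"
    proof (rule summable_comparison_test'[OF summable_mult[OF t(1), of "norm E"]])
      fix j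
      have "norm (D j) \<le> norm E * norm (Q o\<^sub>C cblinfun_power (S o\<^sub>C Q) j)"
        unfolding D_def by (subst mult.commute) (rule norm_cblinfun_compose)
      then show "norm (norm (D j) * cmod (z - 1) ^ j) \<le>
          norm E * (norm (Q o\<^sub>C cblinfun_power (S o\<^sub>C Q) j) * cmod (z - 1) ^ j)"
        by (simp add: mult.assoc[symmetric] mult_right_mono)
    qed
    show "(\<lambda>j. (z - 1) ^ j *\<^sub>C D j) sums H z"
      using bounded_linear.sums[OF bounded_linear_compose_left t(2), of E] by (simp add: D_def H_def)
  qed
  define C where "C j = (if j = - 1 then X else if j = - 2 then Y else if j < 0 then 0 else D (nat j))" for j
  have "has_laurent_series (\<lambda>z. op_inverse (id_cblinfun - z *\<^sub>C T)) 1 C"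
    unfolding C_def[abs_def]
  proof (rule has_laurent_seriesI[OF r(1)])
    fix z :: complex assume z: "z \<in> ball 1 r - {1}"
    then show "summable (\<lambda>j. norm (D j) * cmod (z - 1) ^ j)" using D by blast
    have "(z - 1) powi - 1 = - (1 / (1 - z))"
      by (simp add: power_int_minus divide_simps)
    moreover have "(z - 1) powi - 2 = 1 / (1 - z)\<^sup>2"
      by (simp add: power_int_minus power2_commute divide_inverse)
    ultimately have "op_inverse (id_cblinfun - z *\<^sub>C T) - ((z - 1) powi - 1) *\<^sub>C X - ((z - 1) powi - 2) *\<^sub>C Y = H z"
      using inverse[of z] z ball[of z] by (simp add: X_def Y_def H_def)
    then show "(\<lambda>j. (z - 1) ^ j *\<^sub>C D j) sums (op_inverse (id_cblinfun - z *\<^sub>C T)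
        - ((z - 1) powi - 1) *\<^sub>C X - ((z - 1) powi - 2) *\<^sub>C Y)"
      using D(2) z by simp
  qed
  moreover have "C (- 2) \<noteq> 0" "\<forall>j< - 2. C j = 0" using nz by (auto simp: C_def Y_def)
  moreover have "power_series_on H (1 + \<eta>) (\<lambda>n. cblinfun_power S n o\<^sub>C E)"
    unfolding power_series_on_def
  proof (intro ballI conjI)
    have ps: "power_series_on (\<lambda>z. op_inverse (id_cblinfun - z *\<^sub>C S)) (1 + \<eta>) (cblinfun_power S)"
      by (rule power_series_on_resolvent) (use S in auto)
    fix z :: complex assume "z \<in> ball 0 (1 + \<eta>)"
    with ps have s: "summable (\<lambda>n. norm (cblinfun_power S n) * cmod z ^ n)"
      and t: "(\<lambda>n. z ^ n *\<^sub>C cblinfun_power S n) sums op_inverse (id_cblinfun - z *\<^sub>C S)"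
      unfolding power_series_on_def by blast+
    show "summable (\<lambda>n. norm (cblinfun_power S n o\<^sub>C E) * cmod z ^ n)"
    proof (rule summable_comparison_test'[OF summable_mult[OF s, of "norm E"]])
      fix n
      have "norm (cblinfun_power S n o\<^sub>C E) \<le> norm E * norm (cblinfun_power S n)"
        by (subst mult.commute) (rule norm_cblinfun_compose)
      then show "norm (norm (cblinfun_power S n o\<^sub>C E) * cmod z ^ n) \<le> norm E * (norm (cblinfun_power S n) * cmod z ^ n)"
        by (simp add: mult.assoc[symmetric] mult_right_mono)
    qed
    show "(\<lambda>n. z ^ n *\<^sub>C (cblinfun_power S n o\<^sub>C E)) sums H z"
      using bounded_linear.sums[OF bounded_linear_compose_left t, of E] by (simp add: H_def)
  qed
  moreover have "\<forall>\<^sub>F z in nhds 1. (\<lambda>j. (z - 1) ^ j *\<^sub>C C (int j)) sums H z"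
    using eventually_nhds_in_open[OF open_ball, of 1 1 r] r D(2)
    by (auto simp: C_def elim!: eventually_mono)
  moreover have "(1 - z)\<^sup>2 *\<^sub>C op_inverse (id_cblinfun - z *\<^sub>C T) =
       C (- 2) - (1 - z) *\<^sub>C (C (- 2) + (C (- 1) o\<^sub>C T)) + (1 - z)\<^sup>2 *\<^sub>C H z"
    if z: "z \<in> ball 0 (1 + \<eta>) - {1}" for z
  proof -
    have "C (- 1) o\<^sub>C T = - (id_cblinfun - E)"
      by (simp add: C_def X_def P bounded_bilinear.minus_left[OF bounded_bilinear_cblinfun_compose])
    \<comment> \<open>Adding \<open>C (- 2)\<close> to \<open>- (I - E)\<close> rebuilds the simple
      pole coefficient, which is why the linear term of the theorem combines \<open>N (- 2)\<close>
      with \<open>Pt\<close>.\<close>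
    then have "C (- 2) + (C (- 1) o\<^sub>C T) = - ((id_cblinfun + A) o\<^sub>C (id_cblinfun - E))"
      by (simp add: C_def Y_def cblinfun_compose_distribs algebra_simps)
    moreover have "(1 - z)\<^sup>2 * (1 / (1 - z)) = 1 - z" "(1 - z)\<^sup>2 * (1 / (1 - z)\<^sup>2) = 1"
      using z by (simp_all add: power2_eq_square)
    ultimately show ?thesis unfolding inverse[OF z]
      by (simp add: C_def Y_def H_def scaleC_add_right complex_vector.scale_right_diff_distrib scaleC_scaleC
          del: times_divide_eq_right)
  qed
  ultimately show thesis using that by blast
qed

section \<open>The companion pencil\<close>

lemma continuous_on_component [continuous_intros]:
  assumes "continuous_on S f"
  shows "continuous_on S (\<lambda>x. component (f x) i)"
proof -
  have "bounded_linear (\<lambda>x. component x i)"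
    by (rule bounded_linear_intro[where K = 1])
      (simp_all add: plus_pow.rep_eq scaleR_pow.rep_eq norm_component_le)
  from bounded_linear.continuous_on[OF this assms] show ?thesis .
qed

lemma component_Pow_vec:
  "component (Pow_vec (\<lambda>i. if i \<in> {1..CARD('p)} then f i else 0) :: ('a::complex_normed_vector, 'p::finite) pow) =
    (\<lambda>i. if i \<in> {1..CARD('p)} then f i else 0)"
  by (intro Pow_vec_inverse) auto

lemma pow_eq_iff:
  "x = y \<longleftrightarrow> (\<forall>i\<in>{1..CARD('p)}. component x i = component y i)"
  for x y :: "('a::complex_normed_vector, 'p::finite) pow"
proof
  assume "\<forall>i\<in>{1..CARD('p)}. component x i = component y i"
  moreover have "component x i = component y i" if "i \<notin> {1..CARD('p)}" for i
    using component[of x] component[of y] that by simp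
  ultimately have "component x = component y" by (auto simp: fun_eq_iff)
  then show "x = y" by (simp add: component_inject)
qed simp

lemma component_companion_pencil:
  fixes x :: "('a::complex_normed_vector, 'p::finite) pow"
  assumes "i \<in> {1..CARD('p)}"
  shows "component (companion_pencil \<Phi> z x) i =
    component x i - z *\<^sub>C (if i = 1 then \<Sum>j = 1..CARD('p). \<Phi> j (component x j) else component x (i - 1))"
  using assms
  by (auto simp: companion_pencil_def cblinfun_apply_simps minus_pow.rep_eq scaleC_pow.rep_eq
      companion.rep_eq companion_fun.rep_eq)

text \<open>Solving the last \<open>p - 1\<close> rows of \<open>A(z) x = y\<close> gives \<open>x\<^sub>i = z\<^sup>i\<^sup>-\<^sup>1 x\<^sub>1 + v\<^sub>i\<close>, where
  \<open>v = companion_tail z y\<close>; the first row becomes \<open>\<Phi>(z) x\<^sub>1 = companion_rhs \<Phi> z y\<close>.\<close>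

fun companion_tail :: "complex \<Rightarrow> (nat \<Rightarrow> 'a::complex_normed_vector) \<Rightarrow> nat \<Rightarrow> 'a" where
  "companion_tail z y 0 = 0"
| "companion_tail z y (Suc i) = (if i = 0 then 0 else z *\<^sub>C companion_tail z y i + y (Suc i))"

definition companion_rhs ::
    "(nat \<Rightarrow> ('a::complex_normed_vector, 'a) cblinfun) \<Rightarrow> complex \<Rightarrow> ('a, 'p::finite) pow \<Rightarrow> 'a" where
  "companion_rhs \<Phi> z y =
     component y 1 + z *\<^sub>C (\<Sum>j = 1..CARD('p). \<Phi> j (companion_tail z (component y) j))"

lemma companion_tail_diff: "companion_tail z (\<lambda>i. y i - y' i) i = companion_tail z y i - companion_tail z y' i"
  by (induction i) (auto simp: complex_vector.scale_right_diff_distrib)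

lemma companion_tail_eq_0: "(\<And>i. i > 1 \<Longrightarrow> y i = 0) \<Longrightarrow> companion_tail z y i = 0"
  by (induction i) auto

lemma companion_rhs_diff: "companion_rhs \<Phi> z (y - y') = companion_rhs \<Phi> z y - companion_rhs \<Phi> z y'"
  by (simp add: companion_rhs_def minus_pow.rep_eq companion_tail_diff sum_subtractf
      complex_vector.scale_right_diff_distrib)

lemma companion_rhs_eq: "(\<And>i. i > 1 \<Longrightarrow> component y i = 0) \<Longrightarrow> companion_rhs \<Phi> z y = component y 1"
  by (simp add: companion_rhs_def companion_tail_eq_0)

lemma continuous_on_companion_tail:
  "continuous_on UNIV (\<lambda>y :: ('a::complex_normed_vector, 'p::finite) pow. companion_tail z (component y) i)"
proof (induction i)
  case (Suc i)
  then show ?case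
    by (cases "i = 0")
      (auto intro!: continuous_intros bounded_linear.continuous_on[OF bounded_linear_scaleC_right])
qed (simp add: zero_pow.rep_eq)

lemma continuous_on_companion_rhs: "continuous_on UNIV (companion_rhs \<Phi> z)"
  unfolding companion_rhs_def[abs_def]
  by (intro continuous_intros continuous_on_companion_tail
      bounded_linear.continuous_on[OF bounded_linear_scaleC_right])

lemma companion_pencil_eq_iff:
  fixes x y :: "('a::complex_normed_vector, 'p::finite) pow"
  shows "companion_pencil \<Phi> z x = y \<longleftrightarrow>
    pencil CARD('p) \<Phi> z (component x 1) = companion_rhs \<Phi> z y \<and>
    (\<forall>i\<in>{1..CARD('p)}. component x i = z ^ (i - 1) *\<^sub>C component x 1 + companion_tail z (component y) i)"
    (is "?L \<longleftrightarrow> ?first \<and> ?rest")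
proof -
  let ?p = "CARD('p)"
  have one: "1 \<in> {1..?p}" by (simp add: Suc_le_eq)
  have pow: "z * z ^ (k - 1) = z ^ k" if "k > 0" for k using that by (cases k) auto
  have L: "?L \<longleftrightarrow> component x 1 - z *\<^sub>C (\<Sum>j = 1..?p. \<Phi> j (component x j)) = component y 1 \<and>
      (\<forall>i\<in>{2..?p}. component x i - z *\<^sub>C component x (i - 1) = component y i)" (is "_ \<longleftrightarrow> ?row1 \<and> ?rows")
  proof -
    have "{1..?p} = insert 1 {2..?p}" using one by auto
    then have "?L \<longleftrightarrow> component (companion_pencil \<Phi> z x) 1 = component y 1 \<and>
        (\<forall>i\<in>{2..?p}. component (companion_pencil \<Phi> z x) i = component y i)"
      by (simp add: pow_eq_iff)
    then show ?thesis using one by (simp add: component_companion_pencil)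
  qed
  have rest: "?rows \<longleftrightarrow> ?rest"
  proof
    assume rows: ?rows
    have "i \<in> {1..?p} \<Longrightarrow> component x i = z ^ (i - 1) *\<^sub>C component x 1 + companion_tail z (component y) i" for i
    proof (induction i)
      case (Suc i)
      show ?case
      proof (cases "i = 0")
        case False
        then have "component x (Suc i) = z *\<^sub>C component x i + component y (Suc i)"
          using bspec[OF rows, of "Suc i"] Suc.prems by (simp add: algebra_simps)
        then show ?thesis using False Suc pow[of i] by (simp add: scaleC_add_right scaleC_scaleC)
      qed simp
    qed simp
    then show ?rest by blast
  next
    assume rest: ?rest
    show ?rows
    proof
      fix i assume i: "i \<in> {2..?p}"
      then obtain k where k: "i = Suc k" "k > 0" by (cases i) auto
      then show "component x i - z *\<^sub>C component x (i - 1) = component y i"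
        using bspec[OF rest, of i] bspec[OF rest, of k] i k pow[of k] by (simp add: scaleC_add_right scaleC_scaleC)
    qed
  qed
  \<comment> \<open>The first row becomes an equation in \<open>component x 1\<close> alone after
    the solved rows have been substituted.\<close>
  have "?row1 \<longleftrightarrow> ?first" if rest: ?rest
  proof -
    have "z *\<^sub>C (\<Sum>j = 1..?p. \<Phi> j (component x j)) =
        (\<Sum>j = 1..?p. z *\<^sub>C \<Phi> j (z ^ (j - 1) *\<^sub>C component x 1 + companion_tail z (component y) j))"
      unfolding complex_vector.scale_sum_right
    proof (intro sum.cong refl)
      fix j assume "j \<in> {1..?p}"
      from bspec[OF rest this]
      show "z *\<^sub>C \<Phi> j (component x j) =
          z *\<^sub>C \<Phi> j (z ^ (j - 1) *\<^sub>C component x 1 + companion_tail z (component y) j)"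
        by (rule arg_cong[where f = "\<lambda>v. z *\<^sub>C \<Phi> j v"])
    qed
    also have "\<dots> = (\<Sum>j = 1..?p. z ^ j *\<^sub>C \<Phi> j (component x 1) + z *\<^sub>C \<Phi> j (companion_tail z (component y) j))"
      using pow by (intro sum.cong) (auto simp: scaleC_add_right scaleC_scaleC)
    finally have 1: "z *\<^sub>C (\<Sum>j = 1..?p. \<Phi> j (component x j)) = (\<Sum>j = 1..?p. z ^ j *\<^sub>C \<Phi> j (component x 1)) +
        z *\<^sub>C (\<Sum>j = 1..?p. \<Phi> j (companion_tail z (component y) j))"
      by (simp add: sum.distrib complex_vector.scale_sum_right)
    have "(\<Sum>j = 1..m. z ^ j *\<^sub>C \<Phi> j) u = (\<Sum>j = 1..m. z ^ j *\<^sub>C \<Phi> j u)" for m u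
      by (induction m) (simp_all add: cblinfun_apply_simps)
    then have "pencil ?p \<Phi> z (component x 1) = component x 1 - (\<Sum>j = 1..?p. z ^ j *\<^sub>C \<Phi> j (component x 1))"
      by (simp add: pencil_def cblinfun_apply_simps)
    moreover have "a - (s + t) = b \<longleftrightarrow> a - s = b + t" for a b s t :: 'a
      by (simp only: diff_diff_eq[symmetric] diff_eq_eq[of "a - s"])
    ultimately show ?thesis unfolding 1 companion_rhs_def by simp
  qed
  then show ?thesis unfolding L rest by blast
qed

lemma companion_pencil_solution:
  fixes y :: "('a::complex_normed_vector, 'p::finite) pow"
  assumes "pencil CARD('p) \<Phi> z u = companion_rhs \<Phi> z y"
  shows "\<exists>x. companion_pencil \<Phi> z x = y"
proof -
  define x :: "('a, 'p) pow" where
    "x = Pow_vec (\<lambda>i. if i \<in> {1..CARD('p)} then z ^ (i - 1) *\<^sub>C u + companion_tail z (component y) i else 0)"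
  have x: "component x i = z ^ (i - 1) *\<^sub>C u + companion_tail z (component y) i" if "i \<in> {1..CARD('p)}" for i
    using that unfolding x_def component_Pow_vec by simp
  have "component x 1 = u" using x[of 1] by (simp add: Suc_le_eq)
  then have "companion_pencil \<Phi> z x = y" unfolding companion_pencil_eq_iff using assms x by simp
  then show ?thesis by blast
qed

lemma companion_pencil_eq_0_iff:
  fixes x :: "('a::complex_normed_vector, 'p::finite) pow"
  shows "companion_pencil \<Phi> z x = 0 \<longleftrightarrow> pencil CARD('p) \<Phi> z (component x 1) = 0 \<and>
    (\<forall>i\<in>{1..CARD('p)}. component x i = z ^ (i - 1) *\<^sub>C component x 1)"
  unfolding companion_pencil_eq_iff
  by (simp add: companion_rhs_eq zero_pow.rep_eq companion_tail_eq_0)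

section \<open>Invertibility and complements for the companion pencil\<close>

lemma op_invertible_companion_pencil:
  fixes \<Phi> :: "nat \<Rightarrow> ('a::cbanach, 'a) cblinfun"
  assumes "op_invertible (pencil CARD('p) \<Phi> z)"
  shows "op_invertible (companion_pencil \<Phi> z :: (('a, 'p::finite) pow, ('a, 'p) pow) cblinfun)"
  unfolding op_invertible_iff_bij
proof (intro conjI allI impI)
  have bij: "\<And>x. pencil CARD('p) \<Phi> z x = 0 \<Longrightarrow> x = 0" "\<And>y. \<exists>x. pencil CARD('p) \<Phi> z x = y"
    using assms by (auto simp: op_invertible_iff_bij)
  fix x :: "('a, 'p) pow"
  show "\<exists>y. companion_pencil \<Phi> z y = x" using bij(2) companion_pencil_solution by metis
  assume "companion_pencil \<Phi> z x = 0"
  then have x: "pencil CARD('p) \<Phi> z (component x 1) = 0"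
    "\<forall>i\<in>{1..CARD('p)}. component x i = z ^ (i - 1) *\<^sub>C component x 1"
    unfolding companion_pencil_eq_0_iff by blast+
  show "x = 0" using x(2) unfolding bij(1)[OF x(1)] by (simp add: pow_eq_iff zero_pow.rep_eq)
qed

lemma csubspace_ran: "csubspace (ran A)"
proof (rule complex_vector.subspaceI)
  show "0 \<in> ran A" unfolding ran_def by (rule range_eqI[of _ _ 0]) simp
next
  fix x y assume "x \<in> ran A" "y \<in> ran A"
  then obtain u v where "x = A u" "y = A v" by (auto simp: ran_def)
  then show "x + y \<in> ran A" unfolding ran_def by (intro range_eqI[of _ _ "u + v"]) simp
next
  fix c x assume "x \<in> ran A"
  then obtain u where "x = A u" by (auto simp: ran_def)
  then show "c *\<^sub>C x \<in> ran A" unfolding ran_def by (intro range_eqI[of _ _ "c *\<^sub>C u"]) simp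
qed

text \<open>A vector is in the range exactly when its \<open>companion_rhs\<close> is in the range
  of the pencil, and on vectors supported in the first slot \<open>companion_rhs\<close> is just
  that entry. So \<open>W\<close> placed in the first slot is a complement; closedness of the range
  comes from continuity of \<open>companion_rhs\<close>.\<close>

lemma is_complement_ran_companion_pencil:
  fixes \<Phi> :: "nat \<Rightarrow> ('a::cbanach, 'a) cblinfun"
  assumes c: "is_complement (ran (pencil CARD('p) \<Phi> z)) W"
  shows "is_complement (ran (companion_pencil \<Phi> z :: (('a, 'p::finite) pow, ('a, 'p) pow) cblinfun))
    {y. component y 1 \<in> W \<and> (\<forall>i>1. component y i = 0)}" (is "is_complement ?R ?W")
  unfolding is_direct_sum_def
proof (intro conjI)
  note D = is_complementD[OF c]
  have cl: "closed (ran (pencil CARD('p) \<Phi> z))" "closed W" using c by (auto simp: is_direct_sum_def)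
  have R: "?R = {y. companion_rhs \<Phi> z y \<in> ran (pencil CARD('p) \<Phi> z)}"
  proof safe
    fix y :: "('a, 'p) pow" assume "y \<in> ?R"
    then obtain x where "companion_pencil \<Phi> z x = y" by (auto simp: ran_def)
    then have "pencil CARD('p) \<Phi> z (component x 1) = companion_rhs \<Phi> z y"
      unfolding companion_pencil_eq_iff by blast
    from this[symmetric]
    show "companion_rhs \<Phi> z y \<in> ran (pencil CARD('p) \<Phi> z)" by (simp add: ran_def)
  next
    fix y :: "('a, 'p) pow" assume "companion_rhs \<Phi> z y \<in> ran (pencil CARD('p) \<Phi> z)"
    then obtain u where "pencil CARD('p) \<Phi> z u = companion_rhs \<Phi> z y" by (auto simp: ran_def)
    from companion_pencil_solution[OF this] show "y \<in> ?R" by (auto simp: ran_def)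
  qed
  show "csubspace ?R" by (rule csubspace_ran)
  show "closed ?R" unfolding R
    using closed_vimage[OF cl(1) continuous_on_companion_rhs] by (simp add: vimage_def)
  show "csubspace ?W"
    by (rule complex_vector.subspaceI) (use D in \<open>auto simp: zero_pow.rep_eq plus_pow.rep_eq scaleC_pow.rep_eq\<close>)
  have W: "?W = (\<lambda>y. component y 1) -` W \<inter> (\<Inter>i\<in>{1<..}. {y. component y i = 0})" by auto
  show "closed ?W" unfolding W
    by (intro closed_Int closed_vimage[OF cl(2)] closed_INT ballI closed_Collect_eq continuous_intros)
  show "?R \<inter> ?W = {0}"
  proof safe
    fix y :: "('a, 'p) pow" assume y: "y \<in> ?R" "component y 1 \<in> W" "\<forall>i>1. component y i = 0"
    then have "component y 1 \<in> ran (pencil CARD('p) \<Phi> z)" by (simp add: R companion_rhs_eq)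
    then have "component y 1 = 0" using D(9) y by blast
    then have "component y i = 0" if "i \<in> {1..CARD('p)}" for i using y(3) that by (cases "i = 1") simp_all
    then show "y = 0" unfolding pow_eq_iff zero_pow.rep_eq by blast
  next
    show "0 \<in> ?R" by (rule complex_vector.subspace_0[OF csubspace_ran])
  qed (use D in \<open>auto simp: zero_pow.rep_eq\<close>)
  show "UNIV = sum_set ?R ?W"
  proof safe
    fix y :: "('a, 'p) pow"
    obtain a b where ab: "a \<in> ran (pencil CARD('p) \<Phi> z)" "b \<in> W" "companion_rhs \<Phi> z y = a + b"
      using D(10) by blast
    \<comment> \<open>\<open>w\<close> carries the \<open>W\<close>-part of
      \<open>companion_rhs\<close>, so subtracting it leaves a vector of the range.\<close>
    define w :: "('a, 'p) pow" where "w = Pow_vec (\<lambda>i. if i \<in> {1..CARD('p)} then (if i = 1 then b else 0) else 0)"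
    have w: "component w 1 = b" "\<And>i. i > 1 \<Longrightarrow> component w i = 0"
      unfolding w_def component_Pow_vec by (auto simp: Suc_le_eq)
    have "companion_rhs \<Phi> z (y - w) = a"
      using ab(3) companion_rhs_eq[OF w(2)] w(1) by (simp only: companion_rhs_diff) simp
    then have "y - w \<in> ?R" using ab by (simp add: R)
    moreover have "w \<in> ?W" using w ab by simp
    moreover have "y = (y - w) + w" by simp
    ultimately show "y \<in> sum_set ?R ?W" unfolding sum_set_def by blast
  qed simp
qed

text \<open>Kernel vectors have entries \<open>z ^ (i - 1) u\<close> with \<open>u\<close> in the
  kernel of the pencil, so constraining the first entry to \<open>W\<close> is enough.\<close>

lemma is_complement_ker_companion_pencil:
  fixes \<Phi> :: "nat \<Rightarrow> ('a::cbanach, 'a) cblinfun"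
  assumes c: "is_complement (ker (pencil CARD('p) \<Phi> z)) W"
  shows "is_complement (ker (companion_pencil \<Phi> z :: (('a, 'p::finite) pow, ('a, 'p) pow) cblinfun))
    {x. component x 1 \<in> W}" (is "is_complement ?K ?W")
  unfolding is_direct_sum_def
proof (intro conjI)
  note D = is_complementD[OF c]
  have cl: "closed W" using c by (auto simp: is_direct_sum_def)
  show "csubspace ?K" by (rule complex_vector.subspaceI) (auto simp: ker_def)
  show "closed ?K" unfolding ker_def by (intro closed_Collect_eq continuous_intros)
  show "csubspace ?W"
    by (rule complex_vector.subspaceI) (use D in \<open>auto simp: zero_pow.rep_eq plus_pow.rep_eq scaleC_pow.rep_eq\<close>)
  have "closed ((\<lambda>x :: ('a, 'p) pow. component x 1) -` W)"
    by (intro closed_vimage[OF cl] continuous_intros)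
  then show "closed ?W" by (simp add: vimage_def)
  show "?K \<inter> ?W = {0}"
  proof safe
    fix x :: "('a, 'p) pow" assume x: "x \<in> ?K" "component x 1 \<in> W"
    then have x': "component x 1 \<in> ker (pencil CARD('p) \<Phi> z)"
      "\<forall>i\<in>{1..CARD('p)}. component x i = z ^ (i - 1) *\<^sub>C component x 1"
      unfolding ker_def mem_Collect_eq companion_pencil_eq_0_iff by blast+
    have x1: "component x 1 = 0" using D(9) x'(1) x(2) by blast
    show "x = 0" using x'(2) unfolding x1 by (simp add: pow_eq_iff zero_pow.rep_eq)
  next
    show "0 \<in> ?K" by (simp add: ker_def)
    show "component 0 1 \<in> W" using D(2) by (simp add: zero_pow.rep_eq)
  qed
  show "UNIV = sum_set ?K ?W"
  proof safe
    fix x :: "('a, 'p) pow"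
    obtain a b where ab: "a \<in> ker (pencil CARD('p) \<Phi> z)" "b \<in> W" "component x 1 = a + b"
      using D(10) by blast
    define k :: "('a, 'p) pow" where "k = Pow_vec (\<lambda>i. if i \<in> {1..CARD('p)} then z ^ (i - 1) *\<^sub>C a else 0)"
    have k: "component k i = z ^ (i - 1) *\<^sub>C a" if "i \<in> {1..CARD('p)}" for i
      using that unfolding k_def component_Pow_vec by simp
    have k1: "component k 1 = a" using k[of 1] by (simp add: Suc_le_eq)
    have "k \<in> ?K" using ab(1) k k1 by (simp add: ker_def companion_pencil_eq_0_iff)
    moreover have "x - k \<in> ?W" using ab k1 by (simp add: minus_pow.rep_eq)
    moreover have "x = k + (x - k)" by simp
    ultimately show "x \<in> sum_set ?K ?W" unfolding sum_set_def by blast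
  qed simp
qed

theorem proposition3p5:
  fixes \<Phi> :: "nat \<Rightarrow> ('a::cbanach, 'a) cblinfun"
    and \<Phi>z :: "complex \<Rightarrow> ('a, 'a) cblinfun"
    and \<Phi>t :: "complex \<Rightarrow> (('a, 'p::finite) pow, ('a, 'p) pow) cblinfun"
    and N :: "int \<Rightarrow> (('a, 'p) pow, ('a, 'p) pow) cblinfun"
    and Pt :: "(('a, 'p) pow, ('a, 'p) pow) cblinfun"
    and \<eta> :: real and Ran_c Ker_c R R_c K K_c :: "'a set"
  assumes separable: "separable_space (euclidean :: 'a topology)"
    and \<Phi>z: "\<Phi>z = pencil CARD('p) \<Phi>"
    and \<Phi>t: "\<Phi>t = companion_pencil \<Phi>"
    and N: "N = (\<lambda>j. - laurent_coeff (\<lambda>z. op_inverse (\<Phi>t z)) 1 j)"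
    and Pt: "Pt = N (-1) o\<^sub>C companion \<Phi>"
    and "\<eta> > 0"
    and "pencil_spectrum \<Phi>z \<inter> ball 0 (1 + \<eta>) = {1}"
    and "\<Phi>z 1 \<noteq> 0"
    and "is_complement (ran (\<Phi>z 1)) Ran_c"
    and "is_complement (ker (\<Phi>z 1)) Ker_c"
    and "\<And>ip. norm_inner_product ip \<Longrightarrow>
      Ran_c = orthogonal_complement_wrt ip (ran (\<Phi>z 1)) \<and>
      Ker_c = orthogonal_complement_wrt ip (ker (\<Phi>z 1))"
    and "\<not> is_direct_sum UNIV (ran (\<Phi>t 1)) (ker (\<Phi>t 1))"
    and R: "R = (\<lambda>x. proj_onto Ran_c (ran (\<Phi>z 1)) (cderiv \<Phi>z 1 x)) ` ker (\<Phi>z 1)"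
    and K: "K = {x \<in> ker (\<Phi>z 1). cderiv \<Phi>z 1 x \<in> ran (\<Phi>z 1)}"
    and "is_direct_sum Ran_c R R_c"
    and "is_direct_sum (ker (\<Phi>z 1)) K K_c"
  shows "(has_pole_of_order (\<lambda>z. op_inverse (\<Phi>t z)) 1 2 \<longleftrightarrow> I2_condition (\<Phi>t 1)) \<and>
    (I2_condition (\<Phi>t 1) \<longrightarrow>
      ran (N (-2)) = ran (\<Phi>t 1) \<inter> ker (\<Phi>t 1) \<and>
      (\<exists>\<epsilon>>0. \<exists>G H.
        vholomorphic_on G (ball 0 (1 + \<epsilon>)) \<and>
        (\<forall>z\<in>ball 0 (1 + \<epsilon>) - {1}.
           op_invertible (\<Phi>t z) \<and> G z = (1 - z)\<^sup>2 *\<^sub>C op_inverse (\<Phi>t z)) \<and>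
        vholomorphic_on H (ball 0 (1 + \<epsilon>)) \<and>
        (\<forall>\<^sub>F z in nhds 1. (\<lambda>j. (z - 1) ^ j *\<^sub>C N (int j)) sums (- H z)) \<and>
        (\<forall>z\<in>ball 0 (1 + \<epsilon>).
           G z = - N (-2) + (1 - z) *\<^sub>C (N (-2) + Pt) + (1 - z)\<^sup>2 *\<^sub>C H z) \<and>
        maclaurin_series_converges_on G (ball 0 (1 + \<epsilon>)) \<and>
        maclaurin_series_converges_on H (ball 0 (1 + \<epsilon>))))"
proof -
  define T :: "(('a, 'p) pow, ('a, 'p) pow) cblinfun" where "T = companion \<Phi>"
  define A where "A = id_cblinfun - T"
  have \<Phi>t_eq: "\<Phi>t z = id_cblinfun - z *\<^sub>C T" for z by (simp add: \<Phi>t companion_pencil_def T_def)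
  have \<Phi>t1: "\<Phi>t 1 = A" by (simp add: \<Phi>t_eq A_def)
  have inv: "\<forall>z\<in>ball 0 (1 + \<eta>) - {1}. op_invertible (id_cblinfun - z *\<^sub>C T)"
  proof
    fix z :: complex assume "z \<in> ball 0 (1 + \<eta>) - {1}"
    then have "op_invertible (pencil CARD('p) \<Phi> z)"
      using \<open>pencil_spectrum \<Phi>z \<inter> ball 0 (1 + \<eta>) = {1}\<close> unfolding \<Phi>z pencil_spectrum_def by blast
    then have "op_invertible (\<Phi>t z)" unfolding \<Phi>t by (rule op_invertible_companion_pencil)
    then show "op_invertible (id_cblinfun - z *\<^sub>C T)" by (simp add: \<Phi>t_eq)
  qed
  have "z \<in> ball 0 (1 + \<eta>)" if "z \<in> ball 1 \<eta>" for z :: complex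
    using that norm_triangle_ineq[of 1 "z - 1"] by (simp add: dist_norm norm_minus_commute)
  then have inv1: "\<forall>z\<in>ball 1 \<eta> - {1}. op_invertible (id_cblinfun - z *\<^sub>C T)" using inv by blast
  \<comment> \<open>Complements in the product space provide the choice that I(2) asks for once a
    double pole is given.\<close>
  obtain Rc where Rc: "is_complement (ran A) Rc"
    using is_complement_ran_companion_pencil \<open>is_complement (ran (\<Phi>z 1)) Ran_c\<close>
    unfolding \<Phi>z \<Phi>t1[symmetric] \<Phi>t by blast
  obtain Kc where Kc: "is_complement (ker A) Kc"
    using is_complement_ker_companion_pencil \<open>is_complement (ker (\<Phi>z 1)) Ker_c\<close>
    unfolding \<Phi>z \<Phi>t1[symmetric] \<Phi>t by blast
  have "I2_condition A" if pole: "has_pole_of_order (\<lambda>z. op_inverse (\<Phi>t z)) 1 2"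
  proof -
    obtain C where "has_laurent_series (\<lambda>z. op_inverse (id_cblinfun - z *\<^sub>C T)) 1 C"
      "C (- 2) \<noteq> 0" "\<forall>j< - 2. C j = 0"
      using pole unfolding \<Phi>t_eq has_pole_of_order_def by auto
    then show ?thesis
      unfolding A_def using I2_condition_if_double_pole[OF _ _ _ \<open>\<eta> > 0\<close> inv1 Rc[unfolded A_def] Kc[unfolded A_def]]
      by blast
  qed
  moreover have "has_pole_of_order (\<lambda>z. op_inverse (\<Phi>t z)) 1 2 \<and>
      ran (N (-2)) = ran A \<inter> ker A \<and>
      (\<exists>\<epsilon>>0. \<exists>G H.
        vholomorphic_on G (ball 0 (1 + \<epsilon>)) \<and>
        (\<forall>z\<in>ball 0 (1 + \<epsilon>) - {1}.
           op_invertible (\<Phi>t z) \<and> G z = (1 - z)\<^sup>2 *\<^sub>C op_inverse (\<Phi>t z)) \<and>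
        vholomorphic_on H (ball 0 (1 + \<epsilon>)) \<and>
        (\<forall>\<^sub>F z in nhds 1. (\<lambda>j. (z - 1) ^ j *\<^sub>C N (int j)) sums (- H z)) \<and>
        (\<forall>z\<in>ball 0 (1 + \<epsilon>).
           G z = - N (-2) + (1 - z) *\<^sub>C (N (-2) + Pt) + (1 - z)\<^sup>2 *\<^sub>C H z) \<and>
        maclaurin_series_converges_on G (ball 0 (1 + \<epsilon>)) \<and>
        maclaurin_series_converges_on H (ball 0 (1 + \<epsilon>)))" if I2: "I2_condition A"
  proof -
    obtain C H c where C: "has_laurent_series (\<lambda>z. op_inverse (id_cblinfun - z *\<^sub>C T)) 1 C"
        "C (- 2) \<noteq> 0" "\<forall>j< - 2. C j = 0"
      and H: "power_series_on H (1 + \<eta>) c" "\<forall>\<^sub>F z in nhds 1. (\<lambda>j. (z - 1) ^ j *\<^sub>C C (int j)) sums H z"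
      and G: "\<And>z. z \<in> ball 0 (1 + \<eta>) - {1} \<Longrightarrow> (1 - z)\<^sup>2 *\<^sub>C op_inverse (id_cblinfun - z *\<^sub>C T) =
        C (- 2) - (1 - z) *\<^sub>C (C (- 2) + (C (- 1) o\<^sub>C T)) + (1 - z)\<^sup>2 *\<^sub>C H z"
      using double_pole_expansion[OF I2[unfolded A_def] \<open>\<eta> > 0\<close> inv] by blast
    have NC: "N j = - C j" for j using laurent_coeff_eq[OF C(1)] by (simp add: N \<Phi>t_eq)
    have Pt_eq: "Pt = - (C (- 1) o\<^sub>C T)"
      by (simp add: Pt NC T_def bounded_bilinear.minus_left[OF bounded_bilinear_cblinfun_compose])
    have "has_pole_of_order (\<lambda>z. op_inverse (\<Phi>t z)) 1 2"
      unfolding has_pole_of_order_def \<Phi>t_eq using C by (auto intro!: exI[of _ C])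
    moreover have "ran (N (- 2)) = ran A \<inter> ker A"
    proof -
      have "ran (N (- 2)) = ran (C (- 2))"
      proof safe
        fix x assume "x \<in> ran (N (- 2))"
        then obtain y where "x = C (- 2) (- y)" by (auto simp: ran_def NC uminus_cblinfun.rep_eq)
        then show "x \<in> ran (C (- 2))" unfolding ran_def by (rule range_eqI)
      next
        fix x assume "x \<in> ran (C (- 2))"
        then obtain y where "x = N (- 2) (- y)" by (auto simp: ran_def NC uminus_cblinfun.rep_eq)
        then show "x \<in> ran (N (- 2))" unfolding ran_def by (rule range_eqI)
      qed
      then show ?thesis using ran_double_pole_coeff[OF C(1,3) \<open>\<eta> > 0\<close> inv1] by (simp add: A_def)
    qed
    \<comment> \<open>Defining \<open>G\<close> by the expansion makes it holomorphic at 1 as well;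
      it is compared with the resolvent only away from 1, where the inverse exists. The given
      \<open>\<eta>\<close> serves as \<open>\<epsilon>\<close>.\<close>
    moreover define G where "G z = - N (-2) + (1 - z) *\<^sub>C (N (-2) + Pt) + (1 - z)\<^sup>2 *\<^sub>C H z" for z
    obtain d where d: "power_series_on G (1 + \<eta>) d"
    proof -
      obtain d1 where d1: "power_series_on (\<lambda>z. (1 - z) *\<^sub>C (N (-2) + Pt)) (1 + \<eta>) d1"
        using power_series_on_mult_one_minus[OF power_series_on_const] by blast
      obtain d2 where "power_series_on (\<lambda>z. (1 - z) *\<^sub>C H z) (1 + \<eta>) d2"
        using power_series_on_mult_one_minus[OF H(1)] by blast
      then obtain d3 where d3: "power_series_on (\<lambda>z. (1 - z) *\<^sub>C (1 - z) *\<^sub>C H z) (1 + \<eta>) d3"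
        using power_series_on_mult_one_minus by blast
      show thesis
        by (rule that, rule power_series_on_cong,
            rule power_series_on_add[OF power_series_on_add[OF power_series_on_const d1] d3])
          (simp add: G_def power2_eq_square scaleC_scaleC)
    qed
    moreover have "\<forall>z\<in>ball 0 (1 + \<eta>) - {1}. op_invertible (\<Phi>t z) \<and> G z = (1 - z)\<^sup>2 *\<^sub>C op_inverse (\<Phi>t z)"
    proof
      fix z :: complex assume z: "z \<in> ball 0 (1 + \<eta>) - {1}"
      then have "op_invertible (\<Phi>t z)" using inv by (simp add: \<Phi>t_eq)
      moreover have "G z = (1 - z)\<^sup>2 *\<^sub>C op_inverse (\<Phi>t z)"
        unfolding \<Phi>t_eq G[OF z] by (simp add: G_def NC Pt_eq scaleC_add_right algebra_simps)
      ultimately show "op_invertible (\<Phi>t z) \<and> G z = (1 - z)\<^sup>2 *\<^sub>C op_inverse (\<Phi>t z)" by blast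
    qed
    moreover have "\<forall>\<^sub>F z in nhds 1. (\<lambda>j. (z - 1) ^ j *\<^sub>C N (int j)) sums (- H z)"
      using H(2) by eventually_elim (simp add: NC sums_minus)
    moreover have "\<forall>z\<in>ball 0 (1 + \<eta>). G z = - N (-2) + (1 - z) *\<^sub>C (N (-2) + Pt) + (1 - z)\<^sup>2 *\<^sub>C H z"
      by (simp add: G_def)
    ultimately show ?thesis
      using \<open>\<eta> > 0\<close> power_series_on_deriv(1)[OF d] power_series_on_maclaurin[OF d]
        power_series_on_deriv(1)[OF H(1)] power_series_on_maclaurin[OF H(1)] by blast
  qed
  ultimately show ?thesis unfolding \<Phi>t1 by blast
qed

end
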